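(* Let $K$ be a field, $n\ge 2$, $R=K[x_1,\dots,x_n]$, and let $F\in R^{l\times m}$ with $l\le m$ be of full row rank. Let $g_1=x_1-f_1(x_2,\dots,x_n)$ and $g_2=x_2-f_2(x_3,\dots,x_n)$ with $f_1\in K[x_2,\dots,x_n]$, $f_2\in K[x_3,\dots,x_n]$, and suppose $d_l(F)=g_1^{p}g_2^{q}$, where $p,q$ are positive integers. Then $F$ is equivalent to its Smith normal form if and only if $J_k(F)=R$ for all $k=1,2,\dots,l$.
   Context: For a matrix $F$ over $R$ of normal rank $r$ (rank over the fraction field of $R$; full row rank means $r=l$) and $1\le i\le r$, $d_i(F)$ denotes the greatest common divisor of all $i\times i$ minors of $F$ (determined up to a nonzero constant of $K$; equalities of g.c.d.s are understood in this sense), and $d_0(F)=1$. The reduced $i$-th order minors of $F$ are the $i\times i$ minors of $F$ divided by $d_i(F)$, and $J_i(F)$ is the ideal of $R$ generated by them. The Smith normal form of $F\in R^{l\times m}$ ($l\le m$) of normal rank $r$ is the $l\times m$ matrix $(\mathrm{diag}\{\Phi_1,\dots,\Phi_l\}\ \ 0_{l\times(m-l)})$ with $\Phi_i=d_i(F)/d_{i-1}(F)$ for $1\le i\le r$ and $\Phi_i=0$ for $i>r$; it satisfies $\Phi_1\mid\Phi_2\mid\cdots\mid\Phi_r$. A square matrix over $R$ is unimodular if its determinant is a unit of $R$ (a nonzero constant). Two matrices $F_1,F_2\in R^{l\times m}$ are equivalent if $F_2=MF_1N$ for some unimodular $M\in R^{l\times l}$ and $N\in R^{m\times m}$. *)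

theory Defs
  imports
    "HOL-Library.Poly_Mapping"
    "HOL-Library.Numeral_Type"
    "HOL-Computational_Algebra.Polynomial_Factorial"
    "Jordan_Normal_Form.Determinant"
    "Jordan_Normal_Form.DL_Submatrix"
    "Jordan_Normal_Form.DL_Rank"
begin

section \<open>Polynomials in finitely many variables\<close>

text \<open>The variables are indexed by a finite type \<^typ>\<open>'n\<close>, so that the type below is the ring
  \<open>K[x\<^sub>1, \<dots>, x\<^sub>n]\<close> with \<open>n = CARD('n)\<close>. The library needs a linear order on \<^typ>\<open>'n\<close> to make the
  polynomials an integral domain; the same order numbers the variables.\<close>

type_synonym ('n, 'k) mpoly = "('n \<Rightarrow>\<^sub>0 nat) \<Rightarrow>\<^sub>0 'k"

text \<open>Numbering starts at 1; only \<open>1 \<le> k \<le> CARD('n)\<close> is meaningful.\<close>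

definition var_index :: "nat \<Rightarrow> 'n :: {finite, linorder}"
  where "var_index k = sorted_list_of_set (UNIV :: 'n set) ! (k - 1)"

definition x_var :: "nat \<Rightarrow> ('n :: {finite, linorder}, 'k :: field) mpoly"
  where "x_var k = Poly_Mapping.single (Poly_Mapping.single (var_index k) 1) 1"

text \<open>The subring \<open>K[x\<^sub>k, \<dots>, x\<^sub>n]\<close>, which is \<open>K\<close> for \<open>k = n + 1\<close>.\<close>

definition polys_from :: "nat \<Rightarrow> ('n :: {finite, linorder}, 'k :: field) mpoly set"
  where "polys_from k = {f. \<forall>t \<in> Poly_Mapping.keys f. Poly_Mapping.keys t \<subseteq> var_index ` {k..CARD('n)}}"

section \<open>Greatest common divisors and ideals\<close>

text \<open>Greatest common divisors are determined up to units only, hence a relation; the polynomial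
  type has no \<open>gcd\<close> operation in the library.\<close>

definition is_gcd_of :: "'a :: idom set \<Rightarrow> 'a \<Rightarrow> bool"
  where "is_gcd_of A d \<longleftrightarrow> (\<forall>a \<in> A. d dvd a) \<and> (\<forall>c. (\<forall>a \<in> A. c dvd a) \<longrightarrow> c dvd d)"

text \<open>Meaningful if \<open>b \<noteq> 0\<close> and \<open>b dvd a\<close>.\<close>

definition exact_quot :: "'a :: idom \<Rightarrow> 'a \<Rightarrow> 'a"
  where "exact_quot a b = (THE c. a = b * c)"

definition ideal_generated :: "'a :: idom set \<Rightarrow> 'a set"
  where "ideal_generated A = Modules.module.span (*) A"

section \<open>Minors, determinantal divisors and the Smith normal form\<close>

definition normal_rank :: "'a :: idom mat \<Rightarrow> nat"
  where "normal_rank F = vec_space.rank (dim_row F) (map_mat to_fract F)"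

definition minors :: "nat \<Rightarrow> 'a :: idom mat \<Rightarrow> 'a set"
  where "minors i F = {det (submatrix F I J) | I J.
           I \<subseteq> {..<dim_row F} \<and> J \<subseteq> {..<dim_col F} \<and> card I = i \<and> card J = i}"

text \<open>\<open>d\<^sub>i(F)\<close>: some choice among the associated greatest common divisors of the \<open>i \<times> i\<close> minors.
  The ideals and the equivalence class of the Smith form below do not depend on the choice.\<close>

definition minor_gcd :: "nat \<Rightarrow> 'a :: idom mat \<Rightarrow> 'a"
  where "minor_gcd i F = (if i = 0 then 1 else (SOME d. is_gcd_of (minors i F) d))"

definition reduced_minors :: "nat \<Rightarrow> 'a :: idom mat \<Rightarrow> 'a set"
  where "reduced_minors i F = (\<lambda>a. exact_quot a (minor_gcd i F)) ` minors i F"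

definition reduced_ideal :: "nat \<Rightarrow> 'a :: idom mat \<Rightarrow> 'a set"
  where "reduced_ideal i F = ideal_generated (reduced_minors i F)"

definition invariant_factor :: "nat \<Rightarrow> 'a :: idom mat \<Rightarrow> 'a"
  where "invariant_factor i F =
    (if 1 \<le> i \<and> i \<le> normal_rank F then exact_quot (minor_gcd i F) (minor_gcd (i - 1) F) else 0)"

text \<open>Matrix indices start at 0, the invariant factors at 1.\<close>

definition smith_form :: "'a :: idom mat \<Rightarrow> 'a mat"
  where "smith_form F = mat (dim_row F) (dim_col F)
           (\<lambda>(i, j). if i = j then invariant_factor (i + 1) F else 0)"

section \<open>Equivalence of matrices\<close>

definition unimodular :: "'a :: idom mat \<Rightarrow> bool"
  where "unimodular M \<longleftrightarrow> square_mat M \<and> det M dvd 1"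

definition equivalent_mat :: "'a :: idom mat \<Rightarrow> 'a mat \<Rightarrow> bool"
  where "equivalent_mat F\<^sub>1 F\<^sub>2 \<longleftrightarrow>
    (\<exists>M \<in> carrier_mat (dim_row F\<^sub>1) (dim_row F\<^sub>1). \<exists>N \<in> carrier_mat (dim_col F\<^sub>1) (dim_col F\<^sub>1).
       unimodular M \<and> unimodular N \<and> F\<^sub>2 = M * F\<^sub>1 * N)"

end

theory Submission imports Defs "Jordan_Normal_Form.Ring_Hom_Matrix" "Jordan_Normal_Form.Char_Poly" begin

text \<open>
  Equivalent matrices have the same determinantal ideals, and \<open>J\<^sub>k(F) = R\<close> says that the
  \<open>k\<close>-th determinantal ideal is generated by \<open>d\<^sub>k(F)\<close>; as this holds for the Smith form, necessity
  follows.

  For sufficiency divide \<open>F\<close> by \<open>d\<^sub>1(F)\<close>, so that the entries generate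
  \<open>R\<close>. It is enough to find a row \<open>u\<close> and a column \<open>v\<close> with \<open>u F v = 1\<close>:
  unimodular rows and columns are completable over \<open>R\<close>, so \<open>F\<close> is then equivalent
  to \<open>diag(1, F')\<close>, and induction applies to \<open>F'\<close>. Let \<open>r\<close> and \<open>s\<close>
  be the ranks of \<open>F\<close> modulo \<open>g\<^sub>1\<close> and \<open>g\<^sub>2\<close>, where
  \<open>r \<le> s\<close> by symmetry. Then neither \<open>g\<^sub>1\<close> nor \<open>g\<^sub>2\<close> divides
  \<open>d\<^sub>r(F)\<close>, which is thus a unit, and \<open>d\<^sub>s(F)\<close> divides a power of
  \<open>g\<^sub>1\<close> modulo \<open>g\<^sub>2\<close>. A matrix of rank \<open>k\<close> whose
  \<open>k\<close>-th determinantal ideal is principal has a projective image up to the generator, and projective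
  modules are free. Modulo \<open>g\<^sub>2\<close> this allows row operations after which only the first
  \<open>s\<close> rows of \<open>F\<close> are nonzero modulo \<open>g\<^sub>2\<close>; modulo
  \<open>g\<^sub>1\<close> it gives a row \<open>u\<close> such that \<open>y = u F\<close> is unimodular modulo
  \<open>g\<^sub>1\<close>. Hence \<open>y\<close> is unimodular modulo \<open>(g\<^sub>1, g\<^sub>2)\<close>, and the
  first \<open>s\<close> entries of \<open>u\<close> are unimodular there, because the others do not contribute. Since
  \<open>F\<close> modulo \<open>g\<^sub>2\<close> has a right inverse up to \<open>d\<^sub>s(F)\<close> on these
  rows, \<open>y\<close> is unimodular modulo \<open>g\<^sub>2\<close>. It is also unimodular after inverting
  \<open>g\<^sub>1 g\<^sub>2\<close>, because \<open>F\<close> has a right inverse up to \<open>d\<^sub>l(F)\<close>,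
  and so it is unimodular.

  The theorem of Quillen and Suslin is proved for idempotent matrices by induction on the number of
  variables: after Nagata's substitution an idempotent becomes free when a monic polynomial is
  inverted, and this reduces freeness to an idempotent in fewer variables and to the completion of
  unimodular columns, for which Vaserstein's argument is used.
\<close>

text \<open>Since g_1 and g_2 have the form x_i - f_i, reduction modulo either is realised as a
  retraction of R onto a subring. A matrix modulo g_1 is then a matrix over R fixed by the
  retraction, and freeness of projective modules is needed over R only. The retractions are chosen
  to commute, so that an equation modulo both factors becomes an equation in R. The obstacle is that
  the row u must serve both factors. Rows found separately modulo g_1 and modulo g_2 would have to
  be glued over R/(g_1, g_2). Instead u is chosen modulo g_1 alone, and the splitting of F modulo
  g_2 makes the same row work there. The condition J_k = R is carried through the induction in the
  form that the k-th determinantal ideal is principal with a generator dividing a power of g_1 g_2.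
  Passing from diag(1, F') to F' merely shifts these ideals. Projective modules are given by
  idempotents because an idempotent and its freeness are finitely many matrix equations, which every
  ring homomorphism preserves. This is what lets substitutions and retractions act on them.\<close>

declare One_nat_def [simp del]

subsection \<open>Matrices of arbitrary format\<close>

text \<open>Finitely supported matrices form a ring without unit, so that ring rewriting applies to products
  of any formats. The format is the predicate \<open>carr\<close>, and the unit matrices \<open>I n\<close> are idempotents.\<close>

typedef (overloaded) 'a fmat =
  "{f :: nat \<Rightarrow> nat \<Rightarrow> 'a::zero. \<exists>n. \<forall>i j. n \<le> i \<or> n \<le> j \<longrightarrow> f i j = 0}"
  morphisms ent Abs_fmat
  by (rule exI[of _ "\<lambda>_ _. 0"]) auto

lemma fmat_eqI: "(\<And>i j. ent A i j = ent B i j) \<Longrightarrow> A = B"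
  by (metis ent_inject ext)

lemma fmat_eq_iff: "A = B \<longleftrightarrow> (\<forall>i j. ent A i j = ent B i j)"
  using fmat_eqI by blast

definition carr :: "nat \<Rightarrow> nat \<Rightarrow> 'a::zero fmat \<Rightarrow> bool"
  where "carr n m A \<longleftrightarrow> (\<forall>i j. n \<le> i \<or> m \<le> j \<longrightarrow> ent A i j = 0)"

lemma carrD: "carr n m A \<Longrightarrow> n \<le> i \<or> m \<le> j \<Longrightarrow> ent A i j = 0"
  by (auto simp: carr_def)

lemma carr_mono: "carr n m A \<Longrightarrow> n \<le> n' \<Longrightarrow> m \<le> m' \<Longrightarrow> carr n' m' A"
  unfolding carr_def by (metis order_trans)

lemma carr_exists: obtains n where "carr n n A"
  using ent[of A] by (auto simp: carr_def)

lemma ent_Abs: assumes "\<And>i j. n \<le> i \<or> m \<le> j \<Longrightarrow> f i j = 0"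
  shows "ent (Abs_fmat f) = f"
  by (rule Abs_fmat_inverse) (use assms in \<open>auto intro!: exI[of _ "max n m"]\<close>)

definition fm :: "nat \<Rightarrow> nat \<Rightarrow> (nat \<Rightarrow> nat \<Rightarrow> 'a) \<Rightarrow> 'a::zero fmat"
  where "fm n m f = Abs_fmat (\<lambda>i j. if i < n \<and> j < m then f i j else 0)"

lemma ent_fm [simp]: "ent (fm n m f) i j = (if i < n \<and> j < m then f i j else 0)"
  unfolding fm_def by (subst ent_Abs[of n m]) auto

lemma carr_fm [simp]: "carr n m (fm n m f)"
  by (auto simp: carr_def)

instantiation fmat :: (comm_ring_1) ring
begin

definition "0 = fm 0 0 (\<lambda>_ _. 0)"
definition "A + B = Abs_fmat (\<lambda>i j. ent A i j + ent B i j)"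
definition "- A = Abs_fmat (\<lambda>i j. - ent A i j)"
definition "A - B = Abs_fmat (\<lambda>i j. ent A i j - ent B i j)"
definition "A * B = Abs_fmat (\<lambda>i j. \<Sum>k | ent A i k \<noteq> 0. ent A i k * ent B k j)"

lemma ent_zero: "ent (0 :: 'a fmat) i j = 0" by (simp add: zero_fmat_def)

lemma ent_add: "ent (A + B :: 'a fmat) i j = ent A i j + ent B i j"
proof -
  obtain n m where "carr n n A" "carr m m B" by (metis carr_exists)
  then show ?thesis unfolding plus_fmat_def
    by (subst ent_Abs[of "max n m" "max n m"]) (auto simp: carr_def)
qed

lemma ent_uminus: "ent (- A :: 'a fmat) i j = - ent A i j"
proof -
  obtain n where "carr n n A" by (metis carr_exists)
  then show ?thesis unfolding uminus_fmat_def
    by (subst ent_Abs[of n n]) (auto simp: carr_def)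
qed

lemma ent_minus: "ent (A - B :: 'a fmat) i j = ent A i j - ent B i j"
proof -
  obtain n m where "carr n n A" "carr m m B" by (metis carr_exists)
  then show ?thesis unfolding minus_fmat_def
    by (subst ent_Abs[of "max n m" "max n m"]) (auto simp: carr_def)
qed

lemma ent_times0: "ent (A * B :: 'a fmat) i j = (\<Sum>k | ent A i k \<noteq> 0. ent A i k * ent B k j)"
proof -
  obtain n m where *: "carr n n A" "carr m m B" by (metis carr_exists)
  have "{k. ent A i k \<noteq> 0} = {}" if "n \<le> i" for i using * that by (auto simp: carr_def)
  with * show ?thesis unfolding times_fmat_def
    by (subst ent_Abs[of n m]) (auto simp: carr_def intro!: sum.neutral)
qed

lemma ent_times: assumes "\<And>k. N \<le> k \<Longrightarrow> ent A i k * ent B k j = 0"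
  shows "ent (A * B :: 'a fmat) i j = (\<Sum>k<N. ent A i k * ent B k j)"
proof -
  obtain n where n: "carr n n A" by (metis carr_exists)
  have "ent (A * B) i j = (\<Sum>k<max n N. ent A i k * ent B k j)"
    unfolding ent_times0 by (rule sum.mono_neutral_left) (use n in \<open>auto simp: carr_def not_le[symmetric]\<close>)
  also have "\<dots> = (\<Sum>k<N. ent A i k * ent B k j)"
    by (rule sum.mono_neutral_right) (use assms in auto)
  finally show ?thesis .
qed

lemma ent_times_carr0: "carr n m A \<Longrightarrow> ent (A * B :: 'a fmat) i j = (\<Sum>k<m. ent A i k * ent B k j)"
  by (rule ent_times) (auto simp: carr_def)

instance
proof
  fix A B C :: "'a fmat"
  obtain a b c where "carr a a A" "carr b b B" "carr c c C" by (metis carr_exists)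
  define N where "N = max a (max b c)"
  have carr: "carr N N A" "carr N N B" "carr N N C"
    using \<open>carr a a A\<close> \<open>carr b b B\<close> \<open>carr c c C\<close> by (auto simp: N_def intro: carr_mono)
  have car2: "carr N N (A * B)" "carr N N (A + B)"
    using carr by (auto simp: carr_def ent_times0 ent_add intro!: sum.neutral)
  note e = carr[THEN ent_times_carr0] car2[THEN ent_times_carr0]
  show "A * B * C = A * (B * C)"
  proof (rule fmat_eqI)
    fix i j
    have "ent (A * B * C) i j = (\<Sum>k<N. (\<Sum>l<N. ent A i l * ent B l k) * ent C k j)"
      unfolding e ..
    also have "\<dots> = (\<Sum>l<N. ent A i l * (\<Sum>k<N. ent B l k * ent C k j))"
      by (simp add: sum_distrib_left sum_distrib_right mult.assoc) (rule sum.swap)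
    also have "\<dots> = ent (A * (B * C)) i j"
      unfolding e ..
    finally show "ent (A * B * C) i j = ent (A * (B * C)) i j" .
  qed
  show "(A + B) * C = A * C + B * C"
    by (rule fmat_eqI) (simp add: ent_add e algebra_simps sum.distrib)
  show "A * (B + C) = A * B + A * C"
    by (rule fmat_eqI) (simp add: ent_add e algebra_simps sum.distrib)
  show "A + B + C = A + (B + C)" "A + B = B + A" "0 + A = A" "- A + A = 0" "A - B = A + - B"
    by (rule fmat_eqI, simp add: ent_zero ent_add ent_minus ent_uminus)+
qed

end

lemmas ent_simps [simp] = ent_zero ent_add ent_uminus ent_minus

lemma ent_times_carr: "carr n m A \<Longrightarrow> ent (A * B) i j = (\<Sum>k<m. ent A i k * ent B k j)"
  by (rule ent_times) (auto simp: carr_def)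

lemma ent_times_carr': "carr n m B \<Longrightarrow> ent (A * B) i j = (\<Sum>k<n. ent A i k * ent B k j)"
  by (rule ent_times) (auto simp: carr_def)

lemma carr_zero [simp]: "carr n m 0" by (simp add: carr_def)
lemma carr_add: "carr n m A \<Longrightarrow> carr n m B \<Longrightarrow> carr n m (A + B)" by (simp add: carr_def)
lemma carr_minus: "carr n m A \<Longrightarrow> carr n m B \<Longrightarrow> carr n m (A - B)" by (simp add: carr_def)
lemma carr_times: "carr n k A \<Longrightarrow> carr l m B \<Longrightarrow> carr n m (A * B)"
  by (simp add: carr_def ent_times0)

definition I :: "nat \<Rightarrow> 'a::comm_ring_1 fmat"
  where "I n = fm n n (\<lambda>i j. if i = j then 1 else 0)"

lemma ent_I [simp]: "ent (I n) i j = (if i = j \<and> i < n then 1 else 0)"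
  by (auto simp: I_def)

lemma carr_I [simp]: "carr n n (I n)" by (simp add: carr_def)

lemma ent_I_times [simp]: "ent (I n * A) i j = (if i < n then ent A i j else 0)"
proof -
  have "ent (I n * A) i j = (\<Sum>k<n. if k = i then ent A i j else 0)"
    unfolding ent_times_carr[OF carr_I] by (rule sum.cong) auto
  then show ?thesis by simp
qed

lemma ent_times_I [simp]: "ent (A * I n) i j = (if j < n then ent A i j else 0)"
proof -
  have "ent (A * I n) i j = (\<Sum>k<n. if k = j then ent A i j else 0)"
    unfolding ent_times_carr'[OF carr_I] by (rule sum.cong) auto
  then show ?thesis by simp
qed

lemma I_0 [simp]: "I 0 = 0" by (rule fmat_eqI) simp

lemma I_times: "carr n m A \<Longrightarrow> I n * A = A" by (rule fmat_eqI) (auto simp: carr_def)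
lemma times_I: "carr n m A \<Longrightarrow> A * I m = A" by (rule fmat_eqI) (auto simp: carr_def)
lemma I_I: "I m * I n = I (min m n)" by (rule fmat_eqI) auto
lemma I_idem [simp]: "I n * I n = I n" by (simp add: I_I)

lemma carr_iff: "carr n m A \<longleftrightarrow> I n * A = A \<and> A * I m = A"
proof
  assume "I n * A = A \<and> A * I m = A"
  then have "ent (I n * A) i j = ent A i j" "ent (A * I m) i j = ent A i j" for i j by simp_all
  then show "carr n m A" unfolding carr_def by (metis ent_I_times ent_times_I leD)
qed (auto simp: I_times times_I)

lemma I_eq_0_iff [simp]: "(I n :: 'a::comm_ring_1 fmat) = 0 \<longleftrightarrow> n = 0"
proof
  assume "(I n :: 'a fmat) = 0"
  then have "ent (I n) 0 0 = ent (0 :: 'a fmat) 0 0" by (rule arg_cong)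
  then show "n = 0" by (simp split: if_splits)
qed simp

section \<open>Scalar multiples, transposes and images under ring homomorphisms\<close>

definition sm :: "'a \<Rightarrow> 'a fmat \<Rightarrow> 'a::comm_ring_1 fmat"
  where "sm c A = Abs_fmat (\<lambda>i j. c * ent A i j)"

lemma ent_sm [simp]: "ent (sm c A) i j = c * ent A i j"
proof -
  obtain n where "carr n n A" by (metis carr_exists)
  then show ?thesis unfolding sm_def
    by (subst ent_Abs[of n n]) (auto simp: carr_def)
qed

lemma sm_times: "sm c A * B = sm c (A * B)"
proof -
  obtain n where "carr n n B" by (metis carr_exists)
  then show ?thesis by (intro fmat_eqI) (simp add: ent_times_carr'[of n n] sum_distrib_left mult.assoc)
qed

lemma times_sm: "A * sm c B = sm c (A * B)"
proof -
  obtain n where "carr n n A" by (metis carr_exists)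
  then show ?thesis by (intro fmat_eqI) (simp add: ent_times_carr[of n n] sum_distrib_left mult.left_commute)
qed

lemma sm_sm: "sm c (sm d A) = sm (c * d) A" by (rule fmat_eqI) (simp add: mult.assoc)
lemma sm_1 [simp]: "sm 1 A = A" by (rule fmat_eqI) simp
lemma sm_0 [simp]: "sm 0 A = 0" by (rule fmat_eqI) simp
lemma sm_zero [simp]: "sm c 0 = 0" by (rule fmat_eqI) simp
lemma sm_add: "sm c (A + B) = sm c A + sm c B" by (rule fmat_eqI) (simp add: algebra_simps)
lemma sm_minus: "sm c (A - B) = sm c A - sm c B" by (rule fmat_eqI) (simp add: algebra_simps)
lemma add_sm: "sm (c + d) A = sm c A + sm d A" by (rule fmat_eqI) (simp add: algebra_simps)
lemma carr_sm: "carr n m A \<Longrightarrow> carr n m (sm c A)" by (simp add: carr_def)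

lemmas sm_simps = sm_times times_sm sm_sm

lemma sm_cancel: fixes c :: "'a::idom" shows "c \<noteq> 0 \<Longrightarrow> sm c A = sm c B \<longleftrightarrow> A = B"
  by (auto simp: fmat_eq_iff)

definition tr :: "'a::zero fmat \<Rightarrow> 'a fmat"
  where "tr A = Abs_fmat (\<lambda>i j. ent A j i)"

lemma ent_tr [simp]: "ent (tr A) i j = ent A j i"
proof -
  obtain n where "carr n n A" by (metis carr_exists)
  then show ?thesis unfolding tr_def by (subst ent_Abs[of n n]) (auto simp: carr_def)
qed

lemma tr_times: "tr (A * B) = tr B * tr A"
proof -
  obtain n where n: "carr n n A" by (metis carr_exists)
  then have "carr n n (tr A)" by (auto simp: carr_def)
  with n show ?thesis
    by (intro fmat_eqI) (simp add: ent_times_carr[of n n] ent_times_carr'[of n n] mult.commute)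
qed

lemma tr_tr [simp]: "tr (tr A) = A" by (rule fmat_eqI) auto
lemma carr_tr: "carr n m A \<Longrightarrow> carr m n (tr A)" by (auto simp: carr_def)

definition fmap :: "('a \<Rightarrow> 'b) \<Rightarrow> 'a::zero fmat \<Rightarrow> 'b::zero fmat"
  where "fmap h A = Abs_fmat (\<lambda>i j. h (ent A i j))"

lemma ent_fmap: "h 0 = 0 \<Longrightarrow> ent (fmap h A) i j = h (ent A i j)"
proof -
  assume h: "h 0 = 0"
  obtain n where "carr n n A" by (metis carr_exists)
  then show ?thesis unfolding fmap_def by (subst ent_Abs[of n n]) (auto simp: carr_def h)
qed

lemma carr_fmap: "h 0 = 0 \<Longrightarrow> carr n m A \<Longrightarrow> carr n m (fmap h A)"
  by (simp add: carr_def ent_fmap)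

context comm_ring_hom
begin

lemma ent_fmap_hom [simp]: "ent (fmap hom A) i j = hom (ent A i j)"
  by (simp add: ent_fmap)

lemma fmap_zero [simp]: "fmap hom 0 = 0" by (rule fmat_eqI) simp
lemma fmap_I [simp]: "fmap hom (I n) = I n" by (rule fmat_eqI) simp
lemma fmap_add: "fmap hom (A + B) = fmap hom A + fmap hom B"
  by (rule fmat_eqI) (simp add: hom_add)
lemma fmap_minus: "fmap hom (A - B) = fmap hom A - fmap hom B"
  by (rule fmat_eqI) (simp add: hom_minus)
lemma fmap_sm: "fmap hom (sm c A) = sm (hom c) (fmap hom A)"
  by (rule fmat_eqI) (simp add: hom_mult)
lemma fmap_times: "fmap hom (A * B) = fmap hom A * fmap hom B"
proof (rule fmat_eqI)
  fix i j
  obtain n where n: "carr n n A" by (metis carr_exists)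
  then have "carr n n (fmap hom A)" by (simp add: carr_fmap)
  with n show "ent (fmap hom (A * B)) i j = ent (fmap hom A * fmap hom B) i j"
    by (simp add: ent_times_carr[of n n] hom_sum hom_mult)
qed
lemma fmap_carr: "carr n m A \<Longrightarrow> carr n m (fmap hom A)" by (simp add: carr_fmap)

lemmas fmap_simps = fmap_add fmap_minus fmap_sm fmap_times
end

text \<open>\<open>ins m n\<close> and \<open>prj m n\<close> are the injection of and the projection onto \<open>n\<close> coordinates
  starting at coordinate \<open>m\<close>; they replace block matrices.\<close>

definition ins :: "nat \<Rightarrow> nat \<Rightarrow> 'a::comm_ring_1 fmat"
  where "ins m n = fm (m + n) n (\<lambda>i j. if i = m + j then 1 else 0)"

definition prj :: "nat \<Rightarrow> nat \<Rightarrow> 'a::comm_ring_1 fmat"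
  where "prj m n = tr (ins m n)"

lemma carr_ins [simp]: "carr (m + n) n (ins m n)" by (simp add: ins_def)
lemma carr_prj [simp]: "carr n (m + n) (prj m n)" by (simp add: prj_def carr_tr)

lemma carr_ins_1 [simp]: "carr (Suc n) n (ins 1 n)" by (metis carr_ins plus_1_eq_Suc)
lemma carr_prj_1 [simp]: "carr n (Suc n) (prj 1 n)" by (metis carr_prj plus_1_eq_Suc)

lemma ent_ins: "ent (ins m n) i j = (if i = m + j \<and> j < n then 1 else 0)"
  by (simp add: ins_def)

lemma ent_prj: "ent (prj m n) i j = (if j = m + i \<and> i < n then 1 else 0)"
  by (simp add: prj_def ent_ins)

lemma ent_prj_times [simp]: "ent (prj m n * A) i j = (if i < n then ent A (m + i) j else 0)"
proof -
  have "ent (prj m n * A) i j = (\<Sum>k<m+n. ent (prj m n) i k * ent A k j)"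
    by (rule ent_times_carr[of n]) simp
  also have "\<dots> = (\<Sum>k<m+n. if k = m + i then (if i < n then ent A (m + i) j else 0) else 0)"
    by (intro sum.cong) (auto simp: ent_prj)
  finally show ?thesis by simp
qed

lemma ent_times_ins [simp]: "ent (A * ins m n) i j = (if j < n then ent A i (m + j) else 0)"
proof -
  have "ent (A * ins m n) i j = ent (tr (prj m n * tr A)) i j"
    by (simp add: tr_times prj_def)
  then show ?thesis by simp
qed

lemma prj_ins: "prj m n * ins m n = I n"
  by (rule fmat_eqI) (auto simp: ent_prj)

lemma ins_prj: "ins m n * prj m n = I (m + n) - I m"
proof (rule fmat_eqI)
  fix i j :: nat
  have "ent (ins m n * prj m n :: 'a fmat) i j = (\<Sum>k<n. ent (ins m n) i k * ent (prj m n) k j)"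
    by (rule ent_times_carr[of "m + n"]) simp
  also have "\<dots> = (\<Sum>k<n. if k = i - m then (if m \<le> i \<and> i = j then 1 else 0) else 0)"
    by (intro sum.cong) (auto simp: ent_ins ent_prj)
  also have "\<dots> = ent (I (m + n) - I m) i j" by auto
  finally show "ent (ins m n * prj m n :: 'a fmat) i j = ent (I (m + n) - I m) i j" .
qed

lemma I_ins: "I m * ins m n = 0"
  by (rule fmat_eqI) (auto simp: ent_ins)

lemma prj_I: "prj m n * I m = 0"
  by (rule fmat_eqI) (auto simp: ent_prj)

lemma (in comm_ring_hom) fmap_ins [simp]: "fmap hom (ins m n) = ins m n"
  by (rule fmat_eqI) (simp add: ent_ins)

lemma (in comm_ring_hom) fmap_prj [simp]: "fmap hom (prj m n) = prj m n"
  by (rule fmat_eqI) (simp add: ent_prj)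

text \<open>With products nested to the right, an equation for \<open>a * b\<close> no longer
  matches in the middle of a product. This form restores it as a rewrite rule.\<close>

lemma mulR: "a * b = c \<Longrightarrow> a * (b * x) = c * (x :: 'a :: semigroup_mult)"
  by (metis mult.assoc)

subsection \<open>Free idempotents and unimodular columns\<close>

text \<open>An idempotent matrix \<open>e\<close> stands for the projective module that is its image.\<close>

definition free :: "'a::comm_ring_1 fmat \<Rightarrow> bool"
  where "free e \<longleftrightarrow> (\<exists>r X Y. X * Y = e \<and> Y * X = I r)"

lemma freeI: "X * Y = e \<Longrightarrow> Y * X = I r \<Longrightarrow> free e"
  unfolding free_def by blast

lemma freeE:
  assumes "free e" "e * e = e" "carr n n e"
  obtains r X Y where "carr n r X" "carr r n Y" "X * Y = e" "Y * X = I r" "e * X = X" "Y * e = Y"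
proof -
  obtain r X Y where XY: "X * Y = e" "Y * X = I r"
    using assms(1) unfolding free_def by blast
  note r = XY XY[THEN mulR] assms(2) assms(2)[THEN mulR]
  show ?thesis
  \<comment> \<open>The factors in \<open>free\<close> carry no format. Multiplying them by
    \<open>e\<close> confines them to the format of \<open>e\<close> and keeps both
    equations.\<close>
  proof (rule that[of r "e * X" "Y * e"])
    have "I n * (e * X) = e * X" using assms(3) by (simp add: I_times mult.assoc[symmetric])
    moreover have "e * X * I r = e * (X * Y) * X" by (simp only: XY(2)[symmetric] mult.assoc)
    ultimately show "carr n r (e * X)" by (simp add: carr_iff r mult.assoc)
    have "Y * e * I n = Y * e" using assms(3) by (simp add: times_I mult.assoc)
    moreover have "I r * (Y * e) = Y * (X * Y) * e" by (simp add: XY(2)[symmetric] mult.assoc)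
    ultimately show "carr r n (Y * e)" by (simp add: carr_iff r mult.assoc)
    have "e * X * (Y * e) = e * (X * Y) * e" by (simp add: mult.assoc)
    then show "e * X * (Y * e) = e" by (simp add: r)
    have "Y * e * (e * X) = Y * (e * e) * X" by (simp add: mult.assoc)
    also have "\<dots> = (Y * X) * (Y * X)" by (simp only: assms(2)) (simp add: XY(1)[symmetric] mult.assoc)
    finally show "Y * e * (e * X) = I r" by (simp add: XY)
    show "e * (e * X) = e * X" "Y * e * e = Y * e" by (simp_all add: r mult.assoc)
  qed
qed

lemma (in comm_ring_hom) free_fmap: "free e \<Longrightarrow> free (fmap hom e)"
  unfolding free_def by (metis fmap_times fmap_I)

text \<open>\<open>S\<close> and \<open>G\<close> are mutually inverse isomorphisms between the
  images of \<open>e\<close> and \<open>k\<close>, so a basis of one image is carried to the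
  other.\<close>

lemma free_transfer:
  assumes "G * S = e" "S * G = k" "S * e = S" "e * e = e" "free k"
  shows "free e"
proof -
  obtain r X Y where XY: "X * Y = k" "Y * X = I r" using assms(5) unfolding free_def by blast
  show ?thesis
  proof (rule freeI)
    have "G * X * (Y * S) = G * (X * Y) * S" by (simp add: mult.assoc)
    also have "\<dots> = (G * S) * (G * S)" by (simp add: XY assms(2)[symmetric] mult.assoc)
    finally show "G * X * (Y * S) = e" by (simp add: assms)
    have "Y * S * (G * X) = Y * (S * G) * X" by (simp add: mult.assoc)
    also have "\<dots> = (Y * X) * (Y * X)" by (simp add: assms(2) XY(1)[symmetric] mult.assoc)
    finally show "Y * S * (G * X) = I r" by (simp add: XY)
  qed
qed

text \<open>Unimodular columns can be completed to invertible matrices. As a column of any length,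
  \<open>I 1\<close> is the first unit column.\<close>

definition hermite :: "'a::comm_ring_1 itself \<Rightarrow> bool"
  where "hermite _ \<longleftrightarrow> (\<forall>n (v :: 'a fmat) w. carr n 1 v \<longrightarrow> carr 1 n w \<longrightarrow> w * v = I 1 \<longrightarrow>
    (\<exists>U U'. carr n n U \<and> carr n n U' \<and> U * U' = I n \<and> U' * U = I n \<and> U * v = I 1))"

text \<open>\<open>I n - v * w\<close> projects onto the kernel of \<open>w\<close>. Once
  \<open>v\<close> is moved to the first unit column, a basis of this kernel can be written
  down.\<close>

lemma hermite_complement:
  assumes "hermite TYPE('a::comm_ring_1)" "carr n 1 v" "carr 1 n w" "w * v = (I 1 :: 'a fmat)"
  obtains X Y where "carr n (n - 1) X" "carr (n - 1) n Y" "X * Y = I n - v * w" "Y * X = I (n - 1)"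
proof (cases n)
  case 0
  then have "v = 0" using assms(2) by (intro fmat_eqI) (auto simp: carr_def)
  then show ?thesis using assms(4) by auto
next
  case (Suc m)
  obtain U U' where U: "carr n n U" "carr n n U'" "U * U' = I n" "U' * U = I n" "U * v = I 1"
    using assms unfolding hermite_def by blast
  \<comment> \<open>In the new coordinates \<open>w\<close> is the row \<open>l\<close> with first
    entry 1. Read as a square matrix, \<open>I n - l\<close> turns each later unit column into an
    element of the kernel of \<open>l\<close>.\<close>
  define l where "l = w * U'"
  have In: "I n = I (1 + m)" by (simp only: Suc plus_1_eq_Suc)
  have c1: "I 1 * l = l" "I 1 * w = w"
    using assms(3) by (simp_all add: l_def carr_iff mult.assoc[symmetric])
  have U1: "U' * I 1 = v" using U assms(2) by (metis carr_iff mult.assoc)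
  have l1: "l * I 1 = I 1"
    unfolding l_def mult.assoc U1 by (rule assms)
  have cs: "carr n m (ins 1 m)" "carr m n (prj 1 m)"
    by (simp_all add: Suc)
  have cl: "carr n n l" "carr 1 n l" using assms(3) U(2) carr_times[OF assms(3) U(2)]
    by (auto simp: l_def Suc intro: carr_mono)
  show ?thesis
  proof (rule that[of "U' * (I n - l) * ins 1 m" "prj 1 m * U"])
    show "carr n (n - 1) (U' * (I n - l) * ins 1 m)" "carr (n - 1) n (prj 1 m * U)"
      using cs U carr_minus[OF carr_I cl(1)] by (auto simp: Suc intro!: carr_times intro: carr_ins_1 carr_prj_1)
    have "U' * (I n - l) * ins 1 m * (prj 1 m * U) = U' * (I n - l) * (ins 1 m * prj 1 m) * U"
      by (simp add: mult.assoc)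
    also have "ins 1 m * prj 1 m = I n - I 1" by (simp only: In ins_prj)
    also have "U' * (I n - l) * (I n - I 1) * U = U' * (I n - l) * U"
    proof -
      have "(I n - l) * (I n - I 1) = (I n - l :: 'a fmat)"
        using l1 cl times_I[OF cl(1)] by (simp add: algebra_simps I_I Suc)
      then show ?thesis by (metis mult.assoc)
    qed
    also have "\<dots> = U' * U - U' * (l * U)"
      using I_times[OF U(1)] by (simp add: algebra_simps)
    also have "U' * (l * U) = U' * I 1 * (l * U)" by (simp add: mult.assoc c1(1)[THEN mulR])
    also have "\<dots> = v * w" unfolding U1 unfolding l_def mult.assoc U(4) times_I[OF assms(3)] ..
    finally show "U' * (I n - l) * ins 1 m * (prj 1 m * U) = I n - v * w" by (simp add: U)
    have "prj 1 m * U * (U' * (I n - l) * ins 1 m) = prj 1 m * ((U * U') * (I n - l)) * ins 1 m"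
      by (simp add: mult.assoc)
    also have "U * U' * (I n - l) = I n - l" using I_times[OF cl(1)] by (simp add: U algebra_simps)
    also have "prj 1 m * (I n - l) * ins 1 m = prj 1 m * ins 1 m - prj 1 m * l * ins 1 m"
      by (simp add: algebra_simps times_I[OF cs(2), THEN mulR])
    also have "prj 1 m * l = 0" by (metis c1(1) prj_I mult.assoc mult_zero_left)
    finally show "prj 1 m * U * (U' * (I n - l) * ins 1 m) = I (n - 1)" by (simp add: prj_ins Suc)
  qed
qed

text \<open>Stably free modules are free over a Hermite ring: the columns of \<open>Z\<close> are
  split off one at a time.\<close>

lemma free_complement:
  assumes "hermite TYPE('a::comm_ring_1)" "carr n N Z" "carr N n L" "L * Z = (I N :: 'a fmat)"
  shows "free (I n - Z * L)"
  using assms(2-)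
proof (induction N arbitrary: n Z L)
  case 0
  then have "Z = 0" by (intro fmat_eqI) (auto simp: carr_def)
  then show ?case by (simp add: freeI[of "I n" "I n" _ n])
next
  case (Suc N)
  define z l Z' L' where "z = Z * I 1" and "l = I 1 * L" and "Z' = Z * ins 1 N" and "L' = prj 1 N * L"
  have cs: "carr (Suc N) N (ins 1 N)" "carr N (Suc N) (prj 1 N)"
    by simp_all
  have c: "carr n 1 z" "carr 1 n l" "carr n N Z'" "carr N n L'"
    unfolding z_def l_def Z'_def L'_def using Suc.prems by (auto intro: carr_times carr_I carr_ins_1 carr_prj_1)
  have lz: "l * z = I 1" "l * Z' = 0" "L' * z = 0" "L' * Z' = I N"
  proof -
    have "l * z = I 1 * (L * Z) * I 1" "l * Z' = I 1 * (L * Z) * ins 1 N"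
      "L' * z = prj 1 N * (L * Z) * I 1" "L' * Z' = prj 1 N * (L * Z) * ins 1 N"
      by (simp_all add: z_def l_def Z'_def L'_def mult.assoc)
    then show "l * z = I 1" "l * Z' = 0" "L' * z = 0" "L' * Z' = I N"
      unfolding Suc.prems(3) times_I[OF cs(2)] by (simp_all add: I_I I_ins prj_I prj_ins)
  qed
  obtain X1 Y1 where 1: "carr n (n - 1) X1" "carr (n - 1) n Y1" "X1 * Y1 = I n - z * l" "Y1 * X1 = I (n - 1)"
    using hermite_complement[OF assms(1) c(1,2) lz(1)] .
  have E: "X1 * Y1 * Z' = Z'" "L' * (X1 * Y1) = L'"
    unfolding 1 using lz c by (simp_all add: algebra_simps I_times times_I lz[THEN mulR])
  define Z2 L2 where "Z2 = Y1 * Z'" and "L2 = L' * X1"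
  have c2: "carr (n - 1) N Z2" "carr N (n - 1) L2" using 1 c by (auto simp: Z2_def L2_def intro: carr_times)
  have "L2 * Z2 = L' * (X1 * Y1 * Z')" by (simp add: mult.assoc Z2_def L2_def)
  then have LZ2: "L2 * Z2 = I N" by (simp add: E lz)
  have "free (I (n - 1) - Z2 * L2)" by (rule Suc.IH[OF c2 LZ2])
  moreover have "(I (n - 1) - Z2 * L2) * (I (n - 1) - Z2 * L2) = I (n - 1) - Z2 * L2"
    by (simp add: algebra_simps LZ2[THEN mulR] I_times[OF c2(1)] I_times[OF c2(1), THEN mulR]
        I_times[OF c2(2)] times_I[OF c2(2)])
  moreover have "carr (n - 1) (n - 1) (I (n - 1) - Z2 * L2)" using c2 by (intro carr_minus carr_times) auto
  ultimately obtain r X2 Y2 where 2: "carr (n - 1) r X2" "X2 * Y2 = I (n - 1) - Z2 * L2" "Y2 * X2 = I r"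
    using freeE by metis
  show ?case
  proof (rule freeI[of "X1 * X2" "Y2 * Y1" _ r])
    have "X1 * X2 * (Y2 * Y1) = X1 * (X2 * Y2) * Y1" by (simp add: mult.assoc)
    also have "\<dots> = X1 * Y1 - (X1 * Y1 * Z') * (L' * (X1 * Y1))"
      unfolding 2(2) Z2_def L2_def
      by (simp add: algebra_simps times_I[OF 1(1), THEN mulR] I_times[OF 1(2)] times_I[OF 1(1)] mult.assoc)
    also have "\<dots> = I n - (z * l + Z' * L')" unfolding E unfolding 1 by (simp add: algebra_simps)
    also have "z * l + Z' * L' = Z * (I 1 + ins 1 N * prj 1 N) * L"
      unfolding z_def l_def Z'_def L'_def by (simp add: algebra_simps mulR[OF I_idem])
    also have "I 1 + ins 1 N * prj 1 N = (I (Suc N) :: 'a fmat)" by (simp add: ins_prj plus_1_eq_Suc)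
    also have "Z * I (Suc N) = Z" using Suc.prems by (simp add: times_I)
    finally show "X1 * X2 * (Y2 * Y1) = I n - Z * L" .
    have "Y2 * Y1 * (X1 * X2) = Y2 * ((Y1 * X1) * X2)" by (simp add: mult.assoc)
    also have "\<dots> = I r" unfolding 1(4) I_times[OF 2(1)] by (rule 2)
    finally show "Y2 * Y1 * (X1 * X2) = I r" .
  qed
qed

subsection \<open>Division by monic polynomials\<close>

interpretation pCons_hom: comm_ring_hom "\<lambda>a :: 'a :: comm_ring_1. [:a:]"
  by unfold_locales (auto simp: one_pCons)

abbreviation cst :: "'a::comm_ring_1 fmat \<Rightarrow> 'a poly fmat"
  where "cst \<equiv> fmap (\<lambda>a. [:a:])"

text \<open>The strict bound covers zero entries without a case distinction, and
  \<open>lowdeg 0\<close> means being zero.\<close>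

definition lowdeg :: "nat \<Rightarrow> 'a::comm_ring_1 poly fmat \<Rightarrow> bool"
  where "lowdeg D M \<longleftrightarrow> (\<forall>i j k. D \<le> k \<longrightarrow> coeff (ent M i j) k = 0)"

lemma lowdeg_0 [simp]: "lowdeg D 0" by (simp add: lowdeg_def)
lemma lowdeg_0_iff [simp]: "lowdeg 0 M \<longleftrightarrow> M = 0"
  by (auto simp: lowdeg_def fmat_eq_iff poly_eq_iff)

lemma lowdeg_times_cst: "lowdeg D M \<Longrightarrow> lowdeg D (M * cst N)"
proof -
  assume *: "lowdeg D M"
  obtain n where "carr n n M" by (metis carr_exists)
  then show ?thesis using * by (simp add: lowdeg_def ent_times_carr coeff_sum)
qed

lemma lowdeg_cst_times: "lowdeg D M \<Longrightarrow> lowdeg D (cst N * M)"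
proof -
  assume *: "lowdeg D M"
  obtain n where "carr n n M" by (metis carr_exists)
  then show ?thesis using * by (simp add: lowdeg_def ent_times_carr' coeff_sum)
qed

lemma lowdeg_exists: obtains k where "lowdeg k M"
proof -
  obtain n where n: "carr n n M" by (metis carr_exists)
  let ?k = "Suc (\<Sum>i<n. \<Sum>j<n. degree (ent M i j))"
  have "coeff (ent M i j) k = 0" if k: "?k \<le> k" for i j k
  proof (cases "i < n \<and> j < n")
    case True
    then have "degree (ent M i j) \<le> (\<Sum>j<n. degree (ent M i j))" by (intro member_le_sum) auto
    also have "\<dots> \<le> (\<Sum>i<n. \<Sum>j<n. degree (ent M i j))"
      using True by (intro member_le_sum[where f = "\<lambda>i. \<Sum>j<n. degree (ent M i j)"]) auto
    finally show ?thesis using k by (intro coeff_eq_0) simp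
  next
    case False
    then show ?thesis using n by (auto simp: carr_def not_less)
  qed
  then show ?thesis by (intro that[of ?k]) (auto simp: lowdeg_def)
qed

lemma poly_monic_div:
  fixes h f :: "'a::idom poly"
  assumes "lead_coeff h = 1"
  shows "\<exists>q. \<forall>k\<ge>degree h. coeff (f - h * q) k = 0"
proof -
  obtain q r where qr: "pseudo_divmod f h = (q, r)" by force
  have "h \<noteq> 0" using assms by auto
  from pseudo_divmod[OF this qr] have *: "f = h * q + r" "r = 0 \<or> degree r < degree h"
    by (simp_all add: assms)
  have "f - h * q = r" by (simp add: *(1))
  moreover have "coeff r k = 0" if "degree h \<le> k" for k using *(2) that by (auto intro: coeff_eq_0)
  ultimately show ?thesis by auto
qed

lemma poly_monic_div_unique:
  fixes h q :: "'a::idom poly"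
  assumes "lead_coeff h = 1" "\<And>k. degree h \<le> k \<Longrightarrow> coeff (h * q) k = 0"
  shows "q = 0"
proof (rule ccontr)
  assume "q \<noteq> 0"
  moreover have "h \<noteq> 0" using assms by auto
  ultimately have "degree (h * q) = degree h + degree q" "h * q \<noteq> 0" by (simp_all add: degree_mult_eq)
  then show False using assms(2)[of "degree (h * q)"] by (metis le_add1 leading_coeff_0_iff)
qed

lemma fmat_monic_div:
  fixes M :: "'a::idom poly fmat"
  assumes "lead_coeff h = 1" "carr n m M"
  obtains Q R where "carr n m Q" "carr n m R" "lowdeg (degree h) R" "M = sm h Q + R"
proof -
  obtain q where q: "\<And>f k. degree h \<le> k \<Longrightarrow> coeff (f - h * q f) k = 0"
    using poly_monic_div[OF assms(1)] by metis
  define Q where "Q = fm n m (\<lambda>i j. q (ent M i j))"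
  show ?thesis
  proof (rule that[of Q "M - sm h Q"])
    show "carr n m Q" by (simp add: Q_def)
    then show "carr n m (M - sm h Q)" by (intro carr_minus carr_sm assms)
    show "lowdeg (degree h) (M - sm h Q)"
      unfolding lowdeg_def
    proof (intro allI impI)
      fix i j k assume k: "degree h \<le> k"
      show "coeff (ent (M - sm h Q) i j) k = 0"
        using q[OF k, of "ent M i j"] carrD[OF assms(2), of i j] by (cases "i < n \<and> j < m") (auto simp: Q_def)
    qed
  qed simp
qed

lemma fmat_monic_div_unique:
  fixes Q :: "'a::idom poly fmat"
  assumes "lead_coeff h = 1" "lowdeg (degree h) R" "lowdeg (degree h) R'" "sm h Q + R = sm h Q' + R'"
  shows "Q = Q'" "R = R'"
proof -
  have "ent Q i j - ent Q' i j = 0" for i j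
  proof (rule poly_monic_div_unique[OF assms(1)])
    fix k assume k: "degree h \<le> k"
    have "ent (sm h Q + R) i j = ent (sm h Q' + R') i j" by (simp only: assms)
    then have "h * (ent Q i j - ent Q' i j) = ent R' i j - ent R i j" by (simp add: algebra_simps)
    then show "coeff (h * (ent Q i j - ent Q' i j)) k = 0" using assms k by (simp add: lowdeg_def)
  qed
  then show "Q = Q'" by (simp add: fmat_eq_iff)
  then show "R = R'" using assms by simp
qed

text \<open>The columns of \<open>monb D r\<close> are the monomial basis of the vectors of length \<open>r\<close> with entries of
  degree less than \<open>D\<close>.\<close>

definition monb :: "nat \<Rightarrow> nat \<Rightarrow> 'a::comm_ring_1 poly fmat"
  where "monb D r = fm r (r * D) (\<lambda>i k. if i = k div D then monom 1 (k mod D) else 0)"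

lemma carr_mon [simp]: "carr r (r * D) (monb D r)" by (simp add: monb_def)

lemma coeff_mon_times:
  assumes "carr (r * D) c M"
  shows "coeff (ent (monb D r * cst M) i j) e = (if i < r \<and> e < D then ent M (i * D + e) j else 0)"
proof -
  have "coeff (ent (monb D r * cst M) i j) e = (\<Sum>k<r*D. coeff (ent (monb D r) i k * [:ent M k j:]) e)"
    by (simp add: ent_times_carr[OF carr_mon] coeff_sum)
  also have "\<dots> = (\<Sum>k<r*D. if k = i * D + e then (if i < r \<and> e < D then ent M (i * D + e) j else 0) else 0)"
  proof (rule sum.cong)
    fix k assume k: "k \<in> {..<r*D}"
    then have D: "D > 0" by (cases D) auto
    then have iff: "i = k div D \<and> e = k mod D \<longleftrightarrow> k = i * D + e \<and> e < D" by auto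
    show "coeff (ent (monb D r) i k * [:ent M k j:]) e
        = (if k = i * D + e then (if i < r \<and> e < D then ent M (i * D + e) j else 0) else 0)"
    proof (cases "k = i * D + e \<and> e < D")
      case True
      have "i < r" using k less_mult_imp_div_less[of k r D] iff True by auto
      have "ent (monb D r) i k = (monom 1 e :: 'a poly)"
        unfolding monb_def ent_fm using k iff True \<open>i < r\<close> by (metis lessThan_iff)
      then show ?thesis using \<open>i < r\<close> True by (simp only: if_True simp_thms) simp
    next
      case False
      then have "\<not> (i = k div D \<and> e = k mod D)" using iff by blast
      then have "coeff (ent (monb D r) i k * [:ent M k j:]) e = 0" by (auto simp: monb_def)
      then show ?thesis using False by auto
    qed
  qed simp
  also have "\<dots> = (if i < r \<and> e < D then ent M (i * D + e) j else 0)"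
  proof -
    have "i * D + e < r * D" if "i < r" "e < D"
    proof -
      have "i * D + e < Suc i * D" using that by simp
      also have "\<dots> \<le> r * D" using that by (intro mult_le_mono1) simp
      finally show ?thesis .
    qed
    then show ?thesis by auto
  qed
  finally show ?thesis .
qed

lemma lowdeg_mon: "carr (r * D) c M \<Longrightarrow> lowdeg D (monb D r * cst M)"
  by (simp add: lowdeg_def coeff_mon_times)

lemma mon_rep:
  assumes "carr r c M" "lowdeg D M"
  obtains M' where "carr (r * D) c M'" "M = monb D r * cst M'"
proof
  let ?M = "fm (r * D) c (\<lambda>k j. coeff (ent M (k div D) j) (k mod D))"
  show c: "carr (r * D) c ?M" by simp
  show "M = monb D r * cst ?M"
  proof (intro fmat_eqI poly_eqI)
    fix i j e
    have "i * D + e < r * D" if "i < r" "e < D"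
    proof -
      have "i * D + e < Suc i * D" using that by simp
      also have "\<dots> \<le> r * D" using that by (intro mult_le_mono1) simp
      finally show ?thesis .
    qed
    then show "coeff (ent M i j) e = coeff (ent (monb D r * cst ?M) i j) e"
      unfolding coeff_mon_times[OF c] using assms by (auto simp: lowdeg_def carr_def not_less)
  qed
qed

lemma mon_inj:
  assumes "carr (r * D) c M" "carr (r * D) c M'" "monb D r * cst M = monb D r * cst M'"
  shows "M = M'"
proof (rule fmat_eqI)
  fix k j
  show "ent M k j = ent M' k j"
  proof (cases "k < r * D")
    case True
    then have "D > 0" by (cases D) auto
    then have "coeff (ent (monb D r * cst N) (k div D) j) (k mod D) = ent N k j" if "carr (r * D) c N" for N :: "'a fmat"
      unfolding coeff_mon_times[OF that] using True by (simp add: less_mult_imp_div_less)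
    from this[OF assms(1)] this[OF assms(2)] show ?thesis by (simp add: assms(3))
  next
    case False
    then show ?thesis using assms by (simp add: carr_def)
  qed
qed

text \<open>Modulo the characteristic matrix \<open>t I - T\<close> the variable acts as the
  constant matrix \<open>T\<close>, so every column of polynomials reduces to a constant
  one.\<close>

lemma fmat_linear_div:
  fixes T :: "'a::comm_ring_1 fmat"
  assumes "carr N N T" "carr N c a"
  obtains y a0 where "carr N c y" "carr N c a0" "a = (sm [:0, 1:] (I N) - cst T) * y + cst a0"
proof -
  let ?x = "[:0, 1:] :: 'a poly"
  have "\<exists>y a0. carr N c y \<and> carr N c a0 \<and> a = (sm ?x (I N) - cst T) * y + cst a0"
    if "carr N c a" "lowdeg k a" for k a
    using that
  proof (induction k arbitrary: a)
    case 0
    then have "a = 0" by simp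
    then show ?case by (intro exI[of _ 0]) simp
  next
    case (Suc k)
    define b a1 where "b = fmap (\<lambda>p. coeff p 0) a" and "a1 = fmap (poly_shift 1) a"
    have shift0: "poly_shift 1 0 = (0 :: 'a poly)" by (rule poly_eqI) (simp add: coeff_poly_shift)
    have a: "a = cst b + sm ?x a1"
      by (intro fmat_eqI poly_eqI) (auto simp: b_def a1_def ent_fmap shift0 coeff_pCons coeff_poly_shift Suc_eq_plus1[symmetric] split: nat.split)
    have cb: "carr N c b" "carr N c a1" using Suc.prems by (auto simp: b_def a1_def carr_fmap shift0)
    moreover have "lowdeg k a1" using Suc.prems(2) by (auto simp: lowdeg_def a1_def ent_fmap shift0 coeff_poly_shift Suc_eq_plus1[symmetric])
    ultimately obtain y a0 where y: "carr N c y" "carr N c a0" "a1 = (sm ?x (I N) - cst T) * y + cst a0"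
      using Suc.IH by blast
    have "a = cst b + sm ?x ((sm ?x (I N) - cst T) * y + cst a0)" using a y(3) by simp
    also have "\<dots> = (sm ?x (I N) - cst T) * (sm ?x y + cst a0) + cst (b + T * a0)"
      using I_times[OF y(1)] I_times[OF pCons_hom.fmap_carr[OF y(2)]]
      by (simp add: algebra_simps pCons_hom.fmap_simps sm_simps sm_add sm_minus)
    finally have "a = (sm ?x (I N) - cst T) * (sm ?x y + cst a0) + cst (b + T * a0)" .
    then show ?case using y cb assms
      by (intro exI[of _ "sm ?x y + cst a0"] exI[of _ "b + T * a0"])
         (auto intro: carr_add carr_times carr_sm pCons_hom.fmap_carr)
  qed
  moreover obtain k where "lowdeg k a" by (rule lowdeg_exists)
  ultimately show ?thesis using assms(2) that by blast
qed

text \<open>On the kernel, multiplication by \<open>t\<close> equals multiplication by the constant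
  matrix \<open>T\<close>, which does not raise degrees. Hence any degree bound can be lowered until
  it is 0.\<close>

lemma fmat_linear_inj:
  fixes T :: "'a::comm_ring_1 fmat"
  assumes "carr N N T" "carr N c y" "(sm [:0, 1:] (I N) - cst T) * y = 0"
  shows "y = 0"
proof -
  have e: "sm [:0, 1:] y = cst T * y"
    using assms(3) I_times[OF assms(2)] by (simp add: algebra_simps sm_simps)
  have "lowdeg k y \<Longrightarrow> y = 0" for k
  proof (induction k)
    case (Suc k)
    have "lowdeg (Suc k) (sm [:0, 1:] y)" unfolding e by (rule lowdeg_cst_times[OF Suc.prems])
    then have "coeff (ent (sm [:0, 1:] y) i j) (Suc l) = 0" if "k \<le> l" for i j l
      using that by (simp add: lowdeg_def del: ent_sm)
    then have "coeff (ent y i j) l = 0" if "k \<le> l" for i j l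
      using that by (simp add: coeff_pCons)
    then show ?case by (intro Suc.IH) (auto simp: lowdeg_def)
  qed simp
  moreover obtain k where "lowdeg k y" by (rule lowdeg_exists)
  ultimately show ?thesis .
qed

subsection \<open>Idempotents that become free after inverting a monic polynomial\<close>

text \<open>Let \<open>e\<close> be an idempotent over \<open>R[t]\<close> that becomes free after inverting the monic polynomial
  \<open>h\<close>. The \<open>R\<close>-module \<open>im e / X R[t]\<^sup>r\<close> is then a direct summand of the vectors
  of degree below \<open>deg h\<close>, with projection \<open>p\<close>. If it is free, multiplication by \<open>t\<close> on it gives a
  square matrix \<open>T\<close>, and the characteristic sequence of \<open>T\<close> resolves \<open>im e\<close> stably freely.\<close>

locale monic_free =
  fixes e X Y :: "'a::idom poly fmat" and h :: "'a poly" and n r :: nat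
  assumes monic: "lead_coeff h = 1"
    and ce: "carr n n e" and cX: "carr n r X" and cY: "carr r n Y"
    and ee: "e * e = e" and XY: "X * Y = sm h e" and YX: "Y * X = sm h (I r)"
    and eX: "e * X = X" and Ye: "Y * e = Y"
begin

abbreviation "D \<equiv> degree h"
abbreviation "B \<equiv> monb D r :: 'a poly fmat"

lemma h0: "h \<noteq> 0" using monic by auto

lemma IB: "I r * B = B" by (rule I_times[OF carr_mon])

lemma YXB: "Y * (X * B) = sm h B"
  by (simp add: mult.assoc[symmetric] YX sm_times IB)

text \<open>As \<open>Y * X\<close> is multiplication by \<open>h\<close>, \<open>Y\<close> embeds
  the quotient \<open>im e / im X\<close> into the vectors modulo \<open>h\<close>, as those
  \<open>B * cst c\<close> for which \<open>h\<close> divides \<open>X * (B * cst c)\<close>. The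
  projection \<open>p\<close> divides \<open>X * B\<close> by \<open>h\<close>, drops the remainder
  and applies \<open>Y\<close> modulo \<open>h\<close>.\<close>

lemma exists_QP:
  "\<exists>Q Rm Q2 p. carr n (r * D) Q \<and> lowdeg D Rm \<and> X * B = sm h Q + Rm \<and>
     carr (r * D) (r * D) p \<and> Y * Q = sm h Q2 + B * cst p"
proof -
  obtain Q Rm where Q: "carr n (r * D) Q" "lowdeg D Rm" "X * B = sm h Q + Rm"
    using fmat_monic_div[OF monic carr_times[OF cX carr_mon]] by metis
  obtain Q2 R2 where R2: "carr r (r * D) R2" "lowdeg D R2" "Y * Q = sm h Q2 + R2"
    using fmat_monic_div[OF monic carr_times[OF cY Q(1)]] by metis
  obtain p where "carr (r * D) (r * D) p" "R2 = B * cst p" using mon_rep[OF R2(1,2)] by metis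
  then show ?thesis using Q R2 by blast
qed

definition "Q = (SOME Q. \<exists>Rm Q2 p. carr n (r * D) Q \<and> lowdeg D Rm \<and> X * B = sm h Q + Rm \<and>
     carr (r * D) (r * D) p \<and> Y * Q = sm h Q2 + B * cst p)"
definition "Rm = X * B - sm h Q"
definition "p = (SOME p. \<exists>Q2. carr (r * D) (r * D) p \<and> Y * Q = sm h Q2 + B * cst p)"
definition "Q2 = (SOME Q2. Y * Q = sm h Q2 + B * cst p)"

lemma QP: "carr n (r * D) Q" "lowdeg D Rm" "X * B = sm h Q + Rm" "carr (r * D) (r * D) p"
  "Y * Q = sm h Q2 + B * cst p"
proof -
  have "\<exists>Rm Q2 p. carr n (r * D) Q \<and> lowdeg D Rm \<and> X * B = sm h Q + Rm \<and>
     carr (r * D) (r * D) p \<and> Y * Q = sm h Q2 + B * cst p"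
    unfolding Q_def by (rule someI_ex) (rule exists_QP)
  then obtain Rm' Q2' p' where 1: "carr n (r * D) Q" "lowdeg D Rm'" "X * B = sm h Q + Rm'"
    "carr (r * D) (r * D) p'" "Y * Q = sm h Q2' + B * cst p'" by blast
  then have "Rm' = Rm" by (simp add: Rm_def)
  with 1 show "carr n (r * D) Q" "lowdeg D Rm" "X * B = sm h Q + Rm" by simp_all
  have ex: "\<exists>Q2. carr (r * D) (r * D) p \<and> Y * Q = sm h Q2 + B * cst p"
    unfolding p_def by (rule someI_ex) (use 1 in blast)
  then show "carr (r * D) (r * D) p" by blast
  from ex have 2: "\<exists>Q2. Y * Q = sm h Q2 + B * cst p" by blast
  show "Y * Q = sm h Q2 + B * cst p" unfolding Q2_def by (rule someI_ex) (rule 2)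
qed

lemma cQP: "carr (r * D) c c0 \<Longrightarrow> carr (r * D) c (p * c0)"
  using QP(4) by (rule carr_times)

text \<open>If \<open>h\<close> divides \<open>X * (B * cst c0)\<close>, the dropped remainder is 0
  by uniqueness of division and \<open>Y * X\<close> returns \<open>h\<close> times the same vector.
  So \<open>p\<close> is the identity on the quotient.\<close>

lemma star:
  assumes c0: "carr (r * D) c c0" and V: "X * (B * cst c0) = sm h V"
  shows "V = Q * cst c0" "p * c0 = c0"
proof -
  have "sm h (Q * cst c0) + Rm * cst c0 = sm h V + 0"
    using V by (simp add: mult.assoc[symmetric] QP(3) algebra_simps sm_simps)
  from fmat_monic_div_unique[OF monic lowdeg_times_cst[OF QP(2)] lowdeg_0 this]
  show V': "V = Q * cst c0" by simp
  have "sm h (Y * V) = Y * (X * (B * cst c0))" by (simp add: V sm_simps)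
  also have "\<dots> = sm h (B * cst c0)" by (simp add: YXB[simplified mult.assoc, THEN mulR] mult.assoc[symmetric] YXB[unfolded mult.assoc[symmetric]] sm_simps)
  finally have "Y * V = B * cst c0" by (simp add: sm_cancel h0)
  moreover have "Y * V = sm h (Q2 * cst c0) + B * cst (p * c0)"
    unfolding V' by (simp add: mult.assoc[symmetric] QP(5) pCons_hom.fmap_times)
       (simp add: algebra_simps sm_simps)
  ultimately have "sm h (Q2 * cst c0) + B * cst (p * c0) = sm h 0 + B * cst c0" by simp
  from fmat_monic_div_unique(2)[OF monic lowdeg_mon[OF cQP[OF c0]] lowdeg_mon[OF c0] this]
  show "p * c0 = c0" by (rule mon_inj[OF cQP[OF c0] c0])
qed

text \<open>The columns of \<open>p\<close> satisfy the divisibility required by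
  \<open>star\<close>, which makes \<open>p\<close> idempotent.\<close>

lemma XBp: "X * (B * cst p) = sm h (e * Q - X * Q2)"
proof -
  have "X * (B * cst p) = X * (Y * Q - sm h Q2)" by (simp add: QP(5))
  also have "\<dots> = sm h (e * Q - X * Q2)"
    by (simp add: right_diff_distrib mult.assoc[symmetric] XY) (simp add: sm_simps sm_minus)
  finally show ?thesis .
qed

lemma p_idem: "p * p = p"
  by (rule star(2)[OF QP(4) XBp])

text \<open>Applied to the retraction \<open>\<phi>\<close> onto the polynomials in fewer variables, this allows induction on the
  number of variables.\<close>

lemma p_fixed:
  assumes "comm_ring_hom \<phi>" "fmap (map_poly \<phi>) X = X" "fmap (map_poly \<phi>) Y = Y" "map_poly \<phi> h = h"
  shows "fmap \<phi> p = p"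
proof -
  interpret phi: comm_ring_hom \<phi> by fact
  interpret map_poly_comm_ring_hom \<phi> ..
  let ?F = "fmap (map_poly \<phi>)"
  have FB: "?F B = B" by (rule fmat_eqI) (simp add: monb_def)
  have Fc: "?F (cst M) = cst (fmap \<phi> M)" for M
    by (intro fmat_eqI poly_eqI) (simp add: coeff_pCons split: nat.split)
  have low: "lowdeg D (?F M)" if "lowdeg D M" for M using that by (simp add: lowdeg_def)
  \<comment> \<open>Applying \<open>\<phi>\<close> to the two divisions that define \<open>Q\<close>
    and \<open>p\<close> gives divisions of the same data, so uniqueness makes \<open>Q\<close> and
    \<open>p\<close> fixed.\<close>
  have "sm h (?F Q) + ?F Rm = ?F (X * B)" by (simp only: QP(3) fmap_simps assms)
  also have "\<dots> = sm h Q + Rm" unfolding fmap_times assms FB by (rule QP(3))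
  finally have FQ: "?F Q = Q" by (rule fmat_monic_div_unique(1)[OF monic low[OF QP(2)] QP(2)])
  have cp: "carr (r * D) (r * D) (fmap \<phi> p)" by (rule phi.fmap_carr[OF QP(4)])
  have "sm h (?F Q2) + B * cst (fmap \<phi> p) = ?F (Y * Q)" by (simp only: QP(5) fmap_simps assms FB Fc)
  also have "\<dots> = sm h Q2 + B * cst p" unfolding fmap_times assms FQ by (rule QP(5))
  finally have "B * cst (fmap \<phi> p) = B * cst p"
    by (rule fmat_monic_div_unique(2)[OF monic lowdeg_mon[OF cp] lowdeg_mon[OF QP(4)]])
  then show ?thesis by (rule mon_inj[OF cp QP(4)])
qed

text \<open>The columns of \<open>V\<close> and \<open>X\<close> generate \<open>im e\<close>, and
  their relations are freely generated by the columns of \<open>Z\<close>, the matrix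
  \<open>t I - T\<close> stacked over \<open>- w\<close>. The resulting splitting makes
  \<open>im e\<close> stably free, and \<open>F\<close> carries it to a ring over which stably free
  modules are free.\<close>

theorem free_if_free_p:
  fixes F :: "'a poly \<Rightarrow> 'b::comm_ring_1"
  assumes F: "comm_ring_hom F" and H: "hermite TYPE('b)" and "free p"
  shows "free (fmap F e)"
proof -
  interpret F: comm_ring_hom F by fact
  obtain N Xi Up where Xi: "carr (r * D) N Xi" "carr N (r * D) Up" "Xi * Up = p" "Up * Xi = I N"
    "p * Xi = Xi" using freeE[OF \<open>free p\<close> p_idem QP(4)] by metis
  \<comment> \<open>The columns of \<open>V\<close> lift a basis of the quotient to
    \<open>im e\<close>, and \<open>C\<close> is their image under \<open>Y\<close>.\<close>
  define V C where "V = (e * Q - X * Q2) * cst Xi" and "C = B * cst Xi"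
  have cXi: "carr (r * D) N (cst Xi)" by (rule pCons_hom.fmap_carr[OF Xi(1)])
  have "I n * V = V" unfolding V_def
    by (simp add: right_diff_distrib mult.assoc[symmetric] I_times[OF ce] I_times[OF cX])
  moreover have "V * I N = V" unfolding V_def by (simp add: mult.assoc times_I[OF cXi])
  ultimately have "carr n N V" by (simp add: carr_iff)
  moreover have "carr r N C" unfolding C_def by (rule carr_times[OF carr_mon cXi])
  ultimately have cV: "carr n N V" "carr r N C" .
  have low: "lowdeg D (C * cst M)" for M
  proof -
    have "lowdeg D C" unfolding C_def by (rule lowdeg_mon[OF Xi(1)])
    then show ?thesis by (rule lowdeg_times_cst)
  qed
  have XC: "X * C = sm h V"
  proof -
    have "X * C = X * (B * cst (p * Xi))" by (simp add: C_def Xi)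
    also have "\<dots> = X * (B * cst p) * cst Xi" by (simp add: pCons_hom.fmap_times mult.assoc)
    also have "\<dots> = sm h V" by (simp add: XBp V_def sm_times)
    finally show ?thesis .
  qed
  have YV: "Y * V = C"
  proof -
    have "sm h (Y * V) = Y * (X * C)" by (simp add: XC sm_simps)
    also have "\<dots> = (Y * (X * B)) * cst Xi" by (simp add: C_def mult.assoc)
    also have "\<dots> = sm h C" by (simp add: YXB C_def sm_simps)
    finally show ?thesis by (simp add: sm_cancel h0)
  qed
  have eV: "e * V = V"
  proof -
    have "sm h (e * V) = (e * X) * C" by (simp add: XC sm_simps mult.assoc)
    then show ?thesis by (simp add: eX XC sm_cancel h0)
  qed
  have rep: "\<exists>S. carr N c S \<and> M = C * cst S"
    if M: "carr r c M" "lowdeg D M" "X * M = sm h W" for M W c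
  proof -
    obtain c0 where c0: "carr (r * D) c c0" "M = B * cst c0" using mon_rep[OF M(1,2)] .
    have "p * c0 = c0" by (rule star(2)[OF c0(1)]) (use M(3) c0 in simp)
    then have "M = B * cst (Xi * (Up * c0))" by (simp add: c0 Xi mult.assoc[symmetric])
    then have "M = C * cst (Up * c0)" by (simp add: C_def pCons_hom.fmap_times mult.assoc)
    then show ?thesis using carr_times[OF Xi(2) c0(1)] by blast
  qed
  \<comment> \<open>The remainder of \<open>Y\<close> modulo \<open>h\<close> is a combination of
    the columns of \<open>C\<close>. Applying \<open>X\<close> and cancelling \<open>h\<close>
    expresses \<open>e\<close> through \<open>V\<close> and \<open>X\<close>.\<close>
  obtain W M where W: "carr r n W" "carr r n M" "lowdeg D M" "Y = sm h W + M"
    using fmat_monic_div[OF monic cY] .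
  have "X * M = X * (Y - sm h W)" by (simp add: W(4))
  also have "\<dots> = sm h (e - X * W)" by (simp add: right_diff_distrib XY sm_simps sm_minus)
  finally have XM: "X * M = sm h (e - X * W)" .
  obtain S0 where S0: "carr N n S0" "M = C * cst S0" using rep[OF W(2,3) XM] by blast
  have gen: "e = V * cst S0 + X * W"
  proof -
    have "sm h (e - X * W) = sm h (V * cst S0)"
      using XM by (simp add: S0(2) mult.assoc[symmetric] XC sm_times)
    then have "e - X * W = V * cst S0" by (simp only: sm_cancel[OF h0])
    then show ?thesis by (simp add: algebra_simps)
  qed
  let ?x = "[:0, 1:] :: 'a poly"
  \<comment> \<open>The same division applied to \<open>t C\<close> yields the matrix
    \<open>T\<close> of multiplication by \<open>t\<close> on the quotient, with correction term
    \<open>X * w\<close>.\<close>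
  obtain w M1 where w: "carr r N w" "carr r N M1" "lowdeg D M1" "sm ?x C = sm h w + M1"
    using fmat_monic_div[OF monic carr_sm[OF cV(2)]] by blast
  have "X * M1 = X * (sm ?x C - sm h w)" by (metis add_diff_cancel_left' w(4))
  also have "\<dots> = sm h (sm ?x V - X * w)"
    by (simp add: right_diff_distrib XC sm_simps sm_minus mult.commute)
  finally have XM1: "X * M1 = sm h (sm ?x V - X * w)" .
  obtain T where T: "carr N N T" "M1 = C * cst T" using rep[OF w(2,3) XM1] by blast
  have act: "sm ?x V = X * w + V * cst T"
  proof -
    have "sm h (sm ?x V - X * w) = sm h (V * cst T)"
      using XM1 by (simp add: T(2) mult.assoc[symmetric] XC sm_times)
    then have "sm ?x V - X * w = V * cst T" by (simp only: sm_cancel[OF h0])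
    then show ?thesis by (simp add: algebra_simps)
  qed
  define tT where "tT = sm ?x (I N) - cst T"
  define i p2 where "i = (ins N r :: 'a poly fmat)" and "p2 = (prj N r :: 'a poly fmat)"
  have ci: "carr (N + r) r i" "carr r (N + r) p2" by (simp_all add: i_def p2_def)
  have ctT: "carr N N tT" unfolding tT_def
    by (intro carr_minus carr_sm carr_I pCons_hom.fmap_carr T(1))
  have VtT: "V * tT = X * w"
    using act times_I[OF cV(1)] by (simp add: tT_def algebra_simps sm_simps)
  have bl: "p2 * i = I r" "I N * i = 0" "p2 * I N = 0" "i * p2 = I (N + r) - I N"
    by (simp_all add: i_def p2_def prj_ins ins_prj I_ins prj_I)
  have "V * i = V * (I N * i)" by (simp only: mult.assoc[symmetric] times_I[OF cV(1)])
  then have Vi: "V * i = 0" by (simp add: bl)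
  have p2N: "p2 * A = 0" if "carr N c A" for A :: "'a poly fmat" and c
  proof -
    have "p2 * A = p2 * I N * A" by (simp only: mult.assoc I_times[OF that])
    then show ?thesis by (simp add: bl)
  qed
  have cS0: "carr N n (cst S0)" by (rule pCons_hom.fmap_carr[OF S0(1)])
  \<comment> \<open>In block form \<open>G\<close> is the row \<open>(V, X)\<close>,
    \<open>S\<close> is a section of it, and \<open>Z\<close> will be its matrix of
    relations.\<close>
  define G S Z where "G = V + X * p2" and "S = cst S0 * e + i * (W * e)" and "Z = tT - i * w"
  have cG: "carr n (N + r) G" "carr (N + r) n S" "carr (N + r) N Z"
    unfolding G_def S_def Z_def using cV(1) cX ci cS0 ce W(1) ctT w(1)
    by (auto intro!: carr_add carr_minus intro: carr_times carr_mono[OF cV(1)] carr_mono[OF carr_times[OF cS0 ce]] carr_mono[OF ctT])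
  have eG: "e * G = G" by (simp add: G_def distrib_left eV mult.assoc[symmetric] eX)
  have Se: "S * e = S" by (simp add: S_def distrib_right mult.assoc ee)
  have GS: "G * S = e"
  proof -
    have "G * S = (V * cst S0 + X * W) * e"
      by (simp add: G_def S_def algebra_simps Vi[THEN mulR] bl[THEN mulR] p2N[OF cS0, THEN mulR] I_times[OF carr_times[OF W(1) ce]])
    then show ?thesis by (simp add: gen[symmetric] ee)
  qed
  have GZ: "G * Z = 0"
    by (simp add: G_def Z_def algebra_simps Vi[THEN mulR] bl[THEN mulR] p2N[OF ctT] VtT I_times[OF w(1)])
  have ker: "\<exists>y. carr N c y \<and> K = Z * y" if K: "carr (N + r) c K" "G * K = 0" for K c
  proof -
    define a b where "a = I N * K" and "b = p2 * K"
    have cab: "carr N c a" "carr r c b"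
      unfolding a_def b_def using carr_times[OF carr_I K(1)] carr_times[OF ci(2) K(1)] by simp_all
    have Kab: "K = a + i * b"
      using I_times[OF K(1)] by (simp add: a_def b_def mult.assoc[symmetric] bl algebra_simps)
    \<comment> \<open>Modulo \<open>Z\<close> the upper part of a relation is a constant
      \<open>a0\<close>. Applying \<open>Y\<close> and comparing quotient and remainder modulo
      \<open>h\<close> shows that nothing else is left.\<close>
    obtain y a0 where y: "carr N c y" "carr N c a0" "a = tT * y + cst a0"
      using fmat_linear_div[OF T(1) cab(1)] unfolding tT_def by blast
    have "V * a + X * b = 0"
      using K(2) unfolding Kab G_def
      by (simp add: algebra_simps Vi[THEN mulR] bl[THEN mulR] p2N[OF cab(1)] I_times[OF cab(2)])
    then have "V * cst a0 + X * (w * y + b) = 0"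
      by (simp add: y(3) algebra_simps VtT[THEN mulR])
    then have "Y * (V * cst a0 + X * (w * y + b)) = 0" by simp
    then have "sm h (w * y + b) + C * cst a0 = sm h 0 + 0"
      using I_times[OF carr_times[OF w(1) y(1)]] I_times[OF cab(2)]
      by (simp add: distrib_left mult.assoc[symmetric] YV YX sm_times add.commute)
         (simp add: distrib_left mult.assoc sm_add algebra_simps)
    from fmat_monic_div_unique[OF monic low lowdeg_0 this]
    have "w * y + b = 0" "C * cst a0 = 0" by simp_all
    have "B * cst (Xi * a0) = B * cst 0"
      using \<open>C * cst a0 = 0\<close> by (simp add: C_def pCons_hom.fmap_times mult.assoc)
    then have "Xi * a0 = 0" by (rule mon_inj[OF carr_times[OF Xi(1) y(2)] carr_zero])
    moreover have "a0 = Up * (Xi * a0)" by (simp only: mult.assoc[symmetric] Xi(4) I_times[OF y(2)])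
    ultimately have "a0 = 0" by simp
    then have "K = tT * y + i * b" by (simp add: Kab y(3))
    also have "b = - (w * y)" using \<open>w * y + b = 0\<close> by (simp add: eq_neg_iff_add_eq_0 add.commute)
    also have "tT * y + i * - (w * y) = Z * y" by (simp add: Z_def algebra_simps)
    finally show ?thesis using y(1) by blast
  qed
  have "G * (I (N + r) - S * G) = 0"
    by (simp add: right_diff_distrib mult.assoc[symmetric] GS eG times_I[OF cG(1)])
  moreover have "carr (N + r) (N + r) (I (N + r) - S * G)"
    using cG by (intro carr_minus carr_times carr_I)
  ultimately obtain L where L: "carr N (N + r) L" "I (N + r) - S * G = Z * L"
    using ker by blast
  have "Z * (L * Z) = (I (N + r) - S * G) * Z" by (simp only: L mult.assoc)
  also have "\<dots> = Z" by (simp add: left_diff_distrib mult.assoc GZ I_times[OF cG(3)])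
  finally have ZLZ: "Z * (L * Z) = Z" .
  \<comment> \<open>So far \<open>Z * L * Z = Z\<close>. The upper block \<open>tT\<close> of
    \<open>Z\<close> is injective, and this cancels \<open>Z\<close> on the left.\<close>
  have INZ: "I N * Z = tT"
    by (simp add: Z_def right_diff_distrib I_times[OF ctT] bl[THEN mulR])
  have "tT * (L * Z - I N) = 0"
    using ZLZ unfolding INZ[symmetric] by (simp add: right_diff_distrib mult.assoc times_I[OF cG(3)])
  moreover have "carr N N (L * Z - I N)" by (intro carr_minus carr_I carr_times[OF L(1) cG(3)])
  ultimately have "L * Z - I N = 0"
    unfolding tT_def by (rule fmat_linear_inj[OF T(1), rotated])
  then have "fmap F L * fmap F Z = I N" by (simp add: F.fmap_times[symmetric])
  then have "free (I (N + r) - fmap F Z * fmap F L)"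
    by (intro free_complement[OF H F.fmap_carr[OF cG(3)] F.fmap_carr[OF L(1)]])
  moreover have "I (N + r) - fmap F Z * fmap F L = fmap F S * fmap F G"
  proof -
    have "fmap F Z * fmap F L = I (N + r) - fmap F S * fmap F G"
      using arg_cong[OF L(2), of "fmap F"] by (simp add: F.fmap_simps)
    then show ?thesis by simp
  qed
  moreover have "fmap F G * fmap F S = fmap F e" "fmap F S * fmap F e = fmap F S" "fmap F e * fmap F e = fmap F e"
    by (simp_all add: F.fmap_times[symmetric] GS Se ee)
  ultimately show ?thesis using free_transfer by metis
qed

end

subsection \<open>Ideals\<close>

definition is_ideal :: "'a::comm_ring_1 set \<Rightarrow> bool"
  where "is_ideal A \<longleftrightarrow> 0 \<in> A \<and> (\<forall>x\<in>A. \<forall>y\<in>A. x + y \<in> A) \<and> (\<forall>r. \<forall>x\<in>A. r * x \<in> A)"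

definition prime_ideal :: "'a::comm_ring_1 set \<Rightarrow> bool"
  where "prime_ideal A \<longleftrightarrow> is_ideal A \<and> 1 \<notin> A \<and> (\<forall>x y. x * y \<in> A \<longrightarrow> x \<in> A \<or> y \<in> A)"

lemma ideal_sum: "is_ideal A \<Longrightarrow> (\<And>i. i \<in> S \<Longrightarrow> f i \<in> A) \<Longrightarrow> sum f S \<in> A"
  by (induction S rule: infinite_finite_induct) (auto simp: is_ideal_def)

lemma ideal_minus: "is_ideal A \<Longrightarrow> x \<in> A \<Longrightarrow> y \<in> A \<Longrightarrow> x - y \<in> A"
proof -
  assume a: "is_ideal A" "x \<in> A" "y \<in> A"
  then have "x + (- 1) * y \<in> A" unfolding is_ideal_def by blast
  then show ?thesis by simp
qed

text \<open>By Zorn's lemma there is an ideal maximal among the proper ideals above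
  \<open>J\<close>, and such an ideal is prime.\<close>

lemma prime_ideal_exists:
  assumes "is_ideal J" "1 \<notin> J"
  shows "\<exists>m. prime_ideal m \<and> J \<subseteq> m"
proof -
  let ?A = "{A. is_ideal A \<and> J \<subseteq> A \<and> 1 \<notin> A}"
  have "\<exists>M\<in>?A. \<forall>X\<in>?A. M \<subseteq> X \<longrightarrow> X = M"
  proof (rule subset_Zorn_nonempty)
    show "?A \<noteq> {}" using assms by auto
    fix C assume C: "C \<noteq> {}" "subset.chain ?A C"
    have "is_ideal (\<Union>C)"
      unfolding is_ideal_def
    proof (intro conjI ballI allI)
      show "0 \<in> \<Union>C" using C by (auto simp: subset.chain_def is_ideal_def)
      fix x assume "x \<in> \<Union>C"
      then obtain A where A: "A \<in> C" "x \<in> A" by blast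
      have "is_ideal A" using A C(2) by (auto simp: subset.chain_def)
      then have "r * x \<in> A" for r using A by (simp add: is_ideal_def)
      then show "r * x \<in> \<Union>C" for r using A by blast
      fix y assume "y \<in> \<Union>C"
      then obtain A' where A': "A' \<in> C" "y \<in> A'" by blast
      have "A \<subseteq> A' \<or> A' \<subseteq> A" using C(2) A A' by (auto simp: subset.chain_def)
      then obtain B where B: "B \<in> C" "x \<in> B" "y \<in> B" using A A' by blast
      then have "is_ideal B" using C(2) by (auto simp: subset.chain_def)
      then have "x + y \<in> B" using B by (simp add: is_ideal_def)
      then show "x + y \<in> \<Union>C" using B by blast
    qed
    then show "\<Union>C \<in> ?A" using C by (auto simp: subset.chain_def)
  qed
  then obtain m where m: "is_ideal m" "J \<subseteq> m" "1 \<notin> m"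
    and max: "\<And>X. is_ideal X \<Longrightarrow> J \<subseteq> X \<Longrightarrow> 1 \<notin> X \<Longrightarrow> m \<subseteq> X \<Longrightarrow> X = m" by auto
  have unit: "\<exists>a\<in>m. \<exists>r. 1 = a + r * x" if "x \<notin> m" for x
  proof -
    let ?X = "{a + r * x | a r. a \<in> m}"
    have X: "a + r * x \<in> ?X" if "a \<in> m" for a r using that by blast
    have "is_ideal ?X"
      unfolding is_ideal_def
    proof (intro conjI ballI allI)
      show "0 \<in> ?X" using X[of 0 0] m by (simp add: is_ideal_def)
      fix y assume "y \<in> ?X"
      then obtain a r where y: "y = a + r * x" "a \<in> m" by blast
      show "s * y \<in> ?X" for s
      proof -
        have "s * a \<in> m" using m(1) y by (simp add: is_ideal_def)
        then have "s * a + (s * r) * x \<in> ?X" by (rule X)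
        moreover have "s * y = s * a + (s * r) * x" by (simp add: y algebra_simps)
        ultimately show ?thesis by (simp only:)
      qed
      fix z assume "z \<in> ?X"
      then obtain b s where z: "z = b + s * x" "b \<in> m" by blast
      show "y + z \<in> ?X"
      proof -
        have "a + b \<in> m" using m(1) y z by (simp add: is_ideal_def)
        then have "(a + b) + (r + s) * x \<in> ?X" by (rule X)
        moreover have "y + z = (a + b) + (r + s) * x" by (simp add: y z algebra_simps)
        ultimately show ?thesis by (simp only:)
      qed
    qed
    moreover have "m \<subseteq> ?X" using X[of _ 0] by auto
    moreover have "x \<in> ?X" using X[of 0 1] m(1) by (simp add: is_ideal_def)
    ultimately have "1 \<in> ?X" using max[of ?X] m(2) that by blast
    then show ?thesis by blast
  qed
  have "x \<in> m \<or> y \<in> m" if "x * y \<in> m" for x y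
  proof (rule ccontr)
    assume "\<not> (x \<in> m \<or> y \<in> m)"
    then obtain a r b s where ab: "a \<in> m" "1 = a + r * x" "b \<in> m" "1 = b + s * y"
      using unit[of x] unit[of y] by blast
    have "(1::'a) = (a + r * x) * (b + s * y)" by (simp add: ab(2,4)[symmetric])
    also have "\<dots> = (b + s * y) * a + (r * x * b + (r * s) * (x * y))" by (simp add: algebra_simps)
    also have "\<dots> \<in> m" using m(1) ab that unfolding is_ideal_def by blast
    finally show False using m by simp
  qed
  then show ?thesis using m by (auto simp: prime_ideal_def)
qed

subsection \<open>Columns over the polynomials over a localisation at a prime\<close>

text \<open>Localisation at a prime \<open>m\<close> is avoided by allowing scalars outside \<open>m\<close> as denominators.\<close>

definition loc_eq :: "nat \<Rightarrow> 'a::idom set \<Rightarrow> 'a poly fmat \<Rightarrow> 'a poly fmat \<Rightarrow> bool"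
  where "loc_eq n m f g \<longleftrightarrow> (\<exists>P Q s. carr n n P \<and> carr n n Q \<and> s \<notin> m \<and>
    P * Q = sm [:s:] (I n) \<and> Q * P = sm [:s:] (I n) \<and> P * f = g)"

lemma loc_eq_trans:
  assumes "prime_ideal m" "loc_eq n m f g" "loc_eq n m g h"
  shows "loc_eq n m f h"
proof -
  obtain P Q s where 1: "carr n n P" "carr n n Q" "s \<notin> m" "P * Q = sm [:s:] (I n)" "Q * P = sm [:s:] (I n)" "P * f = g"
    using assms(2) unfolding loc_eq_def by blast
  obtain P' Q' s' where 2: "carr n n P'" "carr n n Q'" "s' \<notin> m" "P' * Q' = sm [:s':] (I n)" "Q' * P' = sm [:s':] (I n)" "P' * g = h"
    using assms(3) unfolding loc_eq_def by blast
  have "P' * P * (Q * Q') = P' * (P * Q) * Q'" "Q * Q' * (P' * P) = Q * (Q' * P') * P" by (simp_all add: mult.assoc)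
  then have "P' * P * (Q * Q') = sm [:s' * s:] (I n)" "Q * Q' * (P' * P) = sm [:s' * s:] (I n)"
    by (simp_all add: 1 2 sm_simps times_I[OF 2(1)] times_I[OF 1(2)] mult.commute)
  moreover have "s' * s \<notin> m" using 1 2 assms(1) by (auto simp: prime_ideal_def)
  moreover have "P' * P * f = h" by (simp add: mult.assoc 1 2)
  ultimately show ?thesis unfolding loc_eq_def using 1 2 carr_times by blast
qed

lemma loc_eq_unimod:
  assumes "prime_ideal m" "loc_eq n m f g" "carr n 1 f" "carr 1 n w" "s \<notin> m" "w * f = sm [:s:] (I 1)"
  shows "\<exists>w s. carr 1 n w \<and> s \<notin> m \<and> w * g = sm [:s:] (I 1)" "carr n 1 g"
proof -
  obtain P Q s' where 1: "carr n n P" "carr n n Q" "s' \<notin> m" "Q * P = sm [:s':] (I n)" "P * f = g"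
    using assms(2) unfolding loc_eq_def by blast
  have "w * Q * g = w * (Q * P) * f" by (simp add: 1(5)[symmetric] mult.assoc)
  also have "\<dots> = sm [:s' * s:] (I 1)" using times_I[OF assms(4)] by (simp add: 1 sm_simps assms mult.commute)
  finally have "w * Q * g = sm [:s' * s:] (I 1)" .
  moreover have "s' * s \<notin> m" using 1 assms by (auto simp: prime_ideal_def)
  ultimately show "\<exists>w s. carr 1 n w \<and> s \<notin> m \<and> w * g = sm [:s:] (I 1)"
    using carr_times[OF assms(4) 1(2)] by blast
  show "carr n 1 g" using carr_times[OF 1(1) assms(3)] by (simp add: 1)
qed

definition pvt :: "nat \<Rightarrow> nat \<Rightarrow> 'a \<Rightarrow> 'a \<Rightarrow> (nat \<Rightarrow> 'a) \<Rightarrow> 'a::comm_ring_1 fmat"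
  where "pvt n i x y c = fm n n (\<lambda>j k. if j = i then (if k = i then y else 0)
    else if k = j then x else if k = i then c j else 0)"

lemma ent_pvt_times:
  assumes "i < n"
  shows "ent (pvt n i x y c * M) j l = (if j < n then if j = i then y * ent M i l else x * ent M j l + c j * ent M i l else 0)"
proof (cases "j < n")
  case True
  have "ent (pvt n i x y c * M) j l = (\<Sum>k<n. ent (pvt n i x y c) j k * ent M k l)"
    by (rule ent_times_carr[of n]) (simp add: pvt_def)
  also have "\<dots> = (\<Sum>k<n. (if k = i then if j = i then y * ent M i l else c j * ent M i l else 0)
      + (if k = j then if j = i then 0 else x * ent M j l else 0))"
    by (rule sum.cong) (use True in \<open>auto simp: pvt_def\<close>)
  also have "\<dots> = (if j = i then y * ent M i l else x * ent M j l + c j * ent M i l)"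
    using assms True by (auto simp: sum.distrib)
  finally show ?thesis using True by simp
next
  case False
  then show ?thesis by (subst ent_times_carr[of n n]) (simp_all add: pvt_def)
qed

lemma loc_eq_pivot:
  assumes "i < n" "a \<notin> m" "carr n 1 f"
  shows "loc_eq n m f (fm n 1 (\<lambda>j _. if j = i then ent f i 0 else [:a:] * ent f j 0 - c j * ent f i 0))"
proof -
  \<comment> \<open>Exchanging the two diagonal scalars and the sign of \<open>c\<close> inverts the
    row operation up to the factor \<open>a\<close>.\<close>
  let ?P = "pvt n i [:a:] 1 (\<lambda>j. - c j)" and ?Q = "pvt n i 1 [:a:] c"
  have c: "carr n n ?P" "carr n n ?Q" by (simp_all add: pvt_def)
  have "?P * (?Q * I n) = sm [:a:] (I n)" "?Q * (?P * I n) = sm [:a:] (I n)"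
    by (rule fmat_eqI, simp only: ent_pvt_times[OF assms(1)], use assms(1) in auto)+
  then have "?P * ?Q = sm [:a:] (I n)" "?Q * ?P = sm [:a:] (I n)" using c by (simp_all add: times_I)
  moreover have "?P * f = fm n 1 (\<lambda>j _. if j = i then ent f i 0 else [:a:] * ent f j 0 - c j * ent f i 0)"
    by (rule fmat_eqI) (use assms(1) carrD[OF assms(3)] in \<open>auto simp: ent_pvt_times\<close>)
  ultimately show ?thesis unfolding loc_eq_def using c assms(2) by blast
qed

text \<open>All large exponents are allowed, so that one power of the leading coefficient serves
  every entry of a column.\<close>

lemma pseudo_div_powers:
  fixes f g :: "'a::idom poly"
  assumes "degree g \<le> D" "coeff g D \<noteq> 0"
  shows "\<exists>K. \<forall>K'\<ge>K. \<exists>q. \<forall>k\<ge>D. coeff ([:coeff g D ^ K':] * f - q * g) k = 0"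
proof -
  have D: "degree g = D" "g \<noteq> 0" using assms le_degree by fastforce+
  define K where "K = Suc (degree f) - degree g"
  obtain q r where qr: "pseudo_divmod f g = (q, r)" by force
  from pseudo_divmod[OF D(2) qr] D
  have *: "[:coeff g D ^ K:] * f = g * q + r" "r = 0 \<or> degree r < D"
    by (simp_all add: K_def)
  show ?thesis
  proof (intro exI[of _ K] allI impI)
    fix K' assume "K' \<ge> K"
    then have K': "coeff g D ^ K' = coeff g D ^ (K' - K) * coeff g D ^ K" by (metis le_add_diff_inverse2 power_add)
    let ?b = "[:coeff g D ^ (K' - K):]"
    have gen: "b * (g * q + r) - (b * q) * g = b * r" for b by (simp add: algebra_simps)
    have "[:coeff g D ^ K':] * f = ?b * ([:coeff g D ^ K:] * f)" unfolding K' by (simp add: mult.commute)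
    then have e: "[:coeff g D ^ K':] * f - (?b * q) * g = ?b * r" by (simp only: *(1) gen)
    have "coeff (?b * r) k = 0" if "k \<ge> D" for k using *(2) that by (auto intro: coeff_eq_0)
    then show "\<exists>q. \<forall>k\<ge>D. coeff ([:coeff g D ^ K':] * f - q * g) k = 0" using e by metis
  qed
qed

text \<open>Shifting \<open>h\<close> up by one degree and cancelling the new top coefficient with \<open>g\<close> moves a
  coefficient outside \<open>m\<close> one step towards the top.\<close>

lemma raise_coeff:
  fixes g h :: "'a::idom poly"
  assumes m: "prime_ideal m" and g: "degree g \<le> Suc d" "coeff g (Suc d) \<notin> m"
    and h: "\<And>k. Suc d \<le> k \<Longrightarrow> coeff h k = 0" "coeff h k \<notin> m"
  shows "\<exists>u v. coeff (u * g + v * h) d \<notin> m \<and> (\<forall>k\<ge>Suc d. coeff (u * g + v * h) k = 0)"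
proof -
  have idm: "is_ideal m" using m by (simp add: prime_ideal_def)
  then have m0: "0 \<in> m" by (simp add: is_ideal_def)
  have "\<exists>u v. coeff (u * g + v * h) d \<notin> m \<and> (\<forall>k\<ge>Suc d. coeff (u * g + v * h) k = 0)"
    if "\<forall>k\<ge>Suc d. coeff (u * g + v * h) k = 0" "coeff (u * g + v * h) k \<notin> m" "k \<le> d" for u v k
    using that
  proof (induction "d - k" arbitrary: u v k)
    case 0
    then have "k = d" by simp
    then show ?case using 0 by blast
  next
    case (Suc e)
    let ?f = "u * g + v * h"
    show ?case
    proof (cases "coeff ?f d \<in> m")
      case False
      then show ?thesis using Suc by blast
    next
      case True
      let ?a = "coeff g (Suc d)" and ?x = "[:0, 1:] :: 'a poly"
      define u' v' where "u' = [:?a:] * ?x * u - [:coeff ?f d:]" and "v' = [:?a:] * ?x * v"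
      have "smult ?a (pCons 0 ?f) = [:?a:] * ?x * ?f" "smult (coeff ?f d) g = [:coeff ?f d:] * g" by simp_all
      then have e: "u' * g + v' * h = smult ?a (pCons 0 ?f) - smult (coeff ?f d) g"
        unfolding u'_def v'_def by (simp only:) (simp only: algebra_simps)
      have "coeff (u' * g + v' * h) j = 0" if j: "j \<ge> Suc d" for j
      proof (cases "j = Suc d")
        case False
        then have "j = Suc (j - 1)" "j - 1 \<ge> Suc d" using j by auto
        then obtain i where "j = Suc i" "i \<ge> Suc d" by blast
        moreover have "coeff g j = 0" using g False j by (intro coeff_eq_0) simp
        ultimately show ?thesis unfolding e using Suc.prems(1) by (simp add: coeff_pCons)
      qed (simp add: e coeff_pCons)
      moreover have "coeff (u' * g + v' * h) (Suc k) \<notin> m"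
      proof
        assume *: "coeff (u' * g + v' * h) (Suc k) \<in> m"
        have "coeff g (Suc k) * coeff ?f d \<in> m" using True idm by (simp add: is_ideal_def)
        moreover have "?a * coeff ?f k = coeff (u' * g + v' * h) (Suc k) + coeff g (Suc k) * coeff ?f d"
          unfolding e by (simp add: coeff_pCons algebra_simps)
        ultimately have "?a * coeff ?f k \<in> m" using * idm by (simp add: is_ideal_def)
        then show False using m g Suc.prems by (auto simp: prime_ideal_def)
      qed
      ultimately show ?thesis using Suc by (intro Suc.hyps(1)[of "Suc k" u' v']) auto
    qed
  qed
  from this[of 0 1 k] show ?thesis using h m0 by (metis add_0 mult_1 mult_zero_left not_less_eq_eq)
qed

definition unit_col :: "nat \<Rightarrow> nat \<Rightarrow> 'a::comm_ring_1 fmat"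
  where "unit_col n j = fm n 1 (\<lambda>k _. if k = j then 1 else 0)"

text \<open>Otherwise entry \<open>i\<close>, which has positive degree modulo the prime
  \<open>m\<close>, would divide the nonzero constant \<open>s\<close> modulo
  \<open>m\<close>.\<close>

lemma unimod_coeff_not_in:
  fixes f w :: "'a::idom poly fmat"
  assumes m: "prime_ideal m" and f: "carr n 1 f" "carr 1 n w" "s \<notin> m" "w * f = sm [:s:] (I 1)"
    and i: "i < n" "degree (ent f i 0) \<le> Suc d" "coeff (ent f i 0) (Suc d) \<notin> m"
  obtains j k where "j < n" "j \<noteq> i" "coeff (ent f j 0) k \<notin> m"
proof (rule ccontr)
  assume nt: "\<not> thesis"
  note ex = that
  have all: "coeff (ent f j 0) k \<in> m" if "j < n" "j \<noteq> i" for j k using ex[of j k] nt that by blast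
  have idm: "is_ideal m" using m by (simp add: prime_ideal_def)
  note idl = idm[unfolded is_ideal_def]
  define p where "p = ent w 0 i"
  have "[:s:] = ent (w * f) 0 0" using f(4) by simp
  also have "\<dots> = (\<Sum>j<n. ent w 0 j * ent f j 0)" by (rule ent_times_carr[OF f(2)])
  also have "\<dots> = p * ent f i 0 + (\<Sum>j\<in>{..<n}-{i}. ent w 0 j * ent f j 0)"
    using i by (subst sum.remove[of _ i]) (auto simp: p_def)
  finally have s: "[:s:] = p * ent f i 0 + (\<Sum>j\<in>{..<n}-{i}. ent w 0 j * ent f j 0)" .
  have rest: "coeff (\<Sum>j\<in>{..<n}-{i}. ent w 0 j * ent f j 0) k \<in> m" for k
    unfolding coeff_sum coeff_mult by (intro ideal_sum[OF idm]) (use all idl in auto)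
  have pf: "coeff (p * ent f i 0) k \<in> m" if "k > 0" for k
  proof -
    have "coeff (p * ent f i 0) k = 0 - coeff (\<Sum>j\<in>{..<n}-{i}. ent w 0 j * ent f j 0) k"
      using arg_cong[OF s, of "\<lambda>q. coeff q k"] that by (simp add: coeff_pCons eq_neg_iff_add_eq_0 split: nat.splits)
    also have "\<dots> \<in> m" using rest idl by (intro ideal_minus[OF idm]) auto
    finally show ?thesis .
  qed
  have p: "coeff p k \<in> m" for k
  proof (rule ccontr)
    assume "coeff p k \<notin> m"
    \<comment> \<open>\<open>e\<close> is the degree of \<open>p\<close> modulo \<open>m\<close>.
      Its coefficient times the leading coefficient of entry \<open>i\<close> is the only term of
      the product in degree \<open>e + Suc d\<close> that could lie outside
      \<open>m\<close>.\<close>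
    define e where "e = Max {e. coeff p e \<notin> m}"
    have fin: "finite {e. coeff p e \<notin> m}"
      by (rule finite_subset[of _ "{..degree p}"]) (use idl in \<open>auto intro!: le_degree\<close>)
    have e: "coeff p e \<notin> m" using Max_in[OF fin] \<open>coeff p k \<notin> m\<close> unfolding e_def by blast
    have gt: "coeff p u \<in> m" if "e < u" for u
      using Max_ge[OF fin, of u] that unfolding e_def by fastforce
    let ?N = "e + Suc d"
    have eqN: "coeff (p * ent f i 0) ?N
        = coeff p e * coeff (ent f i 0) (Suc d) + (\<Sum>u\<in>{..?N}-{e}. coeff p u * coeff (ent f i 0) (?N - u))"
      unfolding coeff_mult by (subst sum.remove[of _ e]) auto
    have sumN: "(\<Sum>u\<in>{..?N}-{e}. coeff p u * coeff (ent f i 0) (?N - u)) \<in> m"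
    proof (rule ideal_sum[OF idm])
      fix u assume "u \<in> {..?N} - {e}"
      then consider "u > e" | "u < e" by fastforce
      then show "coeff p u * coeff (ent f i 0) (?N - u) \<in> m"
      proof cases
        case 1
        then show ?thesis using gt idl by (subst mult.commute) blast
      next
        case 2
        then have "coeff (ent f i 0) (?N - u) = 0" using i by (intro coeff_eq_0) simp
        then show ?thesis using idl by simp
      qed
    qed
    have "coeff (p * ent f i 0) ?N \<in> m" by (rule pf) simp
    from ideal_minus[OF idm this sumN] have "coeff p e * coeff (ent f i 0) (Suc d) \<in> m"
      by (simp only: eqN add_diff_cancel_right')
    then show False using e i m by (auto simp: prime_ideal_def)
  qed
  have "coeff (p * ent f i 0) 0 + coeff (\<Sum>j\<in>{..<n}-{i}. ent w 0 j * ent f j 0) 0 = s"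
    using arg_cong[OF s, of "\<lambda>q. coeff q 0"] by simp
  moreover have "coeff (p * ent f i 0) 0 \<in> m" unfolding coeff_mult
    by (intro ideal_sum[OF idm], subst mult.commute) (use p idl in blast)
  ultimately have "s \<in> m" using rest[of 0] idl by blast
  then show False using f(3) by simp
qed

text \<open>Horrocks's theorem over a localisation, by induction on the degree of an entry whose
  leading coefficient lies outside \<open>m\<close>. The other entries are reduced below this
  degree. One of them still has a coefficient outside \<open>m\<close>, and together with the pivot
  it produces a combination of degree \<open>d\<close> with leading coefficient outside
  \<open>m\<close>.\<close>

lemma local_horrocks:
  fixes f w :: "'a::idom poly fmat"
  assumes m: "prime_ideal m" and n: "3 \<le> n"
    and "carr n 1 f" "carr 1 n w" "s \<notin> m" "w * f = sm [:s:] (I 1)"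
    and "i < n" "degree (ent f i 0) \<le> d" "coeff (ent f i 0) d \<notin> m"
  shows "\<exists>j t. t \<notin> m \<and> loc_eq n m f (sm [:t:] (unit_col n j))"
  using assms(3-)
proof (induction d arbitrary: f w s i)
  case 0
  then obtain a where a: "ent f i 0 = [:a:]" "a \<notin> m" by (metis degree_eq_zeroE le_zero_eq coeff_pCons_0)
  have "fm n 1 (\<lambda>j _. if j = i then ent f i 0 else [:a:] * ent f j 0 - ent f j 0 * ent f i 0) = sm [:a:] (unit_col n i)"
    by (rule fmat_eqI) (auto simp: unit_col_def a)
  then show ?case using loc_eq_pivot[OF 0(5) a(2) 0(1), of "\<lambda>j. ent f j 0"] a(2) by metis
next
  case (Suc d)
  have idm: "is_ideal m" using m by (simp add: prime_ideal_def)
  note idl = idm[unfolded is_ideal_def]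
  define g a where "g = ent f i 0" and "a = coeff g (Suc d)"
  have g: "degree g \<le> Suc d" "a \<notin> m" "a \<noteq> 0" using Suc.prems idl by (auto simp: g_def a_def)
  have "\<exists>K. \<forall>j<n. \<exists>q. \<forall>k\<ge>Suc d. coeff ([:a ^ K:] * ent f j 0 - q * g) k = 0"
  proof -
    have ex: "\<forall>j. \<exists>K. \<forall>K'\<ge>K. \<exists>q. \<forall>k\<ge>Suc d. coeff ([:a ^ K':] * ent f j 0 - q * g) k = 0"
      using pseudo_div_powers[OF g(1)] g(3) unfolding a_def by blast
    obtain Kf where Kf: "\<And>j K'. K' \<ge> Kf j \<Longrightarrow> \<exists>q. \<forall>k\<ge>Suc d. coeff ([:a ^ K':] * ent f j 0 - q * g) k = 0"
      using ex by metis
    have "Kf j \<le> (\<Sum>j<n. Kf j)" if "j < n" for j using that by (intro member_le_sum) auto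
    then show ?thesis using Kf by blast
  qed
  then obtain K q where q: "\<And>j k. j < n \<Longrightarrow> k \<ge> Suc d \<Longrightarrow> coeff ([:a ^ K:] * ent f j 0 - q j * g) k = 0" by metis
  have aK: "a ^ K \<notin> m"
    using g m by (induction K) (auto simp: prime_ideal_def)
  define f1 where "f1 = fm n 1 (\<lambda>j _. if j = i then g else [:a ^ K:] * ent f j 0 - q j * g)"
  have l1: "loc_eq n m f f1" unfolding f1_def g_def using loc_eq_pivot[OF Suc.prems(5) aK Suc.prems(1)] .
  obtain w1 s1 where w1: "carr 1 n w1" "s1 \<notin> m" "w1 * f1 = sm [:s1:] (I 1)" and c1: "carr n 1 f1"
    using loc_eq_unimod[OF m l1 Suc.prems(1-4)] by blast
  have f1i: "ent f1 i 0 = g" using Suc.prems by (simp add: f1_def)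
  have f1j: "coeff (ent f1 j 0) k = 0" if "j \<noteq> i" "j < n" "k \<ge> Suc d" for j k
    using that q by (simp add: f1_def)
  obtain j k where jk: "j < n" "j \<noteq> i" "coeff (ent f1 j 0) k \<notin> m"
    using unimod_coeff_not_in[OF m c1 w1 Suc.prems(5)] f1i g a_def by metis
  obtain u v where uv: "coeff (u * g + v * ent f1 j 0) d \<notin> m" "\<forall>k\<ge>Suc d. coeff (u * g + v * ent f1 j 0) k = 0"
    using raise_coeff[OF m g(1) g(2)[unfolded a_def] f1j[OF jk(2,1)] jk(3)] by blast
  \<comment> \<open>The combination involves the entries \<open>i\<close> and \<open>j\<close>, so
    adding it to a third entry is an elementary operation. This is where \<open>3 \<le> n\<close>
    enters.\<close>
  obtain l where l: "l < n" "l \<noteq> i" "l \<noteq> j"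
  proof -
    have "card {i, j} < card {..<n}" using n by (simp add: card_insert_if)
    then have "\<not> {..<n} \<subseteq> {i, j}" using card_mono[of "{i, j}" "{..<n}"] by auto
    then show ?thesis using that by blast
  qed
  show ?case
  \<comment> \<open>Adding the combination helps only if the coefficient of entry \<open>l\<close>
    lies in \<open>m\<close>, since two elements outside \<open>m\<close> may add up to one inside.
    In the other case entry \<open>l\<close> already serves as it is.\<close>
  proof (cases "coeff (ent f1 l 0) d \<in> m")
    case False
    have "degree (ent f1 l 0) \<le> d" using f1j[OF l(2,1)] by (intro degree_le) auto
    then obtain j t where "t \<notin> m" "loc_eq n m f1 (sm [:t:] (unit_col n j))"
      using Suc.IH[OF c1 w1 l(1) _ False] by blast
    then show ?thesis using loc_eq_trans[OF m l1] by blast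
  next
    case True
    have m1: "1 \<notin> m" using m by (simp add: prime_ideal_def)
    define f2 where "f2 = fm n 1 (\<lambda>k _. if k = i then ent f1 i 0 else [:1:] * ent f1 k 0 - (if k = l then - u else 0) * ent f1 i 0)"
    have l2: "loc_eq n m f1 f2" unfolding f2_def by (rule loc_eq_pivot[OF Suc.prems(5) m1 c1])
    define f3 where "f3 = fm n 1 (\<lambda>k _. if k = j then ent f2 j 0 else [:1:] * ent f2 k 0 - (if k = l then - v else 0) * ent f2 j 0)"
    have "carr n 1 f2" by (simp add: f2_def)
    then have l3: "loc_eq n m f2 f3" unfolding f3_def by (rule loc_eq_pivot[OF jk(1) m1])
    have l13: "loc_eq n m f1 f3" by (rule loc_eq_trans[OF m l2 l3])
    obtain w3 s3 where w3: "carr 1 n w3" "s3 \<notin> m" "w3 * f3 = sm [:s3:] (I 1)" and c3: "carr n 1 f3"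
      using loc_eq_unimod[OF m l13 c1 w1] by blast
    have f3l: "ent f3 l 0 = ent f1 l 0 + (u * g + v * ent f1 j 0)"
      using l jk Suc.prems by (simp add: f3_def f2_def f1i one_pCons[symmetric] algebra_simps)
    have "degree (ent f3 l 0) \<le> d" using f1j[OF l(2,1)] uv(2) unfolding f3l by (intro degree_le) auto
    moreover have "coeff (ent f3 l 0) d \<notin> m"
    proof
      assume "coeff (ent f3 l 0) d \<in> m"
      then have "coeff (ent f3 l 0) d - coeff (ent f1 l 0) d \<in> m" using True by (rule ideal_minus[OF idm])
      then show False using uv(1) unfolding f3l by simp
    qed
    ultimately obtain j t where "t \<notin> m" "loc_eq n m f3 (sm [:t:] (unit_col n j))"
      using Suc.IH[OF c3 w3 l(1)] by blast
    then show ?thesis using loc_eq_trans[OF m l1] loc_eq_trans[OF m l13] by blast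
  qed
qed

subsection \<open>Patching of unimodular columns over polynomial rings\<close>

lemma pcompose_diff_dvd: "(a - b :: 'a::comm_ring_1 poly) dvd p \<circ>\<^sub>p a - p \<circ>\<^sub>p b"
proof (induction p)
  case (pCons k p)
  then obtain q where q: "p \<circ>\<^sub>p a - p \<circ>\<^sub>p b = (a - b) * q" by (auto elim: dvdE)
  have "pCons k p \<circ>\<^sub>p a - pCons k p \<circ>\<^sub>p b = (a - b) * (p \<circ>\<^sub>p a) + b * (p \<circ>\<^sub>p a - p \<circ>\<^sub>p b)"
    by (simp add: pcompose_pCons algebra_simps)
  also have "\<dots> = (a - b) * (p \<circ>\<^sub>p a + b * q)" unfolding q by (simp add: algebra_simps)
  finally show ?case by simp
qed simp

lemma hom_poly: "comm_ring_hom (\<lambda>p :: 'a::comm_ring_1 poly. poly p x)"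
  by unfold_locales auto

lemma hom_pcompose: "comm_ring_hom (\<lambda>p :: 'a::comm_ring_1 poly. p \<circ>\<^sub>p x)"
  by unfold_locales (auto simp: pcompose_add pcompose_mult pcompose_1)

lemma dvd_diff_swap: "x dvd a - b \<Longrightarrow> x dvd b - (a :: 'a::comm_ring_1)"
  by (metis dvd_minus_iff minus_diff_eq)

lemma fmat_divisible:
  fixes M :: "'a::comm_ring_1 fmat"
  assumes "carr n m M" "\<And>i j. x dvd ent M i j"
  obtains N where "carr n m N" "M = sm x N"
proof -
  obtain q where "\<And>i j. ent M i j = x * q i j" using assms(2) unfolding dvd_def by metis
  then have "M = sm x (fm n m q)" using assms(1) by (intro fmat_eqI) (auto simp: carr_def not_less)
  then show ?thesis by (intro that[of "fm n m q"]) simp_all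
qed

definition col_eq :: "nat \<Rightarrow> 'a::comm_ring_1 fmat \<Rightarrow> 'a fmat \<Rightarrow> bool"
  where "col_eq n v v' \<longleftrightarrow> (\<exists>U U'. carr n n U \<and> carr n n U' \<and> U * U' = I n \<and> U' * U = I n \<and> U * v = v')"

lemma col_eq_refl: "carr n 1 v \<Longrightarrow> col_eq n v v"
  unfolding col_eq_def by (intro exI[of _ "I n"]) (simp add: I_times)

lemma col_eq_trans:
  assumes "col_eq n u v" "col_eq n v w"
  shows "col_eq n u w"
proof -
  obtain U U' where 1: "carr n n U" "carr n n U'" "U * U' = I n" "U' * U = I n" "U * u = v"
    using assms(1) unfolding col_eq_def by blast
  obtain V V' where 2: "carr n n V" "carr n n V'" "V * V' = I n" "V' * V = I n" "V * v = w"
    using assms(2) unfolding col_eq_def by blast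
  have "V * U * (U' * V') = V * (U * U') * V'" "U' * V' * (V * U) = U' * (V' * V) * U" by (simp_all add: mult.assoc)
  then have "V * U * (U' * V') = I n" "U' * V' * (V * U) = I n"
    by (simp_all add: 1 2 times_I[OF 2(1)] times_I[OF 1(2)])
  moreover have "V * U * u = w" by (simp add: mult.assoc 1 2)
  ultimately show ?thesis unfolding col_eq_def using 1 2 carr_times by blast
qed

lemma (in comm_ring_hom) col_eq_fmap: "col_eq n v v' \<Longrightarrow> col_eq n (fmap hom v) (fmap hom v')"
  unfolding col_eq_def by (metis fmap_times fmap_I fmap_carr)

abbreviation ev0 :: "'a::comm_ring_1 poly fmat \<Rightarrow> 'a fmat"
  where "ev0 \<equiv> fmap (\<lambda>p. poly p 0)"

text \<open>The equivalence of \<open>f\<close> with a constant column can be evaluated at 0.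
  Composing the evaluated equivalence with the inverse of the original one leads from the value at 0
  back to \<open>f\<close>.\<close>

lemma loc_eq_const:
  assumes m: "prime_ideal m" and cf: "carr n 1 f" and f: "loc_eq n m f (sm [:t:] (unit_col n j))"
  shows "\<exists>P Q c s. carr n n P \<and> carr n n Q \<and> c \<notin> m \<and> s \<notin> m \<and> P * Q = sm [:c:] (I n) \<and>
    Q * P = sm [:c:] (I n) \<and> P * cst (ev0 f) = sm [:s:] f"
proof -
  note ev = comm_ring_hom.fmap_simps[OF hom_poly] comm_ring_hom.fmap_I[OF hom_poly]
  obtain P Q s where 1: "carr n n P" "carr n n Q" "s \<notin> m" "P * Q = sm [:s:] (I n)" "Q * P = sm [:s:] (I n)"
    "P * f = sm [:t:] (unit_col n j)"
    using f unfolding loc_eq_def by blast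
  have Qf: "Q * (P * f) = sm [:s:] f" by (simp only: mult.assoc[symmetric] 1(5) sm_times I_times[OF cf])
  let ?P = "cst (ev0 P)" and ?Q = "cst (ev0 Q)"
  have PQ: "?P * ?Q = sm [:s:] (I n)" "?Q * ?P = sm [:s:] (I n)"
    using arg_cong[OF 1(4), of "\<lambda>M. cst (ev0 M)"] arg_cong[OF 1(5), of "\<lambda>M. cst (ev0 M)"]
    by (simp_all add: ev pCons_hom.fmap_simps)
  have Pf: "?P * cst (ev0 f) = P * f"
  proof -
    have "?P * cst (ev0 f) = cst (ev0 (P * f))" by (simp add: ev pCons_hom.fmap_simps)
    also have "\<dots> = P * f" unfolding 1(6) by (rule fmat_eqI) (simp add: unit_col_def ent_fmap)
    finally show ?thesis .
  qed
  have c: "carr n n ?P" "carr n n ?Q" using 1 by (simp_all add: comm_ring_hom.fmap_carr[OF hom_poly] pCons_hom.fmap_carr)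
  have "Q * ?P * (?Q * P) = Q * (?P * ?Q) * P" "?Q * P * (Q * ?P) = ?Q * (P * Q) * ?P" by (simp_all add: mult.assoc)
  then have "Q * ?P * (?Q * P) = sm [:s * s:] (I n)" "?Q * P * (Q * ?P) = sm [:s * s:] (I n)"
    by (simp_all add: PQ 1 sm_simps times_I[OF 1(2)] times_I[OF c(2)])
  moreover have "Q * ?P * cst (ev0 f) = sm [:s:] f" by (simp only: mult.assoc Pf Qf)
  moreover have "s * s \<notin> m" using m 1 by (auto simp: prime_ideal_def)
  ultimately show ?thesis
    using carr_times[OF 1(2) c(1)] carr_times[OF c(2) 1(1)] 1(3) by blast
qed

text \<open>Formally the transition matrix is \<open>P(a) * Q(b) / c\<close>. The division is
  possible because \<open>P(a) - P(b)\<close> is divisible by \<open>a - b\<close>, hence by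
  \<open>c\<close>, while \<open>P(b) * Q(b) = c\<close>.\<close>

lemma subst_col_eq:
  fixes f :: "'a::idom poly fmat"
  assumes f: "carr n 1 f" and P: "carr n n P" "carr n n Q" "c \<noteq> 0" "s \<noteq> 0" "P * Q = sm [:c:] (I n)"
    "Q * P = sm [:c:] (I n)" "P * cst f0 = sm [:s:] f" and ab: "[:c:] dvd a - b"
  shows "col_eq n (fmap (\<lambda>p. p \<circ>\<^sub>p b) f) (fmap (\<lambda>p. p \<circ>\<^sub>p a) f)"
proof -
  let ?s = "\<lambda>x :: 'a poly. fmap (\<lambda>p. p \<circ>\<^sub>p x)"
  note h = comm_ring_hom.fmap_simps[OF hom_pcompose] comm_ring_hom.fmap_I[OF hom_pcompose]
  have hc: "?s x (cst M) = cst M" for x M by (rule fmat_eqI) (simp add: ent_fmap)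
  have PQ: "?s x P * ?s x Q = sm [:c:] (I n)" "?s x Q * ?s x P = sm [:c:] (I n)"
    "?s x P * cst f0 = sm [:s:] (?s x f)" for x
    using arg_cong[OF P(5), of "?s x"] arg_cong[OF P(6), of "?s x"] arg_cong[OF P(7), of "?s x"]
    by (simp_all add: h hc)
  have c: "carr n n (?s x P)" "carr n n (?s x Q)" "carr n 1 (?s x f)" for x using P f by (simp_all add: comm_ring_hom.fmap_carr[OF hom_pcompose])
  have N: "\<exists>N. carr n n N \<and> ?s x P * ?s y Q = sm [:c:] N" if "[:c:] dvd x - y" for x y
  proof -
    have "[:c:] dvd ent (?s x P - ?s y P) i j" for i j
      using dvd_trans[OF that pcompose_diff_dvd] by (simp add: ent_fmap)
    then obtain M where M: "carr n n M" "?s x P - ?s y P = sm [:c:] M"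
      using fmat_divisible[OF carr_minus[OF c(1) c(1)]] by metis
    have "?s x P * ?s y Q = (?s x P - ?s y P) * ?s y Q + ?s y P * ?s y Q" by (simp add: algebra_simps)
    also have "\<dots> = sm [:c:] (M * ?s y Q + I n)" by (simp add: M(2) PQ sm_times sm_add)
    finally show ?thesis using carr_add[OF carr_times[OF M(1) c(2)] carr_I] by blast
  qed
  have "[:c:] dvd b - a" using ab by (rule dvd_diff_swap)
  from N[OF ab] N[OF this] obtain M M' where M: "carr n n M" "?s a P * ?s b Q = sm [:c:] M"
    "carr n n M'" "?s b P * ?s a Q = sm [:c:] M'" by blast
  have c0: "[:c:] \<noteq> 0" "[:s:] \<noteq> 0" using P by simp_all
  have inv: "N * N' = I n" if N: "?s x P * ?s y Q = sm [:c:] N" "?s y P * ?s x Q = sm [:c:] N'" for N N' x y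
  proof -
    have "sm [:c:] (sm [:c:] (N * N')) = (?s x P * ?s y Q) * (?s y P * ?s x Q)"
      by (simp only: N sm_times times_sm)
    also have "\<dots> = ?s x P * (?s y Q * ?s y P) * ?s x Q" by (simp only: mult.assoc)
    also have "\<dots> = sm [:c:] (sm [:c:] (I n))" using times_I[OF c(1)] by (simp only: PQ times_sm sm_times)
    finally show ?thesis by (simp only: sm_cancel[OF c0(1)])
  qed
  have "sm [:c:] (sm [:s:] (M * ?s b f)) = (?s a P * ?s b Q) * sm [:s:] (?s b f)"
    unfolding M(2) sm_times[of "[:c:]" M] times_sm[of M "[:s:]"] ..
  also have "\<dots> = (?s a P * ?s b Q) * (?s b P * cst f0)" by (simp only: PQ(3))
  also have "\<dots> = ?s a P * (?s b Q * ?s b P) * cst f0" by (simp only: mult.assoc)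
  also have "\<dots> = sm [:c:] (sm [:s:] (?s a f))" by (simp only: PQ times_sm sm_times times_I[OF c(1)])
  finally have "M * ?s b f = ?s a f" by (simp only: sm_cancel[OF c0(1)] sm_cancel[OF c0(2)])
  then show ?thesis unfolding col_eq_def using M(1,3) inv[OF M(2,4)] inv[OF M(4,2)] by blast
qed

text \<open>Vaserstein's argument: the \<open>c\<close> such that \<open>f(a) \<sim> f(b)\<close> whenever \<open>a \<equiv> b (mod c)\<close> form an
  ideal, which by the local case is contained in no prime ideal.\<close>

theorem monic_col_eq_ev0:
  fixes f w :: "'a::idom poly fmat"
  assumes n: "3 \<le> n" and f: "carr n 1 f" "carr 1 n w" "w * f = I 1" and i: "i < n" "lead_coeff (ent f i 0) = 1"
  shows "col_eq n f (cst (ev0 f))"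
proof -
  let ?s = "\<lambda>x :: 'a poly. fmap (\<lambda>p. p \<circ>\<^sub>p x) f"
  define J where "J = {c. \<forall>a b. [:c:] dvd a - b \<longrightarrow> col_eq n (?s a) (?s b)}"
  have cs: "carr n 1 (?s a)" for a using f by (simp add: carr_fmap)
  have "is_ideal J"
    unfolding is_ideal_def
  proof (intro conjI ballI allI)
    show "0 \<in> J" unfolding J_def using col_eq_refl[OF cs] by auto
    fix x assume x: "x \<in> J"
    show "r * x \<in> J" for r
    proof -
      have "[:r * x:] = [:x:] * [:r:]" by (simp add: mult.commute)
      then have "[:x:] dvd [:r * x:]" by (rule dvdI)
      then show ?thesis using x dvd_trans unfolding J_def by blast
    qed
    fix y assume y: "y \<in> J"
    show "x + y \<in> J"
      unfolding J_def
    proof (intro CollectI allI impI)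
      fix a b assume "[:x + y:] dvd a - b"
      then obtain q where q: "a - b = [:x + y:] * q" by (auto elim: dvdE)
      \<comment> \<open>An intermediate point: the step from \<open>a\<close> to \<open>d\<close> is
        divisible by \<open>x\<close>, the step from \<open>d\<close> to \<open>b\<close> by
        \<open>y\<close>.\<close>
      define d where "d = a - [:x:] * q"
      have "a - d = [:x:] * q" "d - b = [:y:] * q"
      proof -
        show "a - d = [:x:] * q" by (simp add: d_def)
        have "d - b = (a - b) - [:x:] * q" by (simp add: d_def)
        also have "\<dots> = [:y:] * q" unfolding q by (simp add: smult_add_left)
        finally show "d - b = [:y:] * q" .
      qed
      then have "[:x:] dvd a - d" "[:y:] dvd d - b" by (auto simp only: dvd_triv_left)
      then show "col_eq n (?s a) (?s b)" using x y col_eq_trans unfolding J_def by blast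
    qed
  qed
  have "1 \<in> J"
  proof (rule ccontr)
    assume "1 \<notin> J"
    then obtain m where m: "prime_ideal m" "J \<subseteq> m" using prime_ideal_exists[OF \<open>is_ideal J\<close>] by blast
    have m1: "1 \<notin> m" "0 \<in> m" using m by (auto simp: prime_ideal_def is_ideal_def)
    have "w * f = sm [:1:] (I 1)" using f by (simp add: one_pCons[symmetric])
    from local_horrocks[OF m(1) n f(1,2) m1(1) this i(1) le_refl] i(2) m1(1)
    obtain j t where "t \<notin> m" "loc_eq n m f (sm [:t:] (unit_col n j))" by auto
    from loc_eq_const[OF m(1) f(1) this(2)] obtain P Q c s where P: "carr n n P" "carr n n Q" "c \<notin> m" "s \<notin> m"
      "P * Q = sm [:c:] (I n)" "Q * P = sm [:c:] (I n)" "P * cst (ev0 f) = sm [:s:] f" by blast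
    have cs0: "c \<noteq> 0" "s \<noteq> 0" using P m1 by auto
    have "col_eq n (?s a) (?s b)" if "[:c:] dvd a - b" for a b
      by (rule subst_col_eq[OF f(1) P(1,2) cs0 P(5-7)]) (rule dvd_diff_swap, rule that)
    then show False using P(3) m(2) unfolding J_def by blast
  qed
  \<comment> \<open>With 1 in \<open>J\<close> any two points may be compared; the variable itself
    and 0 give \<open>f\<close> and its constant term.\<close>
  have "?s [:0, 1:] = f" by (rule fmat_eqI, subst ent_fmap) (simp, rule pcompose_idR)
  moreover have "?s 0 = cst (ev0 f)" by (rule fmat_eqI) (simp add: ent_fmap pcompose_0' poly_0_coeff_0)
  moreover have "[:1:] dvd [:0, 1 :: 'a:] - 0" by (metis one_pCons one_dvd)
  moreover from \<open>1 \<in> J\<close> have "\<forall>a b. [:1:] dvd a - b \<longrightarrow> col_eq n (?s a) (?s b)"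
    unfolding J_def by (rule CollectD)
  ultimately show ?thesis by metis
qed

subsection \<open>Minors\<close>

interpretation idl: Modules.module "(*) :: 'a::comm_ring_1 \<Rightarrow> 'a \<Rightarrow> 'a"
  by unfold_locales (auto simp: algebra_simps)

lemma is_ideal_generated: "is_ideal (ideal_generated A)"
  unfolding is_ideal_def ideal_generated_def
  by (auto intro: idl.span_zero idl.span_add idl.span_scale)

lemma ideal_generated_base: "x \<in> A \<Longrightarrow> x \<in> ideal_generated A"
  unfolding ideal_generated_def by (rule idl.span_base)

lemma ideal_generated_least: "is_ideal B \<Longrightarrow> A \<subseteq> B \<Longrightarrow> ideal_generated A \<subseteq> B"
  unfolding ideal_generated_def is_ideal_def
  by (intro idl.span_minimal) (auto simp: idl.subspace_def)

lemma ideal_addD: "is_ideal A \<Longrightarrow> x \<in> A \<Longrightarrow> y \<in> A \<Longrightarrow> x + y \<in> A"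
  and ideal_multD: "is_ideal A \<Longrightarrow> x \<in> A \<Longrightarrow> r * x \<in> A"
  and ideal_multD': "is_ideal A \<Longrightarrow> x \<in> A \<Longrightarrow> x * r \<in> A"
  and ideal_zeroD: "is_ideal A \<Longrightarrow> 0 \<in> A"
  by (auto simp: is_ideal_def mult.commute)

lemma is_ideal_dvd: "is_ideal {x. d dvd x}"
  by (auto simp: is_ideal_def)

text \<open>Rows and columns of a minor are selected by arbitrary functions on \<open>{..<k}\<close>; repeated or
  out-of-range indices just give the minor \<open>0\<close>.\<close>

definition minor :: "nat \<Rightarrow> (nat \<Rightarrow> nat) \<Rightarrow> (nat \<Rightarrow> nat) \<Rightarrow> 'a::comm_ring_1 fmat \<Rightarrow> 'a"
  where "minor k f g M = det (mat k k (\<lambda>(i, j). ent M (f i) (g j)))"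

definition minor_ideal :: "nat \<Rightarrow> 'a::idom fmat \<Rightarrow> 'a set"
  where "minor_ideal k M = ideal_generated {minor k f g M | f g. True}"

lemma is_ideal_minor_ideal: "is_ideal (minor_ideal k M)"
  unfolding minor_ideal_def by (rule is_ideal_generated)

lemma minor_in_minor_ideal: "minor k f g M \<in> minor_ideal k M"
  unfolding minor_ideal_def by (rule ideal_generated_base) blast

lemma minor_ideal_least: "is_ideal B \<Longrightarrow> (\<And>f g. minor k f g M \<in> B) \<Longrightarrow> minor_ideal k M \<subseteq> B"
  unfolding minor_ideal_def by (rule ideal_generated_least) auto

lemma minor_0 [simp]: "minor 0 f g M = 1"
  by (simp add: minor_def)

lemma minor_1: "minor 1 f g M = ent M (f 0) (g 0)"
  unfolding minor_def by (subst det_single[of _]) auto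

lemma minor_tr: "minor k f g (tr M) = minor k g f M"
  unfolding minor_def by (subst det_transpose[symmetric, of _ k]) (auto intro!: arg_cong[where f = det])

lemma minor_sm: "minor k f g (sm c M) = c ^ k * minor k f g M"
proof -
  have "mat k k (\<lambda>(i, j). ent (sm c M) (f i) (g j)) = c \<cdot>\<^sub>m mat k k (\<lambda>(i, j). ent M (f i) (g j))"
    by auto
  then show ?thesis unfolding minor_def by simp
qed

lemma (in comm_ring_hom) minor_fmap: "minor k f g (fmap hom M) = hom (minor k f g M)"
  unfolding minor_def hom_det[symmetric] by (rule arg_cong[where f = det]) auto

lemma minor_noninj:
  assumes "i < k" "j < k" "i \<noteq> j" "f i = f j"
  shows "minor k f g M = 0"
  unfolding minor_def by (rule det_identical_rows[of _ k i j]) (use assms in auto)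

lemma minor_cong: "(\<And>i. i < k \<Longrightarrow> f i = f' i) \<Longrightarrow> (\<And>i. i < k \<Longrightarrow> g i = g' i) \<Longrightarrow> minor k f g M = minor k f' g' M"
  unfolding minor_def by (intro arg_cong[where f = det] cong_mat) auto

lemma minor_row_expand:
  assumes "a < Suc k"
  shows "minor (Suc k) f g M = (\<Sum>j<Suc k. ent M (f a) (g j) *
    ((- 1) ^ (a + j) * minor k (\<lambda>i. f (insert_index a i)) (\<lambda>i. g (insert_index j i)) M))"
proof -
  let ?A = "mat (Suc k) (Suc k) (\<lambda>(i, j). ent M (f i) (g j))"
  have "det ?A = (\<Sum>j<Suc k. ?A $$ (a, j) * cofactor ?A a j)"
    by (rule laplace_expansion_row) (use assms in auto)
  also have "\<dots> = (\<Sum>j<Suc k. ent M (f a) (g j) *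
    ((- 1) ^ (a + j) * minor k (\<lambda>i. f (insert_index a i)) (\<lambda>i. g (insert_index j i)) M))"
    using assms unfolding cofactor_def minor_def mat_delete_def insert_index_def
    by (intro sum.cong refl arg_cong2[where f = "(*)"] arg_cong[where f = det] cong_mat) auto
  finally show ?thesis unfolding minor_def .
qed

lemma minor_zero_row:
  assumes "a < k" "\<And>j. j < k \<Longrightarrow> ent M (f a) (g j) = 0"
  shows "minor k f g M = 0"
proof (cases k)
  case (Suc l)
  then show ?thesis using assms by (simp add: minor_row_expand[of a l])
qed (use assms in simp)

lemma minor_zero_col:
  assumes "a < k" "\<And>j. j < k \<Longrightarrow> ent M (f j) (g a) = 0"
  shows "minor k f g M = 0"
  using minor_zero_row[of a k "tr M" g f] assms by (simp add: minor_tr)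

lemma minor_big:
  assumes "carr n m M" "n < k"
  shows "minor k f g M = 0"
proof (cases "\<exists>i<k. n \<le> f i")
  case True
  then show ?thesis using assms minor_zero_row by (metis carrD)
next
  case False
  then have "f ` {..<k} \<subseteq> {..<n}" by auto
  then have "card (f ` {..<k}) < card {..<k}"
    using assms card_mono[of "{..<n}" "f ` {..<k}"] by simp
  then have "\<not> inj_on f {..<k}" by (intro pigeonhole)
  then show ?thesis using minor_noninj by (metis inj_onI lessThan_iff)
qed

lemma minor_ideal_Suc: "minor_ideal (Suc k) M \<subseteq> minor_ideal k M"
proof (rule minor_ideal_least[OF is_ideal_minor_ideal])
  fix f g
  show "minor (Suc k) f g M \<in> minor_ideal k M"
    unfolding minor_row_expand[OF zero_less_Suc]
    by (intro ideal_sum ideal_multD minor_in_minor_ideal is_ideal_minor_ideal)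
qed

lemma minor_ideal_antimono: "k \<le> j \<Longrightarrow> minor_ideal j F \<subseteq> minor_ideal k F"
  by (rule lift_Suc_antimono_le[of "\<lambda>k. minor_ideal k F"]) (rule minor_ideal_Suc)

lemma permutes_less: "p permutes {0..<k} \<Longrightarrow> i < k \<Longrightarrow> p i < (k :: nat)"
  using permutes_in_image[of p "{0..<k}" i] by simp

lemma minor_permute_rows:
  assumes "p permutes {0..<k}"
  shows "minor k (\<lambda>i. h (p i)) g M = signof p * minor k h g M"
proof -
  let ?A = "mat k k (\<lambda>(i, j). ent M (h i) (g j))"
  have "minor k (\<lambda>i. h (p i)) g M = det (mat k k (\<lambda>(i, j). ?A $$ (p i, j)))"
    unfolding minor_def using permutes_less[OF assms] by (intro arg_cong[where f = det] eq_matI) auto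
  also have "\<dots> = signof p * minor k h g M"
    unfolding minor_def by (rule det_permute_rows[OF _ assms]) simp
  finally show ?thesis .
qed

text \<open>A coarse form of the Cauchy-Binet formula. Summing over all functions instead of
  increasing ones is enough to compare ideals of minors.\<close>

lemma minor_times:
  fixes A B :: "'a::comm_ring_1 fmat"
  assumes "carr n N A"
  shows "minor k f g (A * B) = (\<Sum>h\<in>{0..<k} \<rightarrow>\<^sub>E {..<N}. (\<Prod>i\<in>{0..<k}. ent A (f i) (h i)) * minor k h g B)"
proof -
  let ?P = "{p. p permutes {0..<k}}"
  have "minor k f g (A * B) = (\<Sum>p\<in>?P. signof p * (\<Prod>i\<in>{0..<k}. ent (A * B) (f i) (g (p i))))"
    unfolding minor_def by (subst det_def'[of _ k]) (auto intro!: sum.cong prod.cong simp: permutes_less)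
  also have "\<dots> = (\<Sum>p\<in>?P. signof p * (\<Sum>h\<in>{0..<k} \<rightarrow>\<^sub>E {..<N}. \<Prod>i\<in>{0..<k}. ent A (f i) (h i) * ent B (h i) (g (p i))))"
    unfolding ent_times_carr[OF assms] by (intro sum.cong refl arg_cong2[where f = "(*)"] prod_sum_PiE) auto
  also have "\<dots> = (\<Sum>h\<in>{0..<k} \<rightarrow>\<^sub>E {..<N}. \<Sum>p\<in>?P. (\<Prod>i\<in>{0..<k}. ent A (f i) (h i)) *
      (signof p * (\<Prod>i\<in>{0..<k}. ent B (h i) (g (p i)))))"
    unfolding sum_distrib_left by (subst sum.swap) (simp only: prod.distrib mult.left_commute)
  also have "\<dots> = (\<Sum>h\<in>{0..<k} \<rightarrow>\<^sub>E {..<N}. (\<Prod>i\<in>{0..<k}. ent A (f i) (h i)) * minor k h g B)"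
    unfolding minor_def sum_distrib_left[symmetric]
    by (intro sum.cong refl arg_cong2[where f = "(*)"], subst det_def'[of _ k])
       (auto intro!: sum.cong prod.cong simp: permutes_less)
  finally show ?thesis .
qed

lemma minor_ideal_times_right: "minor_ideal k (A * B) \<subseteq> minor_ideal k B"
proof (rule minor_ideal_least[OF is_ideal_minor_ideal])
  fix f g
  obtain n where "carr n n A" by (metis carr_exists)
  from minor_times[OF this] show "minor k f g (A * B) \<in> minor_ideal k B"
    by (auto intro!: ideal_sum ideal_multD minor_in_minor_ideal is_ideal_minor_ideal)
qed

lemma minor_ideal_tr: "minor_ideal k (tr M) = minor_ideal k M"
  unfolding minor_ideal_def minor_tr by (rule arg_cong[where f = ideal_generated]) auto

lemma minor_ideal_times_left: "minor_ideal k (A * B) \<subseteq> minor_ideal k A"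
  by (metis minor_ideal_times_right minor_ideal_tr tr_times)

lemma minor_ideal_equiv:
  assumes "U' * U = I n" "V * V' = I m" "carr n m M"
  shows "minor_ideal k (U * M * V) = minor_ideal k M"
proof
  show "minor_ideal k (U * M * V) \<subseteq> minor_ideal k M"
    using minor_ideal_times_left minor_ideal_times_right by blast
  have "U' * (U * M * V) * V' = (U' * U) * M * (V * V')" by (simp only: mult.assoc)
  also have "\<dots> = M" using assms(3) by (simp add: assms(1,2) I_times times_I)
  finally show "minor_ideal k M \<subseteq> minor_ideal k (U * M * V)"
    using minor_ideal_times_left minor_ideal_times_right by (metis subset_trans)
qed

subsection \<open>Matrices of rank \<open>k\<close>\<close>

definition sel :: "nat \<Rightarrow> (nat \<Rightarrow> nat) \<Rightarrow> (nat \<Rightarrow> nat) \<Rightarrow> 'a fmat \<Rightarrow> 'a::comm_ring_1 fmat"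
  where "sel k f g M = fm k k (\<lambda>i j. ent M (f i) (g j))"

definition adj :: "nat \<Rightarrow> (nat \<Rightarrow> nat) \<Rightarrow> (nat \<Rightarrow> nat) \<Rightarrow> 'a fmat \<Rightarrow> 'a::comm_ring_1 fmat"
  where "adj k f g M = fm k k (\<lambda>i j. adj_mat (mat k k (\<lambda>(i, j). ent M (f i) (g j))) $$ (i, j))"

definition unit_rows :: "nat \<Rightarrow> nat \<Rightarrow> (nat \<Rightarrow> nat) \<Rightarrow> 'a::comm_ring_1 fmat"
  where "unit_rows k n f = fm k n (\<lambda>i j. if j = f i then 1 else 0)"

lemma carr_adj [simp]: "carr k k (adj k f g M)" by (simp add: adj_def)
lemma carr_unit_rows [simp]: "carr k n (unit_rows k n f)" by (simp add: unit_rows_def)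

lemma ent_unit_rows_times: "carr n m M \<Longrightarrow> ent (unit_rows k n f * M) i j = (if i < k then ent M (f i) j else 0)"
proof -
  assume M: "carr n m M"
  have "ent (unit_rows k n f * M) i j = (\<Sum>l<n. ent (unit_rows k n f) i l * ent M l j)"
    by (rule ent_times_carr[OF carr_unit_rows])
  also have "\<dots> = (\<Sum>l<n. if l = f i then (if i < k then ent M (f i) j else 0) else 0)"
    by (rule sum.cong) (auto simp: unit_rows_def)
  also have "\<dots> = (if i < k then ent M (f i) j else 0)" using carrD[OF M] by (auto simp: not_less)
  finally show ?thesis .
qed

lemma ent_times_unit_cols: "carr n m M \<Longrightarrow> ent (M * tr (unit_rows k m g)) i j = (if j < k then ent M i (g j) else 0)"
  using ent_unit_rows_times[OF carr_tr, of n m M k g j i] by (metis ent_tr tr_times tr_tr)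

lemma sel_eq: "carr n m M \<Longrightarrow> sel k f g M = unit_rows k n f * M * tr (unit_rows k m g)"
proof (rule fmat_eqI)
  fix i j
  assume M: "carr n m M"
  have c: "carr n k (M * tr (unit_rows k m g))" by (rule carr_times[OF M carr_tr[OF carr_unit_rows]])
  show "ent (sel k f g M) i j = ent (unit_rows k n f * M * tr (unit_rows k m g)) i j"
    by (simp add: sel_def mult.assoc ent_unit_rows_times[OF c] ent_times_unit_cols[OF M])
qed

lemma adj_sel:
  "adj k f g M * sel k f g M = sm (minor k f g M) (I k)" "sel k f g M * adj k f g M = sm (minor k f g M) (I k)"
proof -
  let ?P = "mat k k (\<lambda>(i, j). ent M (f i) (g j))"
  have P: "?P \<in> carrier_mat k k" by simp
  note a = adj_mat[OF P]
  have fm_times: "fm k k (\<lambda>i j. A $$ (i, j)) * fm k k (\<lambda>i j. B $$ (i, j)) = fm k k (\<lambda>i j. (A * B) $$ (i, j))"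
    if "A \<in> carrier_mat k k" "B \<in> carrier_mat k k" for A B :: "'a mat"
    by (rule fmat_eqI, subst ent_times_carr[of k k])
       (use that in \<open>auto simp: scalar_prod_def atLeast0LessThan intro!: sum.cong\<close>)
  have s: "sel k f g M = fm k k (\<lambda>i j. ?P $$ (i, j))" by (rule fmat_eqI) (simp add: sel_def)
  have u: "fm k k (\<lambda>i j. (c \<cdot>\<^sub>m 1\<^sub>m k) $$ (i, j)) = sm c (I k)" for c :: 'a by (rule fmat_eqI) simp
  show "adj k f g M * sel k f g M = sm (minor k f g M) (I k)"
    unfolding s adj_def fm_times[OF a(1) P] a(3) u minor_def ..
  show "sel k f g M * adj k f g M = sm (minor k f g M) (I k)"
    unfolding s adj_def fm_times[OF P a(1)] a(2) u minor_def ..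
qed

text \<open>Cramer's rule: the cofactors along row \<open>i\<close> do not see row \<open>i\<close>,
  so it may be replaced by row \<open>a\<close>.\<close>

lemma times_adj_entry:
  assumes "carr n m M" "i < k"
  shows "ent (M * tr (unit_rows k m g) * adj k f g M) a i = minor k (f(i := a)) g M"
proof -
  let ?P = "mat k k (\<lambda>(i, j). ent M (f i) (g j))" and ?P' = "mat k k (\<lambda>(i', j). ent M ((f(i := a)) i') (g j))"
  have "carr n k (M * tr (unit_rows k m g))" by (rule carr_times[OF assms(1) carr_tr[OF carr_unit_rows]])
  then have "ent (M * tr (unit_rows k m g) * adj k f g M) a i = (\<Sum>j<k. ent M a (g j) * ent (adj k f g M) j i)"
    by (simp add: ent_times_carr ent_times_unit_cols[OF assms(1)])
  also have "\<dots> = (\<Sum>j<k. ?P' $$ (i, j) * cofactor ?P' i j)"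
  proof (rule sum.cong)
    fix j assume "j \<in> {..<k}"
    moreover have "mat_delete ?P i j = mat_delete ?P' i j"
      unfolding mat_delete_def by (rule cong_mat) auto
    ultimately show "ent M a (g j) * ent (adj k f g M) j i = ?P' $$ (i, j) * cofactor ?P' i j"
      using assms by (simp add: adj_def adj_mat_def cofactor_def)
  qed simp
  also have "\<dots> = minor k (f(i := a)) g M"
    unfolding minor_def by (rule laplace_expansion_row[symmetric]) (use assms in auto)
  finally show ?thesis .
qed

text \<open>Over the fraction field a matrix of rank \<open>k\<close> is recovered from
  \<open>k\<close> columns, \<open>k\<close> rows and the inverse of the square where they meet,
  because the Schur complement of this square consists of quotients of bordered minors. The adjugate
  clears the denominator.\<close>

lemma rank_adj:
  fixes M :: "'a::idom fmat"
  assumes M: "carr n m M" and d: "minor k f g M \<noteq> 0" and rank: "\<And>f g. minor (Suc k) f g M = 0"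
  shows "M * tr (unit_rows k m g) * adj k f g M * (unit_rows k n f * M) = sm (minor k f g M) M"
proof (rule fmat_eqI)
  fix a b
  define d F G where "d = minor k f g M" and "F = unit_rows k n f * M" and "G = M * tr (unit_rows k m g)"
  define u where "u = adj k f g M * F"
  have c: "carr k m F" "carr n k G" "carr k m u" "carr n m (G * u)"
    unfolding F_def G_def u_def by (auto intro!: carr_times M carr_tr intro: carr_adj carr_unit_rows M carr_tr carr_times)
  have "unit_rows k n f * (G * u) = sel k f g M * adj k f g M * F"
    by (simp add: sel_eq[OF M] G_def u_def mult.assoc)
  also have "\<dots> = sm d F" by (simp add: adj_sel sm_times I_times[OF c(1)] d_def)
  finally have FT: "unit_rows k n f * (G * u) = sm d F" .
  have T: "ent (G * u) (f i) b = d * ent M (f i) b" if "i < k" for i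
    using arg_cong[OF FT, of "\<lambda>A. ent A i b"] that
    by (simp add: ent_unit_rows_times[OF c(4)] F_def ent_unit_rows_times[OF M])
  define z where "z = d * ent M a b - ent (G * u) a b"
  text \<open>Column operations clear the last column of the bordered matrix except for its corner,
    which becomes \<open>z\<close>.\<close>
  define B where "B = mat (Suc k) (Suc k) (\<lambda>(i, j). ent M ((f(k := a)) i) ((g(k := b)) j))"
  define W where "W = mat (Suc k) (Suc k) (\<lambda>(i, j). if j < k then if i = j then 1 else 0 else if i < k then - ent u i b else d)"
  have BW: "B * W \<in> carrier_mat (Suc k) (Suc k)" by (auto simp: B_def W_def)
  have ent_BW: "(B * W) $$ (i, j) = (\<Sum>l<Suc k. B $$ (i, l) * W $$ (l, j))" if "i < Suc k" "j < Suc k" for i j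
    using that by (auto simp: B_def W_def scalar_prod_def atLeast0LessThan intro!: sum.cong)
  have col: "(B * W) $$ (i, j) = ent M ((f(k := a)) i) (g j)" if "i < Suc k" "j < k" for i j
  proof -
    have "(B * W) $$ (i, j) = (\<Sum>l<Suc k. if l = j then ent M ((f(k := a)) i) (g j) else 0)"
      unfolding ent_BW[OF that(1) less_SucI[OF that(2)]] by (rule sum.cong) (use that in \<open>auto simp: B_def W_def\<close>)
    then show ?thesis using that by simp
  qed
  have last: "(B * W) $$ (i, k) = (if i = k then z else 0)" if "i < Suc k" for i
  proof -
    let ?x = "(f(k := a)) i"
    have "(B * W) $$ (i, k) = (\<Sum>l<k. B $$ (i, l) * W $$ (l, k)) + B $$ (i, k) * W $$ (k, k)"
      unfolding ent_BW[OF that lessI] by simp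
    also have "(\<Sum>l<k. B $$ (i, l) * W $$ (l, k)) = (\<Sum>l<k. - (ent G ?x l * ent u l b))"
      by (rule sum.cong) (use that in \<open>auto simp: B_def W_def G_def ent_times_unit_cols[OF M]\<close>)
    also have "\<dots> = - ent (G * u) ?x b" unfolding sum_negf ent_times_carr[OF c(2)] ..
    also have "- ent (G * u) ?x b + B $$ (i, k) * W $$ (k, k) = d * ent M ?x b - ent (G * u) ?x b"
      using that by (simp add: B_def W_def)
    also have "\<dots> = (if i = k then z else 0)" using that T by (auto simp: z_def)
    finally show ?thesis .
  qed
  have "det (B * W) = (\<Sum>i<Suc k. (B * W) $$ (i, k) * cofactor (B * W) i k)"
    by (rule laplace_expansion_column[OF BW]) simp
  also have "\<dots> = z * cofactor (B * W) k k"
    by (simp add: last)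
  also have "cofactor (B * W) k k = d"
  proof -
    have "mat_delete (B * W) k k = mat k k (\<lambda>(i, j). ent M (f i) (g j))"
    proof (rule eq_matI)
      have dims: "dim_row B = Suc k" "dim_col W = Suc k" by (simp_all add: B_def W_def)
      then show "dim_row (mat_delete (B * W) k k) = dim_row (mat k k (\<lambda>(i, j). ent M (f i) (g j)))"
        "dim_col (mat_delete (B * W) k k) = dim_col (mat k k (\<lambda>(i, j). ent M (f i) (g j)))" by simp_all
      fix i j assume "i < dim_row (mat k k (\<lambda>(i, j). ent M (f i) (g j)))" "j < dim_col (mat k k (\<lambda>(i, j). ent M (f i) (g j)))"
      then have ij: "i < k" "j < k" by simp_all
      then have "mat_delete (B * W) k k $$ (i, j) = (B * W) $$ (i, j)" by (simp add: mat_delete_def dims del: index_mult_mat(1))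
      then show "mat_delete (B * W) k k $$ (i, j) = mat k k (\<lambda>(i, j). ent M (f i) (g j)) $$ (i, j)"
        using col[of i j] ij by (simp del: index_mult_mat)
    qed
    then show ?thesis by (simp add: cofactor_def d_def minor_def)
  qed
  also have "det (B * W) = det B * det W"
    by (rule det_mult[of _ "Suc k"]) (auto simp: B_def W_def)
  also have "det B = minor (Suc k) (f(k := a)) (g(k := b)) M" by (simp add: B_def minor_def)
  finally have "z * d = 0" by (simp add: rank)
  then have "z = 0" using d by (simp add: d_def)
  then show "ent (M * tr (unit_rows k m g) * adj k f g M * (unit_rows k n f * M)) a b = ent (sm (minor k f g M) M) a b"
    by (simp add: z_def d_def G_def u_def F_def mult.assoc)
qed

text \<open>The image of a matrix whose minors of the maximal nonvanishing order generate a principal ideal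
  is projective.\<close>

theorem rank_idempotent:
  fixes M :: "'a::idom fmat"
  assumes M: "carr n m M" and d: "d \<noteq> 0" "d \<in> minor_ideal k M" and dvd: "\<And>f g. d dvd minor k f g M"
    and rank: "\<And>f g. minor (Suc k) f g M = 0"
  obtains e N where "carr n n e" "e * M = M" "e * e = e" "carr m n N" "M * N = sm d e"
proof -
  \<comment> \<open>The scalars up to which \<open>M\<close> has a generalised inverse
    \<open>N\<close> with \<open>M * N\<close> divisible by \<open>d\<close>. They form an ideal
    that contains the minors of order \<open>k\<close> by \<open>rank_adj\<close>, hence
    \<open>d\<close>. The quotient of \<open>M * N\<close> by \<open>d\<close> is then the
    idempotent.\<close>
  define A where "A = {x. \<exists>N. carr m n N \<and> M * N * M = sm x M \<and> (\<forall>i j. d dvd ent (M * N) i j)}"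
  have "is_ideal A"
    unfolding is_ideal_def
  proof (intro conjI ballI allI)
    show "0 \<in> A" by (auto simp: A_def intro!: exI[of _ 0])
    fix x assume "x \<in> A"
    then obtain N where N: "carr m n N" "M * N * M = sm x M" "\<forall>i j. d dvd ent (M * N) i j"
      by (auto simp: A_def)
    show "r * x \<in> A" for r
      unfolding A_def using N
      by (intro CollectI exI[of _ "sm r N"]) (auto simp: sm_simps intro: carr_sm dvd_mult)
    fix y assume "y \<in> A"
    then obtain N' where N': "carr m n N'" "M * N' * M = sm y M" "\<forall>i j. d dvd ent (M * N') i j"
      by (auto simp: A_def)
    show "x + y \<in> A"
      unfolding A_def using N N'
      by (intro CollectI exI[of _ "N + N'"]) (auto simp: distrib_left distrib_right add_sm intro: carr_add dvd_add)
  qed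
  moreover have "minor k f g M \<in> A" for f g
  proof (cases "minor k f g M = 0")
    case True
    then show ?thesis using ideal_zeroD[OF \<open>is_ideal A\<close>] by simp
  next
    case False
    let ?N = "tr (unit_rows k m g) * adj k f g M * unit_rows k n f"
    have c: "carr m n ?N" by (auto intro!: carr_times carr_tr intro: carr_unit_rows carr_adj)
    have "M * ?N * M = M * tr (unit_rows k m g) * adj k f g M * (unit_rows k n f * M)" by (simp only: mult.assoc)
    also have "\<dots> = sm (minor k f g M) M" by (rule rank_adj[OF M False rank])
    finally have 1: "M * ?N * M = sm (minor k f g M) M" .
    have "d dvd ent (M * ?N) i j" for i j
    proof -
      let ?H = "M * tr (unit_rows k m g) * adj k f g M"
      have "carr n k ?H" by (rule carr_times[OF carr_times[OF M carr_tr[OF carr_unit_rows]] carr_adj])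
      then have "ent (?H * unit_rows k n f) i j = (\<Sum>l<k. ent ?H i l * ent (unit_rows k n f) l j)"
        by (rule ent_times_carr)
      also have "d dvd \<dots>"
        by (intro dvd_sum dvd_mult2) (simp add: times_adj_entry[OF M] dvd)
      finally show ?thesis by (simp only: mult.assoc)
    qed
    then show ?thesis unfolding A_def using c 1 by blast
  qed
  ultimately have "minor_ideal k M \<subseteq> A" by (rule minor_ideal_least)
  then obtain N where N: "carr m n N" "M * N * M = sm d M" "\<And>i j. d dvd ent (M * N) i j"
    using d(2) by (auto simp: A_def)
  obtain e where e: "carr n n e" "M * N = sm d e"
    using fmat_divisible[OF carr_times[OF M N(1)] N(3)] .
  have eM: "e * M = M"
  proof -
    have "sm d (e * M) = sm d M" using N(2) by (simp add: e(2) sm_times)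
    then show ?thesis by (simp only: sm_cancel[OF d(1)])
  qed
  have "e * e = e"
  proof -
    have "sm d (e * e) = e * (M * N)" by (simp add: e(2) times_sm)
    also have "\<dots> = M * N" by (simp only: mult.assoc[symmetric] eM)
    also have "\<dots> = sm d e" by (rule e(2))
    finally show ?thesis by (simp only: sm_cancel[OF d(1)])
  qed
  then show ?thesis using that e N(1) eM by blast
qed

text \<open>Over the fraction field idempotents are free; the choices below are natural in \<open>e\<close>.\<close>

theorem idempotent_generically_free:
  fixes e :: "'a::idom fmat"
  assumes e: "carr n n e" "e * e = e"
  obtains r X Y d where "carr n r X" "carr r n Y" "d \<noteq> 0" "X * Y = sm d e" "Y * X = sm d (I r)"
    "e * X = X" "Y * e = Y"
    "\<And>\<phi>. comm_ring_hom \<phi> \<Longrightarrow> fmap \<phi> e = e \<Longrightarrow> fmap \<phi> X = X \<and> fmap \<phi> Y = Y \<and> \<phi> d = d"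
proof -
  define K where "K = {k. \<exists>f g. minor k f g e \<noteq> 0}"
  have K: "finite K" "K \<noteq> {}"
  proof -
    have "K \<subseteq> {..n}" using minor_big[OF e(1)] by (auto simp: K_def not_less[symmetric])
    then show "finite K" by (rule finite_subset) simp
    have "0 \<in> K" by (simp add: K_def)
    then show "K \<noteq> {}" by blast
  qed
  define r where "r = Max K"
  have "r \<in> K" unfolding r_def by (rule Max_in[OF K])
  then obtain f g where d: "minor r f g e \<noteq> 0" by (auto simp: K_def)
  have "Suc r \<notin> K" using Max_ge[OF K(1), of "Suc r"] by (auto simp: r_def[symmetric])
  then have rank: "\<And>f g. minor (Suc r) f g e = 0" by (auto simp: K_def)
  define G F where "G = tr (unit_rows r n g :: 'a fmat)" and "F = (unit_rows r n f :: 'a fmat)"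
  define X Y where "X = e * G" and "Y = adj r f g e * (F * e)"
  let ?d = "minor r f g e"
  have cGF: "carr n r G" "carr r n F" by (auto simp: G_def F_def intro: carr_tr)
  have XY: "X * Y = sm ?d e"
    using rank_adj[OF e(1) d rank] by (simp add: X_def Y_def G_def F_def mult.assoc)
  have "Y * X = adj r f g e * (F * (e * e) * G)" by (simp add: X_def Y_def mult.assoc)
  also have "F * (e * e) * G = sel r f g e" by (simp add: e(2) sel_eq[OF e(1)] F_def G_def)
  finally have YX: "Y * X = sm ?d (I r)" by (simp add: adj_sel)
  have fixed: "fmap \<phi> X = X \<and> fmap \<phi> Y = Y \<and> \<phi> ?d = ?d" if "comm_ring_hom \<phi>" "fmap \<phi> e = e" for \<phi>
  proof -
    interpret comm_ring_hom \<phi> by fact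
    have pe: "\<phi> (ent e i j) = ent e i j" for i j using that(2) by (metis ent_fmap_hom)
    have "fmap \<phi> G = G" "fmap \<phi> F = F" by (rule fmat_eqI, simp add: G_def F_def unit_rows_def)+
    moreover have "fmap \<phi> (adj r f g e) = adj r f g e"
    proof (rule fmat_eqI)
      fix i j
      have "\<phi> (cofactor (mat r r (\<lambda>(i, j). ent e (f i) (g j))) i j) = cofactor (mat r r (\<lambda>(i, j). ent e (f i) (g j))) i j"
        if "i < r" "j < r" for i j
      proof -
        have "map_mat \<phi> (mat_delete (mat r r (\<lambda>(i, j). ent e (f i) (g j))) i j) = mat_delete (mat r r (\<lambda>(i, j). ent e (f i) (g j))) i j"
          by (rule eq_matI) (auto simp: mat_delete_def pe)
        then show ?thesis unfolding cofactor_def by (metis hom_det hom_mult hom_power hom_uminus hom_one)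
      qed
      then show "ent (fmap \<phi> (adj r f g e)) i j = ent (adj r f g e) i j"
        by (simp add: adj_def adj_mat_def)
    qed
    ultimately have "fmap \<phi> X = X" "fmap \<phi> Y = Y" by (simp_all add: X_def Y_def fmap_times that)
    moreover have "\<phi> ?d = ?d" using minor_fmap[of r f g e] that(2) by simp
    ultimately show ?thesis by blast
  qed
  show ?thesis
  proof (rule that[OF _ _ d XY YX _ _ fixed])
    show "carr n r X" "carr r n Y" unfolding X_def Y_def using cGF e(1) by (auto intro: carr_times carr_adj)
    show "e * X = X" "Y * e = Y" by (simp_all add: X_def Y_def mult.assoc e(2) e(2)[THEN mulR])
  qed
qed

subsection \<open>Evaluation of multivariate polynomials\<close>

lemma comm_ring_homI:
  assumes "h 0 = 0" "h 1 = 1" "\<And>x y. h (x + y) = h x + h y" "\<And>x y. h (x * y) = h x * h y"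
  shows "comm_ring_hom h"
  by unfold_locales (use assms in auto)

lemma comm_ring_hom_comp:
  assumes "comm_ring_hom f" "comm_ring_hom g"
  shows "comm_ring_hom (\<lambda>x. f (g x))"
proof -
  interpret f: comm_ring_hom f by fact
  interpret g: comm_ring_hom g by fact
  show ?thesis by (rule comm_ring_homI) (simp_all add: f.hom_add g.hom_add f.hom_mult g.hom_mult)
qed

lemma comm_ring_hom_map_poly: "comm_ring_hom h \<Longrightarrow> comm_ring_hom (map_poly h)"
proof -
  assume "comm_ring_hom h"
  then interpret comm_ring_hom h .
  interpret m: map_poly_comm_ring_hom h ..
  show ?thesis by (rule comm_ring_homI) (simp_all add: m.hom_add m.hom_mult)
qed

definition kc :: "'k \<Rightarrow> ('n, 'k::comm_ring_1) mpoly" where "kc c = Poly_Mapping.single 0 c"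
definition xv :: "'n \<Rightarrow> ('n, 'k::comm_ring_1) mpoly" where "xv i = Poly_Mapping.single (Poly_Mapping.single i 1) 1"

definition mval :: "('n::finite \<Rightarrow> 'b) \<Rightarrow> ('n \<Rightarrow>\<^sub>0 nat) \<Rightarrow> 'b::comm_ring_1"
  where "mval v t = (\<Prod>i\<in>UNIV. v i ^ Poly_Mapping.lookup t i)"

definition mev :: "('k \<Rightarrow> 'b) \<Rightarrow> ('n::finite \<Rightarrow> 'b) \<Rightarrow> ('n, 'k::comm_ring_1) mpoly \<Rightarrow> 'b::comm_ring_1"
  where "mev h v f = (\<Sum>t\<in>Poly_Mapping.keys f. h (Poly_Mapping.lookup f t) * mval v t)"

lemma mval_0 [simp]: "mval v 0 = 1" by (simp add: mval_def)
lemma mval_add: "mval v (s + t) = mval v s * mval v t"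
  by (simp add: mval_def lookup_add power_add prod.distrib)

lemma mpoly_monomials: "(f :: ('n, 'k::comm_ring_1) mpoly) = (\<Sum>t\<in>Poly_Mapping.keys f. Poly_Mapping.single t (Poly_Mapping.lookup f t))"
proof (rule poly_mapping_eqI)
  fix s
  have "Poly_Mapping.lookup (\<Sum>t\<in>Poly_Mapping.keys f. Poly_Mapping.single t (Poly_Mapping.lookup f t)) s = (\<Sum>t\<in>Poly_Mapping.keys f. if t = s then Poly_Mapping.lookup f s else 0)"
    unfolding lookup_sum by (rule sum.cong) (auto simp: lookup_single when_def)
  then show "Poly_Mapping.lookup f s = Poly_Mapping.lookup (\<Sum>t\<in>Poly_Mapping.keys f. Poly_Mapping.single t (Poly_Mapping.lookup f t)) s"
    by (simp add: in_keys_iff)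
qed

context comm_ring_hom
begin

lemma mev_superset:
  assumes "finite S" "Poly_Mapping.keys f \<subseteq> S"
  shows "mev hom v f = (\<Sum>t\<in>S. hom (Poly_Mapping.lookup f t) * mval v t)"
  unfolding mev_def by (rule sum.mono_neutral_left) (use assms in \<open>auto simp: in_keys_iff\<close>)

lemma mev_single: "mev hom v (Poly_Mapping.single t c) = hom c * mval v t"
  by (subst mev_superset[of "{t}"]) auto

lemma mev_add: "mev hom v (f + g) = mev hom v f + mev hom v g"
  by (subst (1 2 3) mev_superset[of "Poly_Mapping.keys f \<union> Poly_Mapping.keys g"])
     (use keys_add[of f g] in \<open>auto simp: lookup_add hom_add algebra_simps sum.distrib\<close>)

lemma mev_zero: "mev hom v 0 = 0" by (simp add: mev_def)

lemma mev_sum: "mev hom v (\<Sum>i\<in>S. f i) = (\<Sum>i\<in>S. mev hom v (f i))"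
  by (induction S rule: infinite_finite_induct) (auto simp: mev_add mev_zero)

lemma mev_times: "mev hom v (f * g) = mev hom v f * mev hom v g"
proof -
  let ?m = "\<lambda>f t. Poly_Mapping.single t (Poly_Mapping.lookup f t)"
  have monomial: "mev hom v (Poly_Mapping.single s a * Poly_Mapping.single t b) = hom a * mval v s * (hom b * mval v t)" for s t a b
    by (simp only: mult_single mev_single hom_mult mval_add mult_ac)
  have "f * g = (\<Sum>s\<in>Poly_Mapping.keys f. ?m f s) * (\<Sum>t\<in>Poly_Mapping.keys g. ?m g t)"
    using mpoly_monomials[of f] mpoly_monomials[of g] by simp
  also have "mev hom v \<dots> = (\<Sum>s\<in>Poly_Mapping.keys f. \<Sum>t\<in>Poly_Mapping.keys g. hom (Poly_Mapping.lookup f s) * mval v s * (hom (Poly_Mapping.lookup g t) * mval v t))"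
    by (simp only: sum_product mev_sum monomial)
  also have "\<dots> = mev hom v f * mev hom v g"
    by (simp add: mev_def sum_product)
  finally show ?thesis .
qed

lemma comm_ring_hom_mev: "comm_ring_hom (mev hom v)"
proof (rule comm_ring_homI)
  show "mev hom v 1 = 1" using mev_single[of v 0 1] by (simp add: single_one)
qed (simp_all add: mev_add mev_times mev_zero)

lemma mev_kc: "mev hom v (kc c) = hom c" by (simp add: kc_def mev_single)

lemma mev_xv: "mev hom v (xv i) = v i"
proof -
  have "mval v (Poly_Mapping.single i 1) = (\<Prod>j\<in>UNIV. if j = i then v i else 1)"
    unfolding mval_def by (rule prod.cong) (auto simp: lookup_single when_def)
  then show ?thesis by (simp add: xv_def mev_single)
qed

end

lemma mval_xv: "mval xv t = Poly_Mapping.single t (1 :: 'k::comm_ring_1)"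
proof -
  have pow: "xv i ^ k = Poly_Mapping.single (Poly_Mapping.single i k) (1 :: 'k)" for i :: 'a and k
    by (induction k) (simp_all add: xv_def mult_single single_add[symmetric] single_one plus_1_eq_Suc)
  have "(\<Prod>i\<in>S. Poly_Mapping.single (g i) (1 :: 'k)) = Poly_Mapping.single (sum g S) 1"
    if "finite S" for S :: "'a set" and g :: "'a \<Rightarrow> 'a \<Rightarrow>\<^sub>0 nat"
    using that by induction (simp_all add: mult_single)
  then have "mval xv t = Poly_Mapping.single (\<Sum>i\<in>UNIV. Poly_Mapping.single i (Poly_Mapping.lookup t i)) (1 :: 'k)"
    by (simp add: mval_def pow)
  also have "(\<Sum>i\<in>UNIV. Poly_Mapping.single i (Poly_Mapping.lookup t i)) = t"
  proof (rule poly_mapping_eqI)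
    fix j
    have "Poly_Mapping.lookup (\<Sum>i\<in>UNIV. Poly_Mapping.single i (Poly_Mapping.lookup t i)) j = (\<Sum>i\<in>UNIV. if i = j then Poly_Mapping.lookup t j else 0)"
      unfolding lookup_sum by (rule sum.cong) (auto simp: lookup_single when_def)
    then show "Poly_Mapping.lookup (\<Sum>i\<in>UNIV. Poly_Mapping.single i (Poly_Mapping.lookup t i)) j = Poly_Mapping.lookup t j" by simp
  qed
  finally show ?thesis .
qed

lemma mpoly_hom_eq_mev:
  assumes "comm_ring_hom (F :: ('n::finite, 'k::comm_ring_1) mpoly \<Rightarrow> 'b::comm_ring_1)"
  shows "F f = mev (\<lambda>c. F (kc c)) (\<lambda>i. F (xv i)) f"
proof -
  interpret F: comm_ring_hom F by fact
  have "F (Poly_Mapping.single t c) = F (kc c) * mval (\<lambda>i. F (xv i)) t" for t c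
  proof -
    have "Poly_Mapping.single t c = kc c * mval xv t" by (simp add: mval_xv kc_def mult_single)
    then show ?thesis by (simp add: F.hom_mult mval_def F.hom_prod F.hom_power)
  qed
  then have "F (\<Sum>t\<in>Poly_Mapping.keys f. Poly_Mapping.single t (Poly_Mapping.lookup f t)) = mev (\<lambda>c. F (kc c)) (\<lambda>i. F (xv i)) f"
    by (simp add: F.hom_sum mev_def)
  then show ?thesis using mpoly_monomials[of f] by simp
qed

lemma mpoly_hom_ext:
  assumes "comm_ring_hom (F :: ('n::finite, 'k::comm_ring_1) mpoly \<Rightarrow> 'b::comm_ring_1)" "comm_ring_hom G"
    and "\<And>c. F (kc c) = G (kc c)" "\<And>i. F (xv i) = G (xv i)"
  shows "F f = G f"
  using mpoly_hom_eq_mev[OF assms(1), of f] mpoly_hom_eq_mev[OF assms(2), of f] assms(3,4) by simp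

lemma comm_ring_hom_kc: "comm_ring_hom (kc :: 'k::comm_ring_1 \<Rightarrow> ('n, 'k) mpoly)"
  by (rule comm_ring_homI) (simp_all add: kc_def single_add mult_single)

lemma comm_ring_hom_C_kc: "comm_ring_hom (\<lambda>c :: 'k::comm_ring_1. [:kc c :: ('n, 'k) mpoly:])"
  by (rule comm_ring_hom_comp[OF _ comm_ring_hom_kc]) unfold_locales

text \<open>\<open>ret V f = f\<close> says that \<open>f\<close> involves only variables from \<open>V\<close>.\<close>

definition ret :: "'n::finite set \<Rightarrow> ('n, 'k::comm_ring_1) mpoly \<Rightarrow> ('n, 'k) mpoly"
  where "ret V = mev kc (\<lambda>i. if i \<in> V then xv i else 0)"

text \<open>Nagata's substitution: the variable \<open>k\<close> becomes the variable \<open>t\<close> of the polynomials, and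
  \<open>t ^ e i\<close> is added to the variables \<open>i \<in> V\<close>.\<close>

definition nag :: "'n \<Rightarrow> 'n set \<Rightarrow> ('n \<Rightarrow> nat) \<Rightarrow> ('n::finite, 'k::comm_ring_1) mpoly \<Rightarrow> ('n, 'k) mpoly poly"
  where "nag k V e = mev (\<lambda>c. [:kc c:])
    (\<lambda>i. if i = k then [:0, 1:] else if i \<in> V then [:xv i:] + monom 1 (e i) else [:xv i:])"

text \<open>One half of the inverse of Nagata's substitution: the added powers are removed from the
  coefficients. \<open>unnag\<close> then replaces \<open>t\<close> by the variable
  \<open>k\<close>.\<close>

definition unnag0 :: "'n \<Rightarrow> 'n set \<Rightarrow> ('n \<Rightarrow> nat) \<Rightarrow> ('n::finite, 'k::comm_ring_1) mpoly \<Rightarrow> ('n, 'k) mpoly"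
  where "unnag0 k V e = mev kc (\<lambda>i. if i \<in> V then xv i - xv k ^ e i else xv i)"

definition unnag :: "'n \<Rightarrow> 'n set \<Rightarrow> ('n \<Rightarrow> nat) \<Rightarrow> ('n::finite, 'k::comm_ring_1) mpoly poly \<Rightarrow> ('n, 'k) mpoly"
  where "unnag k V e p = poly (map_poly (unnag0 k V e) p) (xv k)"

lemma hom_ret: "comm_ring_hom (ret V)"
  unfolding ret_def by (rule comm_ring_hom.comm_ring_hom_mev[OF comm_ring_hom_kc])
lemma hom_nag: "comm_ring_hom (nag k V e)"
  unfolding nag_def by (rule comm_ring_hom.comm_ring_hom_mev[OF comm_ring_hom_C_kc])
lemma hom_unnag0: "comm_ring_hom (unnag0 k V e)"
  unfolding unnag0_def by (rule comm_ring_hom.comm_ring_hom_mev[OF comm_ring_hom_kc])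
lemma hom_unnag: "comm_ring_hom (unnag k V e)"
  unfolding unnag_def by (rule comm_ring_hom_comp[OF hom_poly comm_ring_hom_map_poly[OF hom_unnag0]])

lemmas kc_simps = comm_ring_hom.mev_kc[OF comm_ring_hom_kc] comm_ring_hom.mev_xv[OF comm_ring_hom_kc]
  comm_ring_hom.mev_kc[OF comm_ring_hom_C_kc] comm_ring_hom.mev_xv[OF comm_ring_hom_C_kc]

lemma ret_simps [simp]: "ret V (kc c) = kc c" "ret V (xv i) = (if i \<in> V then xv i else 0)"
  by (simp_all add: ret_def kc_simps)

lemma nag_simps [simp]: "nag k V e (kc c) = [:kc c:]"
  "nag k V e (xv i) = (if i = k then [:0, 1:] else if i \<in> V then [:xv i:] + monom 1 (e i) else [:xv i:])"
  by (simp_all add: nag_def kc_simps)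

lemma unnag0_simps [simp]: "unnag0 k V e (kc c) = kc c"
  "unnag0 k V e (xv i) = (if i \<in> V then xv i - xv k ^ e i else xv i)"
  by (simp_all add: unnag0_def kc_simps)

lemma unnag_const [simp]: "unnag k V e [:f:] = unnag0 k V e f"
proof -
  interpret comm_ring_hom "unnag0 k V e" by (rule hom_unnag0)
  interpret m: map_poly_comm_ring_hom "unnag0 k V e" ..
  have "map_poly (unnag0 k V e) [:f:] = [:unnag0 k V e f:]"
    by (rule poly_eqI) (simp add: coeff_pCons split: nat.split)
  then show ?thesis by (simp add: unnag_def)
qed

lemma unnag_nag:
  fixes f :: "('a::finite, 'b::comm_ring_1) mpoly"
  shows "k \<notin> V \<Longrightarrow> unnag k V e (nag k V e f) = f"
proof (rule mpoly_hom_ext[OF comm_ring_hom_comp[OF hom_unnag hom_nag]])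
  interpret u: comm_ring_hom "unnag k V e" by (rule hom_unnag)
  interpret u0: comm_ring_hom "unnag0 k V e" by (rule hom_unnag0)
  interpret m: map_poly_comm_ring_hom "unnag0 k V e" ..
  show "comm_ring_hom (\<lambda>f. f)" by unfold_locales auto
  show "unnag k V e (nag k V e (kc c)) = (kc c :: ('a, 'b) mpoly)" for c by simp
  assume k: "k \<notin> V"
  have mon: "unnag k V e (monom 1 d :: ('a, 'b) mpoly poly) = xv k ^ d" for d
  proof -
    have "map_poly (unnag0 k V e) (monom 1 d :: ('a, 'b) mpoly poly) = monom 1 d" by (rule poly_eqI) simp
    then show ?thesis by (simp add: unnag_def poly_monom)
  qed
  have "monom 1 1 = (pCons 0 1 :: ('a, 'b) mpoly poly)" by (simp add: One_nat_def monom_Suc)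
  then have x: "unnag k V e (pCons 0 1 :: ('a, 'b) mpoly poly) = xv k" using mon[of 1] by simp
  show "unnag k V e (nag k V e (xv i)) = (xv i :: ('a, 'b) mpoly)" for i
    using k by (auto simp: x u.hom_add mon)
qed

lemma lookup_ret:
  fixes f :: "('n::finite, 'k::comm_ring_1) mpoly"
  shows "Poly_Mapping.lookup (ret V f) t = (if Poly_Mapping.keys t \<subseteq> V then Poly_Mapping.lookup f t else 0)"
proof -
  have mv: "mval (\<lambda>i. if i \<in> V then xv i else 0) s = (if Poly_Mapping.keys s \<subseteq> V then Poly_Mapping.single s 1 else 0 :: ('n, 'k) mpoly)" for s
  proof (cases "Poly_Mapping.keys s \<subseteq> V")
    case True
    then have "mval (\<lambda>i. if i \<in> V then xv i else 0) s = (mval xv s :: ('n, 'k) mpoly)"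
      unfolding mval_def
    proof (intro prod.cong refl)
      fix i
      show "(if i \<in> V then xv i else 0) ^ Poly_Mapping.lookup s i = (xv i :: ('n, 'k) mpoly) ^ Poly_Mapping.lookup s i"
      proof (cases "i \<in> V")
        case False
        then have "Poly_Mapping.lookup s i = 0" using True by (auto simp: in_keys_iff)
        then show ?thesis by simp
      qed simp
    qed
    then show ?thesis using True by (simp add: mval_xv)
  next
    case False
    then obtain i where "i \<notin> V" "Poly_Mapping.lookup s i \<noteq> 0" by (auto simp: in_keys_iff)
    then have "(0 :: ('n, 'k) mpoly) ^ Poly_Mapping.lookup s i = 0" by (intro zero_power) simp
    then have "\<exists>i\<in>UNIV. (if i \<in> V then xv i else 0 :: ('n, 'k) mpoly) ^ Poly_Mapping.lookup s i = 0" using \<open>i \<notin> V\<close> by auto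
    then have "mval (\<lambda>i. if i \<in> V then xv i else 0) s = (0 :: ('n, 'k) mpoly)"
      unfolding mval_def by (intro prod_zero) auto
    then show ?thesis using False by simp
  qed
  have "Poly_Mapping.lookup (ret V f) t = (\<Sum>s\<in>Poly_Mapping.keys f. if s = t then (if Poly_Mapping.keys t \<subseteq> V then Poly_Mapping.lookup f t else 0) else 0)"
    unfolding ret_def mev_def lookup_sum
    by (rule sum.cong) (auto simp: mv kc_def mult_single lookup_single when_def)
  then show ?thesis by (simp add: in_keys_iff)
qed

text \<open>Positional notation: the weight of each new variable exceeds all total weights so far,
  so the exponents are recovered from the total like digits.\<close>

lemma separating_weights:
  fixes S :: "('n \<Rightarrow> nat) set"
  assumes "finite S" "finite V" "k \<notin> V"
  shows "\<exists>e. (\<forall>j. 0 < e j) \<and> (\<forall>s\<in>S. \<forall>t\<in>S. s k + (\<Sum>j\<in>V. s j * e j) = t k + (\<Sum>j\<in>V. t j * e j) \<longrightarrow>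
    s k = t k \<and> (\<forall>j\<in>V. s j = t j))"
  using assms(2,3)
proof (induction V rule: finite_induct)
  case empty
  show ?case by (intro exI[of _ "\<lambda>_. 1"]) simp
next
  case (insert j V)
  then have "k \<notin> V" by blast
  from insert.IH[OF this] obtain e where e0: "\<forall>j. 0 < e j" "\<forall>s\<in>S. \<forall>t\<in>S.
    s k + (\<Sum>j\<in>V. s j * e j) = t k + (\<Sum>j\<in>V. t j * e j) \<longrightarrow> s k = t k \<and> (\<forall>j\<in>V. s j = t j)" by blast
  then have e: "\<And>j. 0 < e j" "\<And>s t. s \<in> S \<Longrightarrow> t \<in> S \<Longrightarrow>
    s k + (\<Sum>j\<in>V. s j * e j) = t k + (\<Sum>j\<in>V. t j * e j) \<Longrightarrow> s k = t k \<and> (\<forall>j\<in>V. s j = t j)" by blast+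
  define w where "w t = t k + (\<Sum>j\<in>V. t j * e j)" for t
  define W where "W = Suc (\<Sum>t\<in>S. w t)"
  have W: "w t < W" if "t \<in> S" for t
    unfolding W_def using member_le_sum[of t S w] assms(1) that by simp
  define e' where "e' = e(j := W)"
  have w': "t k + (\<Sum>i\<in>insert j V. t i * e' i) = w t + t j * W" for t
  proof -
    have "(\<Sum>i\<in>V. t i * e' i) = (\<Sum>i\<in>V. t i * e i)"
      by (rule sum.cong) (use insert in \<open>auto simp: e'_def\<close>)
    then show ?thesis using insert by (simp add: w_def e'_def)
  qed
  show ?case
  proof (intro exI[of _ e'] conjI allI ballI impI)
    show "0 < e' i" for i using e by (simp add: e'_def W_def)
    fix s t assume st: "s \<in> S" "t \<in> S"
      "s k + (\<Sum>i\<in>insert j V. s i * e' i) = t k + (\<Sum>i\<in>insert j V. t i * e' i)"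
    then have eq: "w s + s j * W = w t + t j * W" unfolding w' by simp
    have "(w s + s j * W) div W = s j" "(w t + t j * W) div W = t j" using W[OF st(1)] W[OF st(2)] by simp_all
    then have "s j = t j" using eq by simp
    then have "w s = w t" using eq by simp
    then have st': "s k = t k \<and> (\<forall>j\<in>V. s j = t j)"
      by (intro e(2)[OF st(1,2)]) (simp only: w_def)
    then show "s k = t k" by blast
    show "s i = t i" if "i \<in> insert j V" for i using that \<open>s j = t j\<close> st' by blast
  qed
qed

text \<open>Under separating weights distinct monomials acquire distinct degrees in
  \<open>t\<close>, and each contributes its bare coefficient as leading coefficient. So nothing
  cancels in the top degree.\<close>

theorem nagata:
  fixes f :: "('n::{finite, linorder}, 'k::field) mpoly"
  assumes f: "f \<noteq> 0" "ret (insert k V) f = f" and k: "k \<notin> V"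
  obtains e c where "c \<noteq> 0" "lead_coeff (nag k V e f) = kc c"
proof -
  have supp: "Poly_Mapping.keys t \<subseteq> insert k V" if "t \<in> Poly_Mapping.keys f" for t
    using lookup_ret[of "insert k V" f t] that f(2) by (auto simp: in_keys_iff split: if_splits)
  have "finite (Poly_Mapping.lookup ` Poly_Mapping.keys f)" by simp
  from separating_weights[OF this finite k] obtain e where e: "\<And>j. 0 < e j"
    and inj: "\<forall>s\<in>Poly_Mapping.lookup ` Poly_Mapping.keys f. \<forall>t\<in>Poly_Mapping.lookup ` Poly_Mapping.keys f.
      s k + (\<Sum>j\<in>V. s j * e j) = t k + (\<Sum>j\<in>V. t j * e j) \<longrightarrow> s k = t k \<and> (\<forall>j\<in>V. s j = t j)"
    by blast
  define w where "w t = Poly_Mapping.lookup t k + (\<Sum>j\<in>V. Poly_Mapping.lookup t j * e j)" for t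
  have w_inj: "s = t" if "s \<in> Poly_Mapping.keys f" "t \<in> Poly_Mapping.keys f" "w s = w t" for s t
  proof (rule poly_mapping_eqI)
    fix j
    have "Poly_Mapping.lookup s k = Poly_Mapping.lookup t k \<and> (\<forall>j\<in>V. Poly_Mapping.lookup s j = Poly_Mapping.lookup t j)"
      by (rule inj[rule_format, OF imageI[OF that(1)] imageI[OF that(2)]]) (use that(3) in \<open>simp add: w_def\<close>)
    moreover have "Poly_Mapping.lookup s j = 0 \<and> Poly_Mapping.lookup t j = 0" if "j \<notin> insert k V"
      using supp[OF \<open>s \<in> Poly_Mapping.keys f\<close>] supp[OF \<open>t \<in> Poly_Mapping.keys f\<close>] that by (auto simp: in_keys_iff)
    ultimately show "Poly_Mapping.lookup s j = Poly_Mapping.lookup t j" by (cases "j \<in> insert k V") auto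
  qed
  define v :: "'n \<Rightarrow> ('n, 'k) mpoly poly"
    where "v i = (if i = k then [:0, 1:] else if i \<in> V then [:xv i:] + monom 1 (e i) else [:xv i:])" for i
  have nf: "nag k V e f = (\<Sum>t\<in>Poly_Mapping.keys f. [:kc (Poly_Mapping.lookup f t):] * mval v t)"
    unfolding nag_def mev_def v_def ..
  have vV: "degree (v i) = e i \<and> lead_coeff (v i) = 1" if "i \<in> V" for i
  proof -
    have "v i = monom 1 (e i) + [:xv i:]" using that k by (auto simp: v_def)
    moreover have "degree (monom 1 (e i) + [:xv i:] :: ('n, 'k) mpoly poly) = e i"
      using e[of i] by (subst degree_add_eq_left) (auto simp: degree_monom_eq)
    moreover have "coeff ([:xv i:] :: ('n, 'k) mpoly poly) (e i) = 0" using e[of i] by (simp add: coeff_pCons split: nat.split)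
    ultimately show ?thesis by simp
  qed
  have vk: "degree (v k) = 1 \<and> lead_coeff (v k) = 1" by (simp add: v_def One_nat_def)
  have mon: "degree (mval v t) = w t \<and> lead_coeff (mval v t) = 1" if "t \<in> Poly_Mapping.keys f" for t
  proof -
    have "mval v t = (\<Prod>i\<in>insert k V. v i ^ Poly_Mapping.lookup t i)"
      unfolding mval_def
    proof (rule prod.mono_neutral_right)
      show "\<forall>i\<in>UNIV - insert k V. v i ^ Poly_Mapping.lookup t i = 1"
      proof
        fix i assume "i \<in> UNIV - insert k V"
        then have "Poly_Mapping.lookup t i = 0" using supp[OF that] by (auto simp: in_keys_iff)
        then show "v i ^ Poly_Mapping.lookup t i = 1" by simp
      qed
    qed auto
    moreover have "lead_coeff (\<Prod>i\<in>insert k V. v i ^ Poly_Mapping.lookup t i) = 1"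
    proof -
      have "lead_coeff (v i) = 1" if "i \<in> insert k V" for i using vV vk that by auto
      then show ?thesis unfolding lead_coeff_prod lead_coeff_power by (intro prod.neutral ballI) (simp only: power_one)
    qed
    moreover have "degree (\<Prod>i\<in>insert k V. v i ^ Poly_Mapping.lookup t i) = (\<Sum>i\<in>insert k V. degree (v i ^ Poly_Mapping.lookup t i))"
    proof (rule degree_prod_eq_sum_degree)
      show "\<forall>i\<in>insert k V. v i ^ Poly_Mapping.lookup t i \<noteq> 0" using vV vk by (metis insertE leading_coeff_0_iff power_not_zero zero_neq_one)
    qed
    moreover have "(\<Sum>i\<in>insert k V. degree (v i ^ Poly_Mapping.lookup t i)) = w t"
    proof -
      have deg: "degree (v i ^ m) = m * degree (v i)" if "i \<in> insert k V" for i m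
      proof -
        have "lead_coeff (v i) = 1" using vV vk that by auto
        then have "v i \<noteq> 0" by auto
        then show ?thesis by (induction m) (simp_all add: degree_mult_eq)
      qed
      have "(\<Sum>i\<in>V. degree (v i ^ Poly_Mapping.lookup t i)) = (\<Sum>i\<in>V. Poly_Mapping.lookup t i * e i)"
        by (rule sum.cong) (use deg vV in auto)
      then show ?thesis using k deg[of k] vk by (simp add: w_def)
    qed
    ultimately show ?thesis by simp
  qed
  have ne: "Poly_Mapping.keys f \<noteq> {}" using f(1) by simp
  define N where "N = Max (w ` Poly_Mapping.keys f)"
  have "N \<in> w ` Poly_Mapping.keys f" unfolding N_def by (rule Max_in) (use ne in auto)
  then obtain t0 where t0: "t0 \<in> Poly_Mapping.keys f" "w t0 = N" by auto
  have le: "w t \<le> N" if "t \<in> Poly_Mapping.keys f" for t using that by (simp add: N_def)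
  have cf: "coeff ([:kc (Poly_Mapping.lookup f t):] * mval v t) j = 0"
    if "t \<in> Poly_Mapping.keys f" "w t < j" for t j
  proof -
    have "coeff (mval v t) j = 0" using mon[OF that(1)] that(2) by (intro coeff_eq_0) simp
    then show ?thesis by simp
  qed
  have "coeff (nag k V e f) N = (\<Sum>t\<in>Poly_Mapping.keys f. if t = t0 then kc (Poly_Mapping.lookup f t0) else 0)"
    unfolding nf coeff_sum
  proof (rule sum.cong)
    fix t assume t: "t \<in> Poly_Mapping.keys f"
    show "coeff ([:kc (Poly_Mapping.lookup f t):] * mval v t) N = (if t = t0 then kc (Poly_Mapping.lookup f t0) else 0)"
    proof (cases "t = t0")
      case True
      have "coeff (mval v t0) N = 1" using mon[OF t0(1)] t0(2) by metis
      then show ?thesis using True by simp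
    next
      case False
      then have "w t < N" using le[OF t] w_inj[OF t t0(1)] t0(2) by fastforce
      then show ?thesis using cf[OF t] False by (simp del: mult_pCons_left)
    qed
  qed simp
  then have cN: "coeff (nag k V e f) N = kc (Poly_Mapping.lookup f t0)" using t0 by simp
  have up: "coeff (nag k V e f) j = 0" if "N < j" for j
    unfolding nf coeff_sum by (rule sum.neutral) (use cf le that in \<open>meson le_less_trans\<close>)
  have c0: "Poly_Mapping.lookup f t0 \<noteq> 0" using t0 by (simp add: in_keys_iff)
  then have "kc (Poly_Mapping.lookup f t0) \<noteq> (0 :: ('n, 'k) mpoly)" by (metis kc_def lookup_single_eq lookup_zero)
  then have "degree (nag k V e f) = N"
    using cN up by (intro antisym degree_le le_degree) auto
  then show ?thesis using that[OF c0, of e] cN by simp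
qed

subsection \<open>The theorem of Quillen and Suslin\<close>

lemma pvt_inverse:
  assumes "i < n" "u * a = (1 :: 'a::comm_ring_1)"
  shows "pvt n i 1 u (\<lambda>j. - (c j * u)) * pvt n i 1 a c = I n" "pvt n i 1 a c * pvt n i 1 u (\<lambda>j. - (c j * u)) = I n"
proof -
  let ?P = "pvt n i 1 u (\<lambda>j. - (c j * u))" and ?Q = "pvt n i 1 a c"
  have "a * u = 1" using assms(2) by (simp only: mult.commute)
  then have ua: "u * (a * x) = x" "a * (u * x) = x" for x
    by (simp_all only: mult.assoc[symmetric] assms(2) mult_1)
  have cua: "- (x * u) * (a * y) = - (x * y)" "- (x * u) * y = - (x * (u * y))" for x y
    by (simp_all only: mult.assoc ua mult_minus_left)
  have "ent (?P * (?Q * I n)) k l = ent (I n) k l" "ent (?Q * (?P * I n)) k l = ent (I n) k l" for k l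
    unfolding ent_pvt_times[OF assms(1)] using carrD[OF carr_I, of n k l]
    by (cases "k < n"; cases "k = i"; simp only: if_True if_False simp_thms assms(1) cua ua mult_1 add.assoc; simp)+
  then have "?P * (?Q * I n) = I n" "?Q * (?P * I n) = I n" by (blast intro: fmat_eqI)+
  moreover have "carr n n ?P" "carr n n ?Q" by (simp_all add: pvt_def)
  ultimately show "?P * ?Q = I n" "?Q * ?P = I n" by (simp_all add: times_I)
qed

lemma col_eq_pvt:
  assumes "i < n" "u * a = (1 :: 'a::comm_ring_1)"
  shows "col_eq n v (pvt n i 1 u (\<lambda>j. - (c j * u)) * v)"
  unfolding col_eq_def using pvt_inverse[OF assms, of c]
  by (intro exI[of _ "pvt n i 1 u (\<lambda>j. - (c j * u))"] exI[of _ "pvt n i 1 a c"]) (simp add: pvt_def)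

lemma col_eq_unit_col:
  assumes "i < n" "u * ent v i 0 = (1 :: 'a::comm_ring_1)" "carr n 1 v"
  shows "col_eq n v (unit_col n i)"
proof -
  let ?P = "pvt n i 1 u (\<lambda>j. - (ent v j 0 * u))"
  have "?P * v = unit_col n i"
    by (rule fmat_eqI) (use assms carrD[OF assms(3)] in \<open>auto simp: ent_pvt_times unit_col_def mult.assoc\<close>)
  then show ?thesis using col_eq_pvt[OF assms(1,2), of v "\<lambda>j. ent v j 0"] by simp
qed

lemma col_eq_I1_if_unit:
  assumes "i < n" "u * ent v i 0 = (1 :: 'a::comm_ring_1)" "carr n 1 v"
  shows "col_eq n v (I 1)"
proof -
  have I1: "unit_col n 0 = (I 1 :: 'a fmat)" using assms(1) by (intro fmat_eqI) (auto simp: unit_col_def)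
  show ?thesis
  proof (cases "i = 0")
    case True
    then show ?thesis using col_eq_unit_col[OF assms] I1 by simp
  next
    case False
    \<comment> \<open>Adding row \<open>i\<close> to row 0 creates a 1 in position 0, which then
      serves as the pivot.\<close>
    let ?v = "pvt n i 1 1 (\<lambda>j. - ((if j = 0 then - 1 else 0) * 1)) * unit_col n i :: 'a fmat"
    have "col_eq n (unit_col n i) ?v" by (rule col_eq_pvt[OF assms(1)]) simp
    moreover have "col_eq n ?v (unit_col n 0)"
    proof (rule col_eq_unit_col[of _ _ 1])
      show "carr n 1 ?v" by (rule carr_times[of n n _ n]) (simp_all add: pvt_def unit_col_def)
      show "0 < n" using assms(1) by simp
      then show "1 * ent ?v 0 0 = 1" using assms(1) False by (simp add: ent_pvt_times unit_col_def)
    qed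
    ultimately show ?thesis using col_eq_unit_col[OF assms] I1 col_eq_trans by metis
  qed
qed

text \<open>The matrix with rows \<open>w\<close> and \<open>(- v1, v0)\<close> has determinant
  \<open>w * v = 1\<close> and sends \<open>v\<close> to the first unit column. This covers the
  length below the range of Horrocks's theorem.\<close>

lemma col_eq_I1_dim2:
  fixes v w :: "'a::comm_ring_1 fmat"
  assumes v: "carr 2 1 v" "carr 1 2 w" "w * v = I 1"
  shows "col_eq 2 v (I 1)"
proof -
  have two: "{..<2::nat} = {0, 1}" by auto
  have "ent (w * v) 0 0 = 1" by (simp add: v)
  then have *: "ent w 0 0 * ent v 0 0 + ent w 0 1 * ent v 1 0 = 1"
    by (simp add: ent_times_carr[OF v(2)] two)
  then have **: "ent v 1 0 * ent w 0 1 + ent v 0 0 * ent w 0 0 = 1"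
    "ent v 0 0 * ent w 0 0 + ent w 0 1 * ent v 1 0 = 1" "ent v 1 0 * ent w 0 1 + ent w 0 0 * ent v 0 0 = 1"
    by (metis add.commute mult.commute)+
  define U where "U = fm 2 2 (\<lambda>i j. if i = 0 then ent w 0 j else if j = 0 then - ent v 1 0 else ent v 0 0)"
  define U' where "U' = fm 2 2 (\<lambda>i j. if j = 0 then ent v i 0 else if i = 0 then - ent w 0 1 else ent w 0 0)"
  have c: "carr 2 2 U" "carr 2 2 U'" by (simp_all add: U_def U'_def)
  have U: "ent U 0 0 = ent w 0 0" "ent U 0 1 = ent w 0 1" "ent U 1 0 = - ent v 1 0" "ent U 1 1 = ent v 0 0"
    "ent U' 0 0 = ent v 0 0" "ent U' 1 0 = ent v 1 0" "ent U' 0 1 = - ent w 0 1" "ent U' 1 1 = ent w 0 0"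
    by (simp_all add: U_def U'_def)
  have prod: "ent (A * B) i j = ent A i 0 * ent B 0 j + ent A i 1 * ent B 1 j" if "carr 2 2 A" for A B :: "'a fmat" and i j
    by (simp add: ent_times_carr[OF that] two)
  have eq2: "A = B" if "carr 2 2 A" "carr 2 2 B" "ent A 0 0 = ent B 0 0" "ent A 0 1 = ent B 0 1"
    "ent A 1 0 = ent B 1 0" "ent A 1 1 = ent B 1 1" for A B :: "'a fmat"
  proof (rule fmat_eqI)
    fix i j
    show "ent A i j = ent B i j"
    proof (cases "i < 2 \<and> j < 2")
      case True
      then have "i = 0 \<or> i = 1" "j = 0 \<or> j = 1" by auto
      then show ?thesis using that by auto
    next
      case False
      then show ?thesis using carrD[OF that(1)] carrD[OF that(2)] by (metis not_less)
    qed
  qed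
  have "U * U' = I 2"
    by (rule eq2) (use * ** in \<open>simp_all add: carr_times[OF c] prod[OF c(1)] U mult.commute\<close>)
  moreover have "U' * U = I 2"
    by (rule eq2) (use * ** in \<open>simp_all add: carr_times[OF c(2,1)] prod[OF c(2)] U mult.commute\<close>)
  moreover have "U * v = I 1"
    by (rule eq2) (use * ** carrD[OF v(1)] in \<open>simp_all add: carr_mono[OF carr_times[OF c(1) v(1)]] carr_mono[OF carr_I] prod[OF c(1)] U mult.commute\<close>)
  ultimately show ?thesis unfolding col_eq_def using c by blast
qed

lemma col_eq_sm:
  assumes "col_eq n (sm a v) (sm a v')" "b * a = (1 :: 'a::comm_ring_1)"
  shows "col_eq n v v'"
proof -
  obtain U U' where U: "carr n n U" "carr n n U'" "U * U' = I n" "U' * U = I n" "U * sm a v = sm a v'"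
    using assms(1) unfolding col_eq_def by blast
  have "sm b (U * sm a v) = sm b (sm a v')" by (simp only: U(5))
  then have "U * v = v'" by (simp add: times_sm sm_sm assms(2))
  then show ?thesis unfolding col_eq_def using U by blast
qed

lemma ret_empty: "ret {} f = kc (Poly_Mapping.lookup f 0)"
  by (rule poly_mapping_eqI) (auto simp: lookup_ret kc_def lookup_single when_def)

lemma ret_UNIV [simp]: "ret UNIV f = f"
  by (rule poly_mapping_eqI) (simp add: lookup_ret)

lemma kc_times: "kc a * kc b = (kc (a * b) :: ('n, 'k::comm_ring_1) mpoly)"
  by (simp add: kc_def mult_single)

lemma kc_1 [simp]: "kc 1 = (1 :: ('n, 'k::comm_ring_1) mpoly)"
  by (simp add: kc_def single_one)

lemma kc_inverse: "c \<noteq> 0 \<Longrightarrow> kc (inverse c) * kc c = (1 :: ('n, 'k::field) mpoly)"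
  by (simp add: kc_times)

lemma kc_inverse': "c \<noteq> 0 \<Longrightarrow> kc c * kc (inverse c) = (1 :: ('n, 'k::field) mpoly)"
  by (simp add: kc_times)

text \<open>The variable \<open>k\<close> has turned into \<open>t\<close>, so the coefficients
  involve one variable less. This drives both inductions below.\<close>

lemma ret_map_poly_nag:
  assumes "k \<notin> V" "ret (insert k V) f = f"
  shows "map_poly (ret V) (nag k V e f) = (nag k V e f :: ('n::finite, 'k::comm_ring_1) mpoly poly)"
proof -
  interpret comm_ring_hom "ret V :: ('n, 'k) mpoly \<Rightarrow> _" by (rule hom_ret)
  interpret m: map_poly_comm_ring_hom "ret V :: ('n, 'k) mpoly \<Rightarrow> _" ..
  interpret n: comm_ring_hom "nag k V e :: ('n, 'k) mpoly \<Rightarrow> _" by (rule hom_nag)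
  have C: "map_poly (ret V) [:g:] = [:ret V g:]" for g :: "('n, 'k) mpoly"
    by (rule poly_eqI) (simp add: coeff_pCons split: nat.split)
  have M: "map_poly (ret V) (monom 1 d) = monom (1 :: ('n, 'k) mpoly) d" for d by (rule poly_eqI) simp
  have T: "map_poly (ret V) (pCons 0 1) = (pCons 0 1 :: ('n, 'k) mpoly poly)"
    by (rule poly_eqI) (simp add: coeff_pCons split: nat.split)
  have h: "comm_ring_hom (\<lambda>f. nag k V e (ret (insert k V) f :: ('n, 'k) mpoly))"
    by (rule comm_ring_hom_comp[OF hom_nag hom_ret])
  have "map_poly (ret V) (nag k V e (ret (insert k V) f)) = nag k V e (ret (insert k V) f)"
  proof (rule mpoly_hom_ext[OF comm_ring_hom_comp[OF comm_ring_hom_map_poly[OF hom_ret] h] h])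
    show "map_poly (ret V) (nag k V e (ret (insert k V) (kc c))) = nag k V e (ret (insert k V) (kc c :: ('n, 'k) mpoly))" for c
      by (simp add: C)
    show "map_poly (ret V) (nag k V e (ret (insert k V) (xv i))) = nag k V e (ret (insert k V) (xv i :: ('n, 'k) mpoly))" for i
      using assms(1) by (auto simp: m.hom_add M C T)
  qed
  then show ?thesis by (simp add: assms(2))
qed

text \<open>The induction is on the variables that occur in \<open>v\<close>; those of
  \<open>w\<close> are not restricted. After normalisation one entry has a constant leading
  coefficient, so the column is equivalent to its value at \<open>t = 0\<close>.\<close>

theorem qs_columns:
  fixes v w :: "('n::{finite, linorder}, 'k::field) mpoly fmat"
  assumes "finite V" "carr n 1 v" "carr 1 n w" "w * v = I 1" "fmap (ret V) v = v"
  shows "col_eq n v (I 1)"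
  using assms
proof (induction V arbitrary: v w rule: finite_induct)
  case empty
  have "v \<noteq> 0" using empty by auto
  then obtain i j where ij: "ent v i j \<noteq> 0" by (auto simp: fmat_eq_iff)
  then have i: "i < n" "j = 0" using carrD[OF empty(1)] by (meson not_less less_one)+
  have "ent v i 0 = ret {} (ent v i 0)"
    using arg_cong[OF empty(4), of "\<lambda>M. ent M i 0"] by (simp add: comm_ring_hom.ent_fmap_hom[OF hom_ret])
  then obtain c where c: "ent v i 0 = kc c" by (metis ret_empty)
  then have "c \<noteq> 0" using ij i by (auto simp: kc_def)
  then have "kc (inverse c) * ent v i 0 = 1" by (simp add: c kc_inverse)
  then show ?case using col_eq_I1_if_unit[OF i(1) _ empty(1)] by blast
next
  case (insert k V)
  consider "n = 0" | "n = 1" | "n = 2" | "3 \<le> n" by linarith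
  then show ?case
  proof cases
    case 1
    then have "v = 0" using insert.prems(1) by (intro fmat_eqI) (auto simp: carr_def)
    then show ?thesis using insert.prems by simp
  next
    case 2
    have "ent (w * v) 0 0 = 1" by (simp add: insert.prems)
    then have "ent w 0 0 * ent v 0 0 = 1"
      using insert.prems(2) 2 by (subst (asm) ent_times_carr[of 1 1]) (simp_all add: One_nat_def)
    then show ?thesis using 2 insert.prems col_eq_I1_if_unit[of 0 n] by simp
  next
    case 3
    then show ?thesis using col_eq_I1_dim2 insert.prems by metis
  next
    case 4
    have "v \<noteq> 0" using insert by auto
    then obtain i j where ij: "ent v i j \<noteq> 0" by (auto simp: fmat_eq_iff)
    then have i: "i < n" "j = 0" using carrD[OF insert.prems(1)] by (meson not_less less_one)+
    have fixed: "ret (insert k V) (ent v l 0) = ent v l 0" for l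
      using arg_cong[OF insert.prems(4), of "\<lambda>M. ent M l 0"] by (simp add: comm_ring_hom.ent_fmap_hom[OF hom_ret])
    obtain e c where c: "c \<noteq> 0" "lead_coeff (nag k V e (ent v i 0)) = kc c"
      using nagata[OF _ fixed insert.hyps(2)] ij i by metis
    let ?N = "fmap (nag k V e)" and ?c = "[:kc (inverse c):] :: ('n, 'k) mpoly poly"
    note hn = comm_ring_hom.fmap_simps[OF hom_nag] comm_ring_hom.fmap_I[OF hom_nag]
    note cn = comm_ring_hom.fmap_carr[OF hom_nag]
    have cc: "[:kc c:] * ?c = (1 :: ('n, 'k) mpoly poly)" and cc': "?c * [:kc c:] = 1" by (simp_all add: kc_inverse[OF c(1)] kc_inverse'[OF c(1)] one_pCons[symmetric])
    have wv: "?N w * ?N v = I 1" using arg_cong[OF insert.prems(3), of ?N] by (simp add: hn)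
    have "col_eq n (sm ?c (?N v)) (cst (ev0 (sm ?c (?N v))))"
    proof (rule monic_col_eq_ev0[OF 4 _ _ _ i(1)])
      show "carr n 1 (sm ?c (?N v))" "carr 1 n (sm [:kc c:] (?N w))" by (intro carr_sm cn insert.prems)+
      show "sm [:kc c:] (?N w) * sm ?c (?N v) = I 1"
        by (simp only: sm_times times_sm sm_sm cc cc' wv sm_1)
      have "ent (sm ?c (?N v)) i 0 = smult (kc (inverse c)) (nag k V e (ent v i 0))"
        by (simp add: comm_ring_hom.ent_fmap_hom[OF hom_nag])
      moreover have "kc (inverse c) \<noteq> (0 :: ('n, 'k) mpoly)" using kc_inverse[OF c(1)] by (metis mult_zero_left zero_neq_one)
      ultimately show "lead_coeff (ent (sm ?c (?N v)) i 0) = 1" using c(2) kc_inverse[OF c(1)] by (simp only: lead_coeff_smult)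
    qed
    moreover have "cst (ev0 (sm ?c (?N v))) = sm ?c (cst (ev0 (?N v)))"
      by (rule fmat_eqI) (simp add: ent_fmap)
    ultimately have const: "col_eq n (?N v) (cst (ev0 (?N v)))" using col_eq_sm[OF _ cc] by simp
    have 1: "col_eq n v (fmap (unnag0 k V e) (ev0 (?N v)))"
    proof -
      have "fmap (unnag k V e) (?N v) = v"
        by (rule fmat_eqI) (simp add: comm_ring_hom.ent_fmap_hom[OF hom_unnag] comm_ring_hom.ent_fmap_hom[OF hom_nag] unnag_nag insert.hyps)
      moreover have "fmap (unnag k V e) (cst (ev0 (?N v))) = fmap (unnag0 k V e) (ev0 (?N v))"
        by (rule fmat_eqI) (simp add: comm_ring_hom.ent_fmap_hom[OF hom_unnag] comm_ring_hom.ent_fmap_hom[OF hom_unnag0])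
      ultimately show ?thesis
        using comm_ring_hom.col_eq_fmap[OF hom_unnag[of k V e] const] by simp
    qed
    note he = comm_ring_hom.fmap_times[OF hom_poly] comm_ring_hom.fmap_I[OF hom_poly]
    note ce = comm_ring_hom.fmap_carr[OF hom_poly]
    \<comment> \<open>The induction hypothesis is applied before the variables are changed back, as
      \<open>unnag0\<close> would reintroduce the variable \<open>k\<close>. The equivalence itself
      survives this homomorphism.\<close>
    have "col_eq n (ev0 (?N v)) (I 1)"
    proof (rule insert.IH)
      show "carr n 1 (ev0 (?N v))" "carr 1 n (ev0 (?N w))" by (intro ce cn insert.prems)+
      show "ev0 (?N w) * ev0 (?N v) = I 1" using arg_cong[OF wv, of ev0] by (simp add: he)
      show "fmap (ret V) (ev0 (?N v)) = ev0 (?N v)"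
      proof (rule fmat_eqI)
        fix a b
        have fixed: "ret (insert k V) (ent v a b) = ent v a b"
          using arg_cong[OF insert.prems(4), of "\<lambda>M. ent M a b"] by (simp add: comm_ring_hom.ent_fmap_hom[OF hom_ret])
        have "ret V (poly (nag k V e (ent v a b)) 0) = poly (map_poly (ret V) (nag k V e (ent v a b))) 0"
        proof -
          interpret comm_ring_hom "ret V :: ('n, 'k) mpoly \<Rightarrow> _" by (rule hom_ret)
          show ?thesis by (simp add: poly_0_coeff_0 coeff_map_poly)
        qed
        then show "ent (fmap (ret V) (ev0 (?N v))) a b = ent (ev0 (?N v)) a b"
          by (simp add: comm_ring_hom.ent_fmap_hom[OF hom_ret] comm_ring_hom.ent_fmap_hom[OF hom_nag] ent_fmap
              ret_map_poly_nag[OF insert.hyps(2) fixed])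
      qed
    qed
    from comm_ring_hom.col_eq_fmap[OF hom_unnag0[of k V e] this]
    have "col_eq n (fmap (unnag0 k V e) (ev0 (?N v))) (I 1)"
      by (simp add: comm_ring_hom.fmap_I[OF hom_unnag0])
    then show ?thesis by (rule col_eq_trans[OF 1])
  qed
qed

theorem hermite_mpoly: "hermite TYPE(('n::{finite, linorder}, 'k::field) mpoly)"
  unfolding hermite_def
proof (intro allI impI)
  fix n and v w :: "('n, 'k) mpoly fmat"
  assume "carr n 1 v" "carr 1 n w" "w * v = I 1"
  moreover have "fmap (ret UNIV) v = v" by (rule fmat_eqI) (simp add: ent_fmap)
  ultimately have "col_eq n v (I 1)" by (intro qs_columns[of UNIV]) auto
  then show "\<exists>U U'. carr n n U \<and> carr n n U' \<and> U * U' = I n \<and> U' * U = I n \<and> U * v = I 1"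
    unfolding col_eq_def .
qed

text \<open>The generic basis and its denominator involve no variables beyond those of
  \<open>e\<close>. After the substitution the idempotent \<open>p\<close> therefore involves only
  \<open>V\<close>, by \<open>p_fixed\<close>, and the induction hypothesis applies to it.\<close>

theorem qs_idempotents:
  fixes e :: "('n::{finite, linorder}, 'k::field) mpoly fmat"
  assumes "finite V" "carr n n e" "e * e = e" "fmap (ret V) e = e"
  shows "free e"
  using assms
proof (induction V arbitrary: n e rule: finite_induct)
  case empty
  obtain r X Y d where XY: "d \<noteq> 0" "X * Y = sm d e" "Y * X = sm d (I r)" "ret {} d = d"
    using idempotent_generically_free[OF empty(1,2)] hom_ret empty(3) by metis
  obtain c where c: "d = kc c" using XY(4) by (metis ret_empty)
  then have "c \<noteq> 0" using XY(1) by (auto simp: kc_def)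
  then have "kc (inverse c) * d = 1" by (simp add: c kc_inverse)
  then show ?case by (intro freeI[of "sm (kc (inverse c)) X" Y _ r]) (simp_all add: sm_times times_sm sm_sm XY)
next
  case (insert k V)
  obtain r X Y d where cXY: "carr n r X" "carr r n Y" and XY: "d \<noteq> 0" "X * Y = sm d e" "Y * X = sm d (I r)"
    "e * X = X" "Y * e = Y" and fixed: "fmap (ret (insert k V)) X = X" "fmap (ret (insert k V)) Y = Y" "ret (insert k V) d = d"
    using idempotent_generically_free[OF insert.prems(1,2)] hom_ret insert.prems(3) by metis
  obtain w c where c: "c \<noteq> 0" "lead_coeff (nag k V w d) = kc c"
    using nagata[OF XY(1) fixed(3) insert.hyps(2)] .
  let ?N = "fmap (nag k V w)" and ?c = "[:kc (inverse c):] :: ('n, 'k) mpoly poly"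
  note hn = comm_ring_hom.fmap_simps[OF hom_nag] comm_ring_hom.fmap_I[OF hom_nag]
  note cn = comm_ring_hom.fmap_carr[OF hom_nag]
  interpret monic_free "?N e" "?N X" "sm ?c (?N Y)" "?c * nag k V w d" n r
  proof
    have "kc (inverse c) \<noteq> (0 :: ('n, 'k) mpoly)" using kc_inverse[OF c(1)] by (metis mult_zero_left zero_neq_one)
    then show "lead_coeff (?c * nag k V w d) = 1" using c(2) kc_inverse[OF c(1)] by simp
    show "carr n n (?N e)" "carr n r (?N X)" "carr r n (sm ?c (?N Y))"
      by (intro carr_sm cn cXY insert.prems)+
    show "?N e * ?N e = ?N e" "?N e * ?N X = ?N X" by (simp_all only: hn(4)[symmetric] insert.prems XY)
    show "sm ?c (?N Y) * ?N e = sm ?c (?N Y)" by (simp only: sm_times hn(4)[symmetric] XY)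
    show "?N X * sm ?c (?N Y) = sm (?c * nag k V w d) (?N e)"
      by (simp only: times_sm hn(4)[symmetric] XY(2)) (simp only: hn(3) sm_sm)
    show "sm ?c (?N Y) * ?N X = sm (?c * nag k V w d) (I r)"
      by (simp only: sm_times hn(4)[symmetric] XY(3)) (simp only: hn(3,5) sm_sm)
  qed
  have ret_N: "fmap (map_poly (ret V)) (?N M) = ?N M" if "fmap (ret (insert k V)) M = M" for M
  proof (rule fmat_eqI)
    fix a b
    have "ret (insert k V) (ent M a b) = ent M a b"
      using arg_cong[OF that, of "\<lambda>M. ent M a b"] by (simp add: comm_ring_hom.ent_fmap_hom[OF hom_ret])
    then show "ent (fmap (map_poly (ret V)) (?N M)) a b = ent (?N M) a b"
      by (simp add: comm_ring_hom.ent_fmap_hom[OF comm_ring_hom_map_poly[OF hom_ret]]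
          comm_ring_hom.ent_fmap_hom[OF hom_nag] ret_map_poly_nag[OF insert.hyps(2)])
  qed
  have ret_c: "map_poly (ret V) ?c = ?c"
  proof -
    interpret comm_ring_hom "ret V :: ('n, 'k) mpoly \<Rightarrow> _" by (rule hom_ret)
    show ?thesis by (rule poly_eqI) (simp add: coeff_map_poly coeff_pCons split: nat.split)
  qed
  have ret_d: "map_poly (ret V) (?c * nag k V w d) = ?c * nag k V w d"
  proof -
    interpret m: comm_ring_hom "map_poly (ret V :: ('n, 'k) mpoly \<Rightarrow> _)" by (rule comm_ring_hom_map_poly[OF hom_ret])
    show ?thesis by (simp only: m.hom_mult ret_c ret_map_poly_nag[OF insert.hyps(2) fixed(3)])
  qed
  have ret_Y: "fmap (map_poly (ret V)) (sm ?c (?N Y)) = sm ?c (?N Y)"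
    by (simp only: comm_ring_hom.fmap_sm[OF comm_ring_hom_map_poly[OF hom_ret]] ret_c ret_N[OF fixed(2)])
  have "fmap (ret V) p = p"
    by (rule p_fixed[OF hom_ret ret_N[OF fixed(1)] ret_Y ret_d])
  then have "free p" by (rule insert.IH[OF QP(4) p_idem])
  then have "free (fmap (unnag k V w) (?N e))"
    by (rule free_if_free_p[OF hom_unnag hermite_mpoly])
  moreover have "fmap (unnag k V w) (?N e) = e"
    by (rule fmat_eqI) (simp add: comm_ring_hom.ent_fmap_hom[OF hom_unnag] comm_ring_hom.ent_fmap_hom[OF hom_nag] unnag_nag insert.hyps)
  ultimately show ?case by simp
qed

subsection \<open>Diagonalisation\<close>

lemma minor_full_rows:
  assumes "carr l m (M :: 'a::comm_ring_1 fmat)"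
  shows "\<exists>s. minor l f g M = s * minor l id g M"
proof (cases "inj_on f {0..<l} \<and> f ` {0..<l} \<subseteq> {0..<l}")
  case False
  have "minor l f g M = 0"
  proof (cases "inj_on f {0..<l}")
    case True
    then obtain i where "i \<in> {0..<l}" "f i \<notin> {0..<l}" using False by blast
    then have "i < l" "\<not> f i < l" by simp_all
    then show ?thesis using carrD[OF assms, of "f i"] by (intro minor_zero_row[of i l]) auto
  next
    case False
    then obtain i j where "i < l" "j < l" "i \<noteq> j" "f i = f j" by (auto simp: inj_on_def)
    then show ?thesis by (rule minor_noninj)
  qed
  then show ?thesis by (intro exI[of _ 0]) simp
next
  case True
  define p where "p i = (if i < l then f i else i)" for i
  have "inj_on p {0..<l}" "p ` {0..<l} \<subseteq> {0..<l}" using True by (auto simp: p_def inj_on_def)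
  then have "bij_betw p {0..<l} {0..<l}" by (simp add: bij_betw_def endo_inj_surj)
  then have p: "p permutes {0..<l}" by (rule bij_imp_permutes) (simp add: p_def)
  have "minor l f g M = minor l (\<lambda>i. id (p i)) g M" by (rule minor_cong) (simp_all add: p_def)
  then show ?thesis unfolding minor_permute_rows[OF p] by blast
qed

text \<open>The scalars up to which \<open>M\<close> has a right inverse form an ideal, and the
  adjugates put every maximal minor into it.\<close>

lemma full_rank_right_inverse:
  fixes M :: "'a::idom fmat"
  assumes M: "carr l m M" and "d \<in> minor_ideal l M"
  obtains H where "carr m l H" "M * H = sm d (I l)"
proof -
  define A where "A = {x. \<exists>H. carr m l H \<and> M * H = sm x (I l)}"
  have A: "is_ideal A"
    unfolding is_ideal_def
  proof (intro conjI ballI allI)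
    show "0 \<in> A" by (auto simp: A_def intro!: exI[of _ 0])
    fix x assume "x \<in> A"
    then obtain H where H: "carr m l H" "M * H = sm x (I l)" by (auto simp: A_def)
    show "r * x \<in> A" for r
      unfolding A_def using H by (intro CollectI exI[of _ "sm r H"]) (simp add: carr_sm times_sm sm_sm)
    fix y assume "y \<in> A"
    then obtain H' where H': "carr m l H'" "M * H' = sm y (I l)" by (auto simp: A_def)
    show "x + y \<in> A"
      unfolding A_def using H H' by (intro CollectI exI[of _ "H + H'"]) (simp add: carr_add distrib_left add_sm)
  qed
  have "minor l id g M \<in> A" for g
  proof -
    have u: "unit_rows l l id = (I l :: 'a fmat)" by (rule fmat_eqI) (auto simp: unit_rows_def)
    have "M * (tr (unit_rows l m g) * adj l id g M) = sel l id g M * adj l id g M"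
      by (simp add: sel_eq[OF M] u I_times[OF M] mult.assoc)
    also have "\<dots> = sm (minor l id g M) (I l)" by (rule adj_sel)
    finally show ?thesis unfolding A_def
      using carr_times[OF carr_tr[OF carr_unit_rows] carr_adj] by blast
  qed
  then have "minor l f g M \<in> A" for f g
    using minor_full_rows[OF M, of f g] ideal_multD[OF A] by metis
  then have "minor_ideal l M \<subseteq> A" by (intro minor_ideal_least[OF A])
  then show ?thesis using assms(2) that by (auto simp: A_def)
qed

lemma minor_ideal_hom:
  fixes h :: "'a::idom \<Rightarrow> 'b::idom"
  assumes h: "comm_ring_hom h" and x: "x \<in> minor_ideal k M"
  shows "h x \<in> minor_ideal k (fmap h M)"
proof -
  interpret comm_ring_hom h by fact
  have "minor_ideal k M \<subseteq> {x. h x \<in> minor_ideal k (fmap h M)}"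
  proof (rule minor_ideal_least)
    show "is_ideal {x. h x \<in> minor_ideal k (fmap h M)}"
      using is_ideal_minor_ideal[of k "fmap h M"] by (auto simp: is_ideal_def hom_add hom_mult)
    show "minor k f g M \<in> {x. h x \<in> minor_ideal k (fmap h M)}" for f g
      using minor_in_minor_ideal[of k f g "fmap h M"] by (simp add: minor_fmap)
  qed
  then show ?thesis using x by blast
qed

lemma minor_ideal_sm:
  fixes M :: "'a::idom fmat"
  assumes "x \<in> minor_ideal k (sm c M)"
  obtains y where "y \<in> minor_ideal k M" "x = c ^ k * y"
proof -
  let ?A = "{c ^ k * y | y. y \<in> minor_ideal k M}"
  have i: "is_ideal (minor_ideal k M)" by (rule is_ideal_minor_ideal)
  have in_A: "c ^ k * y \<in> ?A" if "y \<in> minor_ideal k M" for y using that by blast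
  have "is_ideal ?A"
    unfolding is_ideal_def
  proof (intro conjI ballI allI)
    show "0 \<in> ?A" using in_A[OF ideal_zeroD[OF i]] by simp
    fix x assume "x \<in> ?A"
    then obtain y where y: "y \<in> minor_ideal k M" "x = c ^ k * y" by blast
    show "r * x \<in> ?A" for r using in_A[OF ideal_multD[OF i y(1), of r]] y(2) by (simp add: mult.left_commute)
    fix x' assume "x' \<in> ?A"
    then obtain y' where y': "y' \<in> minor_ideal k M" "x' = c ^ k * y'" by blast
    show "x + x' \<in> ?A" using in_A[OF ideal_addD[OF i y(1) y'(1)]] y(2) y'(2) by (simp add: distrib_left)
  qed
  then have "minor_ideal k (sm c M) \<subseteq> ?A"
    by (rule minor_ideal_least) (simp only: minor_sm, rule in_A[OF minor_in_minor_ideal])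
  then show ?thesis using assms that by blast
qed

text \<open>The matrix \<open>I 1 + ins 1 l * M * prj 1 m\<close> is the block matrix diag(1,
  M).\<close>

lemma ent_border:
  assumes M: "carr l m M"
  shows "ent (I 1 + ins 1 l * M * prj 1 m) i j = (if i = 0 \<or> j = 0 then if i = j then 1 else 0 else ent M (i - 1) (j - 1))"
proof -
  have c: "carr (Suc l) m (ins 1 l * M)" by (rule carr_times[OF carr_ins_1 M])
  have cG: "carr (Suc l) (Suc m) (ins 1 l * M * prj 1 m)" by (rule carr_times[OF c carr_prj_1])
  have z: "I 1 * (ins 1 l * M * prj 1 m) = 0" "(ins 1 l * M * prj 1 m) * I 1 = 0"
    "prj 1 l * (ins 1 l * M * prj 1 m) * ins 1 m = M"
    by (simp_all add: mult.assoc prj_I prj_ins I_times[OF M] times_I[OF M] I_ins[THEN mulR] prj_ins[THEN mulR])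
  show "ent (I 1 + ins 1 l * M * prj 1 m) i j = (if i = 0 \<or> j = 0 then if i = j then 1 else 0 else ent M (i - 1) (j - 1))"
  proof -
    let ?N = "ins 1 l * M * prj 1 m"
    have "ent ?N 0 j = 0" using arg_cong[OF z(1), of "\<lambda>A. ent A 0 j"] by simp
    moreover have "ent ?N i 0 = 0" using arg_cong[OF z(2), of "\<lambda>A. ent A i 0"] by simp
    moreover have "ent ?N (Suc i') (Suc j') = ent M i' j'" for i' j'
    proof (cases "i' < l \<and> j' < m")
      case True
      then show ?thesis using arg_cong[OF z(3), of "\<lambda>A. ent A i' j'"] by (simp add: plus_1_eq_Suc)
    next
      case False
      then show ?thesis using carrD[OF M, of i' j'] carrD[OF cG, of "Suc i'" "Suc j'"] by auto
    qed
    then have "ent ?N i j = ent M (i - 1) (j - 1)" if "i \<noteq> 0" "j \<noteq> 0"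
      using that by (metis Suc_diff_1 neq0_conv)
    ultimately show ?thesis by auto
  qed
qed

text \<open>Adjoining row and column 0 turns a minor of \<open>M\<close> into one of the bordered
  matrix. Conversely, expansion along row 0, or along the first row if row 0 is absent, leaves
  minors that avoid row 0, and these are minors of \<open>M\<close> or vanish.\<close>

lemma minor_ideal_border:
  fixes M :: "'a::idom fmat"
  assumes M: "carr l m M"
  shows "minor_ideal (Suc k) (I 1 + ins 1 l * M * prj 1 m) = minor_ideal k M"
proof
  let ?G = "I 1 + ins 1 l * M * prj 1 m"
  note G = ent_border[OF M]
  show "minor_ideal k M \<subseteq> minor_ideal (Suc k) ?G"
  proof (rule minor_ideal_least[OF is_ideal_minor_ideal])
    fix f g
    define f' g' where "f' i = (case i of 0 \<Rightarrow> 0 | Suc i \<Rightarrow> Suc (f i))" and "g' i = (case i of 0 \<Rightarrow> 0 | Suc i \<Rightarrow> Suc (g i))" for i :: nat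
    have "minor (Suc k) f' g' ?G = (\<Sum>j<Suc k. if j = 0 then minor k (\<lambda>i. f' (insert_index 0 i)) (\<lambda>i. g' (insert_index 0 i)) ?G else 0)"
      unfolding minor_row_expand[OF zero_less_Suc]
      by (rule sum.cong) (auto simp: G f'_def g'_def simp del: ent_add split: nat.split)
    also have "\<dots> = minor k (\<lambda>i. f' (insert_index 0 i)) (\<lambda>i. g' (insert_index 0 i)) ?G" by simp
    also have "\<dots> = minor k f g M"
      unfolding minor_def by (intro arg_cong[where f = det] cong_mat) (auto simp: G f'_def g'_def insert_index_def simp del: ent_add)
    finally show "minor k f g M \<in> minor_ideal (Suc k) ?G" using minor_in_minor_ideal by metis
  qed
  have avoid: "minor k f g ?G \<in> minor_ideal k M" if "\<And>i. i < k \<Longrightarrow> f i \<noteq> 0" for f g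
  proof (cases "\<exists>a<k. g a = 0")
    case True
    then obtain a where "a < k" "g a = 0" by blast
    then have "minor k f g ?G = 0" using that by (intro minor_zero_col[of a]) (auto simp: G simp del: ent_add)
    then show ?thesis using ideal_zeroD[OF is_ideal_minor_ideal] by simp
  next
    case False
    have "ent ?G (f i) (g j) = ent M (f i - 1) (g j - 1)" if ij: "i < k" "j < k" for i j
    proof -
      have "f i \<noteq> 0" "g j \<noteq> 0" using False \<open>\<And>i. i < k \<Longrightarrow> f i \<noteq> 0\<close> ij by auto
      then show ?thesis unfolding G by simp
    qed
    then have "minor k f g ?G = minor k (\<lambda>i. f i - 1) (\<lambda>i. g i - 1) M"
      unfolding minor_def by (intro arg_cong[where f = det] cong_mat) (simp_all del: ent_add)
    then show ?thesis using minor_in_minor_ideal by simp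
  qed
  show "minor_ideal (Suc k) ?G \<subseteq> minor_ideal k M"
  proof (rule minor_ideal_least[OF is_ideal_minor_ideal])
    fix f g
    have expand: "minor (Suc k) f g ?G \<in> minor_ideal k M"
      if "a < Suc k" "\<And>i. i < Suc k \<Longrightarrow> i \<noteq> a \<Longrightarrow> f i \<noteq> 0" for a
      unfolding minor_row_expand[OF that(1)]
    proof (intro ideal_sum ideal_multD is_ideal_minor_ideal avoid)
      fix i assume "i < k"
      then show "f (insert_index a i) \<noteq> 0" by (intro that(2)) (auto simp: insert_index_def)
    qed
    show "minor (Suc k) f g ?G \<in> minor_ideal k M"
    proof (cases "\<exists>a<Suc k. f a = 0")
      case True
      then obtain a where a: "a < Suc k" "f a = 0" by blast
      show ?thesis
      proof (cases "\<exists>i<Suc k. i \<noteq> a \<and> f i = 0")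
        case True
        then have "minor (Suc k) f g ?G = 0" using a minor_noninj by metis
        then show ?thesis using ideal_zeroD[OF is_ideal_minor_ideal] by simp
      next
        case False
        show ?thesis
        proof (rule expand[OF a(1)], rule notI)
          fix i assume "i < Suc k" "i \<noteq> a" "f i = 0"
          then have "\<exists>i<Suc k. i \<noteq> a \<and> f i = 0" by (intro exI[of _ i] conjI)
          with False show False by (rule notE)
        qed
      qed
    next
      case False
      show ?thesis
      proof (rule expand[OF zero_less_Suc], rule notI)
        fix i assume "i < Suc k" "f i = 0"
        then have "\<exists>a<Suc k. f a = 0" by (intro exI[of _ i] conjI)
        with False show False by (rule notE)
      qed
    qed
  qed
qed

section \<open>Prime powers, and ideals of values of a row\<close>

lemma dvd_cancel_prime_power:
  fixes p :: "'a::idom"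
  assumes p: "p \<noteq> 0" "\<forall>x y. p dvd x * y \<longrightarrow> p dvd x \<or> p dvd y" and x: "\<not> p dvd x" "x dvd p ^ n * z"
  shows "x dvd z"
  using x(2)
proof (induction n)
  case (Suc n)
  then obtain y where "p ^ Suc n * z = x * y" unfolding dvd_def by blast
  then have y: "p * (p ^ n * z) = x * y" by (simp only: power_Suc mult.assoc)
  then have "p dvd x * y" by (metis dvd_triv_left)
  then have "p dvd y" using p(2) x(1) by blast
  then obtain y' where "y = p * y'" unfolding dvd_def by blast
  then have "p * (p ^ n * z) = p * (x * y')" using y by (simp add: mult.left_commute)
  then have "p ^ n * z = x * y'" using p(1) by (simp only: mult_cancel_left) simp
  then have "x dvd p ^ n * z" by simp
  then show ?case by (rule Suc.IH)
qed simp

lemma ideal_dvdD: "is_ideal A \<Longrightarrow> x \<in> A \<Longrightarrow> x dvd y \<Longrightarrow> y \<in> A"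
  unfolding dvd_def using ideal_multD' by blast

lemma one_minus_power_in_ideal:
  fixes a :: "'a::comm_ring_1"
  assumes "is_ideal A" "1 - a \<in> A"
  shows "1 - a ^ n \<in> A"
proof (induction n)
  case 0
  then show ?case using ideal_zeroD[OF assms(1)] by simp
next
  case (Suc n)
  have "1 - a ^ Suc n = (1 - a) + a * (1 - a ^ n)" by (simp add: algebra_simps)
  moreover have "(1 - a) + a * (1 - a ^ n) \<in> A"
    by (rule ideal_addD[OF assms ideal_multD[OF assms(1) Suc]])
  ultimately show ?case by (simp only:)
qed

text \<open>Modulo \<open>A\<close> the element \<open>a\<close> is both invertible and
  nilpotent.\<close>

lemma one_in_ideal_if_power:
  assumes A: "is_ideal A" "1 - a * c \<in> A" "a ^ n \<in> A"
  shows "(1 :: 'a::comm_ring_1) \<in> A"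
proof -
  have "1 - (a * c) ^ n \<in> A" by (rule one_minus_power_in_ideal[OF A(1,2)])
  moreover have "(a * c) ^ n \<in> A" using ideal_multD'[OF A(1,3)] by (simp add: power_mult_distrib)
  ultimately show ?thesis using ideal_addD[OF A(1)] by fastforce
qed

lemma ideal_of_row:
  fixes y :: "'a::comm_ring_1 fmat"
  assumes "carr 1 m y"
  shows "is_ideal {x. \<exists>v. carr m 1 v \<and> y * v = sm x (I 1)}"
  unfolding is_ideal_def
proof (intro conjI ballI allI)
  let ?A = "{x. \<exists>v. carr m 1 v \<and> y * v = sm x (I 1)}"
  show "0 \<in> ?A" by (auto intro!: exI[of _ 0])
  fix x assume "x \<in> ?A"
  then obtain v where v: "carr m 1 v" "y * v = sm x (I 1)" by blast
  show "r * x \<in> ?A" for r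
    using v by (intro CollectI exI[of _ "sm r v"]) (simp add: carr_sm times_sm sm_sm)
  fix x' assume "x' \<in> ?A"
  then obtain v' where v': "carr m 1 v'" "y * v' = sm x' (I 1)" by blast
  show "x + x' \<in> ?A"
    using v v' by (intro CollectI exI[of _ "v + v'"]) (simp add: carr_add distrib_left add_sm)
qed

lemma scalar_fmat:
  assumes "carr 1 1 M"
  shows "M = sm (ent M 0 0) (I 1)"
proof (rule fmat_eqI)
  fix i j
  show "ent M i j = ent (sm (ent M 0 0) (I 1)) i j"
    using carrD[OF assms, of i j] by (cases "i = 0"; cases "j = 0") (auto simp: Suc_le_eq One_nat_def)
qed

text \<open>The two rings \<open>R/(g1)\<close> and \<open>R/(g2)\<close> are realised as the images of commuting retractions of
  \<open>R\<close> with kernels \<open>(g1)\<close> and \<open>(g2)\<close>.\<close>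

locale two_retractions =
  fixes \<rho>1 \<rho>2 :: "'a::idom \<Rightarrow> 'a" and g1 g2 :: 'a
  assumes hom1: "comm_ring_hom \<rho>1" and hom2: "comm_ring_hom \<rho>2"
    and ker1: "\<rho>1 x = 0 \<longleftrightarrow> g1 dvd x" and ker2: "\<rho>2 x = 0 \<longleftrightarrow> g2 dvd x"
    and proj1: "\<rho>1 (\<rho>1 x) = \<rho>1 x" and proj2: "\<rho>2 (\<rho>2 x) = \<rho>2 x"
    and commute: "\<rho>1 (\<rho>2 x) = \<rho>2 (\<rho>1 x)"
    and fix12: "\<rho>1 g2 = g2" and fix21: "\<rho>2 g1 = g1"
    and g_nz: "g1 \<noteq> 0" "g2 \<noteq> 0"
    and hermite: "hermite TYPE('a)"
    and idem_free: "carr n n (e :: 'a fmat) \<Longrightarrow> e * e = e \<Longrightarrow> free e"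
begin

sublocale h1: comm_ring_hom \<rho>1 by (rule hom1)
sublocale h2: comm_ring_hom \<rho>2 by (rule hom2)

lemma swap: "two_retractions \<rho>2 \<rho>1 g2 g1"
  using hom1 hom2 ker1 ker2 proj1 proj2 commute fix12 fix21 g_nz hermite idem_free
  by unfold_locales simp_all

lemma prime1: "\<forall>x y. g1 dvd x * y \<longrightarrow> g1 dvd x \<or> g1 dvd y"
  unfolding ker1[symmetric] by (simp add: h1.hom_mult)

lemma prime2: "\<forall>x y. g2 dvd x * y \<longrightarrow> g2 dvd x \<or> g2 dvd y"
  unfolding ker2[symmetric] by (simp add: h2.hom_mult)

lemma dvd_diff1: "\<rho>1 x = 1 \<Longrightarrow> g1 dvd 1 - x"
  unfolding ker1[symmetric] by (simp add: h1.hom_minus)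

lemma dvd_diff2: "\<rho>2 x = 1 \<Longrightarrow> g2 dvd 1 - x"
  unfolding ker2[symmetric] by (simp add: h2.hom_minus)

lemma fmap_proj1: "fmap \<rho>1 (fmap \<rho>1 M) = fmap \<rho>1 M" by (rule fmat_eqI) (simp add: proj1)
lemma fmap_proj2: "fmap \<rho>2 (fmap \<rho>2 M) = fmap \<rho>2 M" by (rule fmat_eqI) (simp add: proj2)
lemma fmap_commute: "fmap \<rho>1 (fmap \<rho>2 M) = fmap \<rho>2 (fmap \<rho>1 M)" by (rule fmat_eqI) (simp add: commute)

text \<open>The invariant of the induction: the determinantal ideals are principal, and their
  generators have no prime factors besides \<open>g1\<close> and \<open>g2\<close>.\<close>

definition gen_minors :: "nat \<Rightarrow> 'a fmat \<Rightarrow> (nat \<Rightarrow> 'a) \<Rightarrow> bool"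
  where "gen_minors l F \<delta> \<longleftrightarrow> (\<forall>k\<le>l. \<delta> k \<in> minor_ideal k F \<and> (\<forall>f g. \<delta> k dvd minor k f g F) \<and>
    (\<exists>N. \<delta> k dvd (g1 * g2) ^ N))"

lemma gen_minors_ideal: "gen_minors l F \<delta> \<Longrightarrow> k \<le> l \<Longrightarrow> x \<in> minor_ideal k F \<Longrightarrow> \<delta> k dvd x"
  using minor_ideal_least[OF is_ideal_dvd, of k F "\<delta> k"] unfolding gen_minors_def by blast

lemma gen_minors_mono:
  assumes "gen_minors l F \<delta>" "k \<le> j" "j \<le> l"
  shows "\<delta> k dvd \<delta> j"
proof (rule gen_minors_ideal[OF assms(1)])
  show "k \<le> l" using assms by simp
  show "\<delta> j \<in> minor_ideal k F" using assms minor_ideal_antimono unfolding gen_minors_def by blast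
qed

text \<open>\<open>r\<close> and \<open>s\<close> are the ranks of \<open>F\<close> modulo \<open>g1\<close> and \<open>g2\<close>.\<close>

lemma unimodular_row_aux:
  assumes F: "carr l m F" and gen: "gen_minors l F \<delta>"
    and r: "1 \<le> r" "r \<le> l" "\<delta> r dvd 1" "\<And>f g. g1 dvd minor (Suc r) f g F"
    and s: "s \<le> l" "\<not> g2 dvd \<delta> s" "\<And>f g. g2 dvd minor (Suc s) f g F"
  shows "\<exists>u v. carr 1 l u \<and> carr m 1 v \<and> u * F * v = I 1"
proof -
  have gs: "\<delta> s \<in> minor_ideal s F" "\<And>f g. \<delta> s dvd minor s f g F" using gen s(1) by (auto simp: gen_minors_def)
  have dvd_N: "\<exists>N. \<delta> k dvd (g1 * g2) ^ N" if "k \<le> l" for k using gen that by (auto simp: gen_minors_def)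
  \<comment> \<open>A generator of the \<open>s\<close>-th determinantal ideal modulo
    \<open>g2\<close>. Since \<open>g2\<close> does not divide \<open>\<delta> s\<close>, it divides
    a power of \<open>g1\<close>.\<close>
  define d where "d = \<rho>2 (\<delta> s)"
  have d0: "d \<noteq> 0" using s(2) by (simp add: d_def ker2)
  obtain N where "\<delta> s dvd (g1 * g2) ^ N" using dvd_N[OF s(1)] by blast
  then have "\<delta> s dvd g2 ^ N * g1 ^ N" by (simp add: power_mult_distrib mult.commute)
  then have "\<delta> s dvd g1 ^ N" by (rule dvd_cancel_prime_power[OF g_nz(2) prime2 s(2)])
  then have dN: "d dvd g1 ^ N" using h2.hom_dvd[of "\<delta> s" "g1 ^ N"] by (simp add: d_def h2.hom_power fix21)

  obtain e0 N0 where e0: "carr l l e0" "e0 * fmap \<rho>2 F = fmap \<rho>2 F" "e0 * e0 = e0" "carr m l N0" "fmap \<rho>2 F * N0 = sm d e0"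
  proof (rule rank_idempotent[of l m "fmap \<rho>2 F" d s])
    show "carr l m (fmap \<rho>2 F)" by (rule h2.fmap_carr[OF F])
    show "d \<in> minor_ideal s (fmap \<rho>2 F)" unfolding d_def by (rule minor_ideal_hom[OF hom2 gs(1)])
    show "d dvd minor s f g (fmap \<rho>2 F)" for f g using gs(2) by (simp add: d_def h2.minor_fmap)
    show "minor (Suc s) f g (fmap \<rho>2 F) = 0" for f g using s(3) by (simp add: h2.minor_fmap ker2)
  qed (use d0 in blast)+
  have ie0: "(I l - e0) * (I l - e0) = I l - e0" "carr l l (I l - e0)"
    using e0 I_times[OF e0(1)] times_I[OF e0(1)] by (simp_all add: algebra_simps carr_minus)
  obtain a X0 Y0 where XY0: "carr l a X0" "carr a l Y0" "X0 * Y0 = e0" "Y0 * X0 = I a" "e0 * X0 = X0" "Y0 * e0 = Y0"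
    using freeE[OF idem_free[OF e0(1,3)] e0(3,1)] .
  obtain b X0' Y0' where XY0': "carr l b X0'" "carr b l Y0'" "X0' * Y0' = I l - e0" "Y0' * X0' = I b"
    "(I l - e0) * X0' = X0'" "Y0' * (I l - e0) = Y0'"
    using freeE[OF idem_free[OF ie0(2,1)] ie0] .
  \<comment> \<open>Applying \<open>\<rho>2\<close> makes these matrices fixed by it, so that
    \<open>W\<close> below is its own reduction modulo \<open>g2\<close>.\<close>
  define e N1 X Y X' Y' where "e = fmap \<rho>2 e0" and "N1 = fmap \<rho>2 N0" and "X = fmap \<rho>2 X0" and "Y = fmap \<rho>2 Y0"
    and "X' = fmap \<rho>2 X0'" and "Y' = fmap \<rho>2 Y0'"
  note defs = e_def N1_def X_def Y_def X'_def Y'_def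
  define F2 where "F2 = fmap \<rho>2 F"
  have F2: "fmap \<rho>2 F2 = F2" by (simp add: F2_def fmap_proj2)
  have d2: "\<rho>2 d = d" by (simp add: d_def proj2)
  have e: "carr l l e" "e * F2 = F2" "carr m l N1" "F2 * N1 = sm d e"
    using arg_cong[OF e0(2), of "fmap \<rho>2"] arg_cong[OF e0(5), of "fmap \<rho>2"] e0(1,4)
    by (simp_all add: h2.fmap_simps defs F2_def[symmetric] F2 d2 h2.fmap_carr)
  have XY: "carr l a X" "carr a l Y" "Y * X = I a" "e * X = X"
    using arg_cong[OF XY0(4), of "fmap \<rho>2"] arg_cong[OF XY0(5), of "fmap \<rho>2"] XY0(1,2)
    by (simp_all add: h2.fmap_simps defs h2.fmap_carr)
  have XY_: "X * Y = e" using arg_cong[OF XY0(3), of "fmap \<rho>2"] by (simp add: h2.fmap_simps defs)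
  have XY': "carr l b X'" "carr b l Y'" "X' * Y' = I l - e" "Y' * X' = I b"
    "(I l - e) * X' = X'" "Y' * (I l - e) = Y'"
    using XY0'(3-6)[THEN arg_cong, of "fmap \<rho>2"] XY0'(1,2)
    by (simp_all add: h2.fmap_simps defs h2.fmap_carr)
  have eX': "e * X' = 0"
    using XY'(5) I_times[OF XY'(1)] by (simp add: algebra_simps)
  have Y'e: "Y' * e = 0"
    using XY'(6) times_I[OF XY'(2)] by (simp add: algebra_simps)
  have YX': "Y * X' = 0"
  proof -
    have "Y * X' = (Y * X) * Y * X'" by (simp only: XY(3) I_times[OF XY(2)])
    also have "\<dots> = Y * ((X * Y) * X')" by (simp add: mult.assoc)
    finally show ?thesis by (simp add: XY_ eX')
  qed
  have Y'X: "Y' * X = 0"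
  proof -
    have "Y' * X = Y' * (e * X)" by (simp add: XY)
    then show ?thesis by (simp add: mult.assoc[symmetric] Y'e)
  qed
  define i p where "i = (ins a b :: 'a fmat)" and "p = (prj a b :: 'a fmat)"
  have ci: "carr (a + b) b i" "carr b (a + b) p" by (simp_all add: i_def p_def)
  have bl: "p * i = I b" "I a * i = 0" "p * I a = 0" "i * p = I (a + b) - I a"
    by (simp_all add: i_def p_def prj_ins ins_prj I_ins prj_I)
  have Xi: "X * i = 0"
  proof -
    have "X * i = X * (I a * i)" by (simp only: mult.assoc[symmetric] times_I[OF XY(1)])
    then show ?thesis by (simp only: bl mult_zero_right)
  qed
  \<comment> \<open>\<open>W\<close> stacks the coordinates on the images of \<open>e\<close> and
    \<open>I l - e\<close>. Its inverse \<open>W'\<close> puts the two bases side by side.\<close>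
  define W W' where "W = Y + i * Y'" and "W' = X + X' * p"
  define l' where "l' = a + b"
  have cW: "carr l' l W" "carr l l' W'"
    unfolding W_def W'_def l'_def using XY XY' ci
    by (auto intro!: carr_add intro: carr_mono carr_times)
  have W'W: "W' * W = I l"
  proof -
    have "p * Y = p * I a * Y" by (simp add: mult.assoc I_times[OF XY(2)])
    then have pY: "p * Y = 0" by (simp add: bl)
    have "W' * W = X * Y + X' * Y'"
      by (simp add: W_def W'_def algebra_simps Xi[THEN mulR] bl[THEN mulR] pY I_times[OF XY'(2)])
    then show ?thesis by (simp add: XY_ XY')
  qed
  have eW': "e * W' = X"
    by (simp add: W'_def distrib_left XY eX'[THEN mulR])
  have WX: "W * X = I a"
    by (simp add: W_def distrib_right XY mult.assoc Y'X)
  have WF: "minor_ideal k (W * F) = minor_ideal k F" for k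
  proof
    show "minor_ideal k (W * F) \<subseteq> minor_ideal k F" by (rule minor_ideal_times_right)
    have "W' * (W * F) = F" by (simp add: mult.assoc[symmetric] W'W I_times[OF F])
    then show "minor_ideal k F \<subseteq> minor_ideal k (W * F)" using minor_ideal_times_right by metis
  qed
  define Fn where "Fn = W * F"
  have cFn: "carr l' m Fn" unfolding Fn_def by (rule carr_times[OF cW(1) F])
  have ideals: "minor_ideal k Fn = minor_ideal k F" for k unfolding Fn_def by (rule WF)
  have W2: "fmap \<rho>2 W = W" by (simp add: W_def defs i_def h2.fmap_simps fmap_proj2)
  have Fn2: "fmap \<rho>2 Fn = W * F2" by (simp add: Fn_def h2.fmap_simps W2 F2_def)
  \<comment> \<open>Modulo \<open>g2\<close> the matrix \<open>F\<close> has its image inside that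
    of \<open>e\<close>, so only the first \<open>a\<close> rows of \<open>W * F\<close>
    survive.\<close>
  have DF: "I a * (W * F2) = W * F2"
  proof -
    have "I a * (W * F2) = W * (e * W') * (W * F2)" by (simp only: eW' WX)
    also have "\<dots> = W * (e * ((W' * W) * F2))" by (simp only: mult.assoc)
    also have "\<dots> = W * F2" by (simp add: W'W I_times[OF h2.fmap_carr[OF F]] F2_def[symmetric] e)
       (simp add: F2_def I_times[OF h2.fmap_carr[OF F]] e[unfolded F2_def])
    finally show ?thesis .
  qed
  have FN: "W * F2 * (N1 * W') = sm d (I a)"
  proof -
    have "W * F2 * (N1 * W') = W * (F2 * N1) * W'" by (simp only: mult.assoc)
    also have "\<dots> = sm d (W * (e * W'))" by (simp add: e(4) sm_simps mult.assoc)
    finally show ?thesis by (simp add: eW' WX)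
  qed

  define F1 where "F1 = fmap \<rho>1 Fn"
  have cF1: "carr l' m F1" unfolding F1_def by (rule h1.fmap_carr[OF cFn])
  have one: "1 \<in> minor_ideal k F" if "k \<le> r" for k
  proof -
    have "\<delta> r \<in> minor_ideal k F"
      using gen r(2) minor_ideal_antimono[OF that] unfolding gen_minors_def by blast
    then show ?thesis using r(3) by (rule ideal_dvdD[OF is_ideal_minor_ideal])
  qed
  have one1: "1 \<in> minor_ideal k F1" if "k \<le> r" for k
    using minor_ideal_hom[OF hom1, of 1 k Fn] one[OF that] by (simp add: ideals F1_def)
  \<comment> \<open>As \<open>\<delta> r\<close> is a unit, the generator modulo \<open>g1\<close>
    may be taken to be 1, and the splitting of \<open>F1\<close> has no denominator.\<close>
  obtain e1 N2 where e1: "carr l' l' e1" "e1 * F1 = F1" "e1 * e1 = e1" "carr m l' N2" "F1 * N2 = sm 1 e1"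
  proof (rule rank_idempotent[of l' m F1 1 r])
    show "carr l' m F1" by (rule cF1)
    show "1 \<in> minor_ideal r F1" using one1 by simp
    show "minor (Suc r) f g F1 = 0" for f g
    proof -
      have "minor_ideal (Suc r) F \<subseteq> {x. g1 dvd x}" by (rule minor_ideal_least[OF is_ideal_dvd]) (simp add: r(4))
      then have "g1 dvd minor (Suc r) f g Fn" using minor_in_minor_ideal[of "Suc r" f g Fn] by (auto simp: ideals)
      then show ?thesis by (simp add: F1_def h1.minor_fmap ker1)
    qed
  qed auto
  obtain c X1 Y1 where XY1: "carr l' c X1" "carr c l' Y1" "X1 * Y1 = e1" "Y1 * X1 = I c" "Y1 * e1 = Y1"
    using freeE[OF idem_free[OF e1(1,3)] e1(3,1)] by metis
  have "c \<noteq> 0"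
  proof
    assume "c = 0"
    then have "X1 = 0" using XY1(1) by (intro fmat_eqI) (auto simp: carr_def)
    then have "F1 = 0" using e1(2) XY1(3) by simp
    then have "minor 1 f g F1 = 0" for f g by (simp add: minor_1)
    then have "minor_ideal 1 F1 \<subseteq> {x. 0 dvd x}" by (intro minor_ideal_least is_ideal_dvd) simp
    then show False using one1[OF r(1)] by auto
  qed
  then have c1: "min 1 c = 1" by simp
  \<comment> \<open>The image of \<open>F1\<close> is free of rank \<open>c > 0\<close>. Up to
    reduction by \<open>\<rho>1\<close>, \<open>u0\<close> is its first coordinate function and
    \<open>v0\<close> a preimage of the first basis vector.\<close>
  define u0 v0 where "u0 = fmap \<rho>1 (I 1 * Y1)" and "v0 = fmap \<rho>1 (N2 * X1 * I 1)"
  have cu0: "carr 1 l' u0" "carr m 1 v0"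
    unfolding u0_def v0_def by (intro h1.fmap_carr carr_times[OF carr_I XY1(2)] carr_times[OF carr_times[OF e1(4) XY1(1)] carr_I])+
  have u0_fix: "fmap \<rho>1 u0 = u0" by (simp add: u0_def fmap_proj1)
  have F1_fix: "fmap \<rho>1 F1 = F1" by (simp add: F1_def fmap_proj1)
  have uv0: "u0 * F1 * v0 = I 1"
  proof -
    have "I 1 * Y1 * F1 * (N2 * X1 * I 1) = I 1 * (Y1 * (F1 * N2)) * X1 * I 1" by (simp only: mult.assoc)
    also have "\<dots> = I 1 * (Y1 * X1) * I 1" by (simp add: e1(5) XY1(5) mult.assoc)
    also have "\<dots> = I 1" by (simp add: XY1(4) I_I c1)
    finally have "fmap \<rho>1 (I 1 * Y1 * F1 * (N2 * X1 * I 1)) = I 1" by simp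
    then show ?thesis by (simp only: h1.fmap_times F1_fix u0_def[symmetric] v0_def[symmetric] u0_def v0_def)
  qed

  define y where "y = u0 * Fn"
  have cy: "carr 1 m y" unfolding y_def by (rule carr_times[OF cu0(1) cFn])
  define A where "A = {x. \<exists>v. carr m 1 v \<and> y * v = sm x (I 1)}"
  have A: "is_ideal A" unfolding A_def by (rule ideal_of_row[OF cy])
  have A_mem: "ent (y * v) 0 0 \<in> A" if "carr m 1 v" for v
    using scalar_fmat[OF carr_times[OF cy that]] that unfolding A_def by blast

  have "\<rho>1 (ent (y * v0) 0 0) = 1"
  proof -
    have "fmap \<rho>1 (y * v0) = u0 * F1 * v0" by (simp add: y_def h1.fmap_times u0_fix F1_def v0_def fmap_proj1)
    then have "ent (fmap \<rho>1 (y * v0)) 0 0 = ent (I 1) 0 0" by (simp only: uv0)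
    then show ?thesis by simp
  qed
  then obtain c1 where c1: "1 - ent (y * v0) 0 0 = g1 * c1" using dvd_diff1 unfolding dvd_def by blast
  have in1: "1 - g1 * c1 \<in> A" using A_mem[OF cu0(2)] by (simp add: c1[symmetric])

  define u2 y2 where "u2 = fmap \<rho>2 u0" and "y2 = fmap \<rho>2 y"
  have cy2: "carr 1 m y2" unfolding y2_def by (rule h2.fmap_carr[OF cy])
  have y2: "y2 = u2 * (W * F2)" by (simp add: y2_def y_def h2.fmap_times Fn2 u2_def)
  define A2 where "A2 = {x. \<exists>v. carr m 1 v \<and> y2 * v = sm x (I 1)}"
  have A2: "is_ideal A2" unfolding A2_def by (rule ideal_of_row[OF cy2])
  define c2 where "c2 = \<rho>2 c1"
  have yv2: "y2 * fmap \<rho>2 v0 = sm (1 - g1 * c2) (I 1)"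
  proof -
    have "y * v0 = sm (ent (y * v0) 0 0) (I 1)" by (rule scalar_fmat[OF carr_times[OF cy cu0(2)]])
    also have "ent (y * v0) 0 0 = 1 - g1 * c1" by (simp add: c1[symmetric])
    finally have "fmap \<rho>2 (y * v0) = fmap \<rho>2 (sm (1 - g1 * c1) (I 1))" by (rule arg_cong)
    then show ?thesis by (simp add: h2.fmap_simps y2_def h2.hom_minus h2.hom_mult fix21 c2_def)
  qed
  have cv2: "carr m 1 (fmap \<rho>2 v0)" by (rule h2.fmap_carr[OF cu0(2)])
  then have in2: "1 - g1 * c2 \<in> A2" using yv2 unfolding A2_def by blast
  \<comment> \<open>Inserting \<open>I a\<close> is harmless because the later rows of
    \<open>W * F2\<close> vanish. It shows that the first \<open>a\<close> entries of
    \<open>u2\<close> alone produce the value.\<close>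
  have "u2 * I a * (W * F2 * fmap \<rho>2 v0) = sm (1 - g1 * c2) (I 1)"
  proof -
    have "u2 * I a * (W * F2 * fmap \<rho>2 v0) = u2 * (I a * (W * F2)) * fmap \<rho>2 v0" by (simp only: mult.assoc)
    also have "\<dots> = y2 * fmap \<rho>2 v0" by (simp only: DF y2)
    finally show ?thesis by (simp only: yv2)
  qed
  then have "fmap \<rho>1 (u2 * I a * (W * F2 * fmap \<rho>2 v0)) = fmap \<rho>1 (sm (1 - g1 * c2) (I 1))" by (rule arg_cong)
  moreover have "\<rho>1 g1 = 0" by (simp add: ker1)
  \<comment> \<open>Here the retractions have to commute. As \<open>u2\<close> is fixed by
    \<open>\<rho>1\<close>, the congruence modulo \<open>g1\<close> becomes the equation
    \<open>Q1\<close> over the ring itself.\<close>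
  moreover have "fmap \<rho>1 u2 = u2" by (simp add: u2_def fmap_commute u0_fix)
  ultimately have Q1: "u2 * I a * fmap \<rho>1 (W * F2 * fmap \<rho>2 v0) = I 1"
    by (simp add: h1.fmap_times h1.fmap_sm h1.hom_minus h1.hom_mult)
  define v3 where "v3 = fmap \<rho>1 (W * F2 * fmap \<rho>2 v0)"
  have cv3: "carr l' 1 v3"
    unfolding v3_def F2_def by (intro h1.fmap_carr carr_times[OF carr_times[OF cW(1) h2.fmap_carr[OF F]] cv2])
  \<comment> \<open>By \<open>FN\<close> the first \<open>a\<close> rows of \<open>W * F2\<close>
    have a right inverse up to \<open>d\<close>. It lifts the unimodularity of the first entries of
    \<open>u2\<close> to \<open>y2\<close>.\<close>
  have "d \<in> A2"
  proof -
    have "y2 * (N1 * W' * v3) = u2 * (W * F2 * (N1 * W')) * v3" by (simp only: y2 mult.assoc)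
    also have "\<dots> = sm d (u2 * I a * v3)" by (simp only: FN times_sm sm_times)
    also have "\<dots> = sm d (I 1)" by (simp only: v3_def Q1)
    finally show ?thesis unfolding A2_def using carr_times[OF carr_times[OF e(3) cW(2)] cv3] by blast
  qed
  then have "g1 ^ N \<in> A2" using dN by (rule ideal_dvdD[OF A2])
  then have "1 \<in> A2" by (rule one_in_ideal_if_power[OF A2 in2])
  then obtain v4 where v4: "carr m 1 v4" "y2 * v4 = I 1" by (auto simp: A2_def)
  have "\<rho>2 (ent (y * v4) 0 0) = 1"
  proof -
    have "fmap \<rho>2 (y * v4) = fmap \<rho>2 (y2 * v4)" by (simp add: h2.fmap_times y2_def fmap_proj2)
    then have "ent (fmap \<rho>2 (y * v4)) 0 0 = ent (fmap \<rho>2 (I 1)) 0 0" by (simp only: v4)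
    then show ?thesis by simp
  qed
  then obtain c3 where c3: "1 - ent (y * v4) 0 0 = g2 * c3" using dvd_diff2 unfolding dvd_def by blast
  have in3: "1 - g2 * c3 \<in> A" using A_mem[OF v4(1)] by (simp add: c3[symmetric])

  have "\<delta> l \<in> minor_ideal l F" using gen by (simp add: gen_minors_def)
  then obtain H where H: "carr m l H" "F * H = sm (\<delta> l) (I l)" by (rule full_rank_right_inverse[OF F])
  \<comment> \<open>The right inverse \<open>H\<close> of \<open>F\<close> up to
    \<open>\<delta> l\<close> lifts the equation \<open>uv0\<close> from \<open>F1\<close> to
    \<open>Fn\<close>.\<close>
  have "\<delta> l \<in> A"
  proof -
    have "y * (H * (W' * (F1 * v0))) = u0 * (W * (F * H) * W') * (F1 * v0)" by (simp only: y_def Fn_def mult.assoc)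
    also have "\<dots> = sm (\<delta> l) (u0 * (W * W') * (F1 * v0))"
      by (simp add: H(2) sm_simps times_I[OF cW(1)])
    also have "W * W' = I l'"
    proof -
      have "W * W' = I a + i * p"
        by (simp add: W_def W'_def algebra_simps XY YX'[THEN mulR] Y'X XY'(4)[THEN mulR] I_times[OF ci(2)])
      then show ?thesis by (simp add: bl l'_def)
    qed
    also have "u0 * I l' * (F1 * v0) = I 1" using uv0 by (simp add: times_I[OF cu0(1)] mult.assoc)
    finally have "y * (H * (W' * (F1 * v0))) = sm (\<delta> l) (I 1)" .
    moreover have "carr m 1 (H * (W' * (F1 * v0)))"
      by (rule carr_times[OF H(1) carr_times[OF cW(2) carr_times[OF cF1 cu0(2)]]])
    ultimately show ?thesis unfolding A_def by blast
  qed
  moreover obtain N' where "\<delta> l dvd (g1 * g2) ^ N'" using dvd_N by blast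
  ultimately have gN: "g1 ^ N' * g2 ^ N' \<in> A"
    using ideal_dvdD[OF A] by (metis power_mult_distrib)
  \<comment> \<open>Modulo \<open>A\<close> both \<open>g1\<close> and \<open>g2\<close> are units,
    while a power of their product vanishes.\<close>
  have "1 \<in> A"
  proof -
    have p1: "1 - (g1 * c1) ^ N' \<in> A" by (rule one_minus_power_in_ideal[OF A in1])
    have p2: "1 - (g2 * c3) ^ N' \<in> A" by (rule one_minus_power_in_ideal[OF A in3])
    have "c1 ^ N' * c3 ^ N' * (g1 ^ N' * g2 ^ N') \<in> A" by (rule ideal_multD[OF A gN])
    then have p3: "(g1 * c1) ^ N' * (g2 * c3) ^ N' \<in> A" by (simp only: power_mult_distrib mult_ac)
    have "(1 - (g1 * c1) ^ N') + ((g1 * c1) ^ N' * (1 - (g2 * c3) ^ N') + (g1 * c1) ^ N' * (g2 * c3) ^ N') \<in> A"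
      by (intro ideal_addD[OF A] p1 p3 ideal_multD[OF A p2])
    moreover have "(1 - x) + (x * (1 - y) + x * y) = 1" for x y :: 'a by (simp add: algebra_simps)
    ultimately show ?thesis by (simp only:)
  qed
  then obtain v where v: "carr m 1 v" "y * v = I 1" by (auto simp: A_def)
  then have "u0 * W * F * v = I 1" by (simp add: y_def Fn_def mult.assoc)
  then show ?thesis using carr_times[OF cu0(1) cW(1)] v(1) by blast
qed

lemma not_unit1: "\<not> g1 dvd 1" unfolding ker1[symmetric] by simp
lemma not_unit2: "\<not> g2 dvd 1" unfolding ker2[symmetric] by simp

lemma unimodular_row_le:
  assumes F: "carr l m F" "1 \<le> l" and gen: "gen_minors l F \<delta>" and one: "\<delta> 1 dvd 1"
    and le: "Max {k. k \<le> l \<and> \<not> g1 dvd \<delta> k} \<le> Max {k. k \<le> l \<and> \<not> g2 dvd \<delta> k}"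
  shows "\<exists>u v. carr 1 l u \<and> carr m 1 v \<and> u * F * v = I 1"
proof -
  have fin: "finite {k. k \<le> l \<and> \<not> g dvd \<delta> k}" for g by simp
  have mem: "1 \<in> {k. k \<le> l \<and> \<not> g1 dvd \<delta> k}" "1 \<in> {k. k \<le> l \<and> \<not> g2 dvd \<delta> k}"
    using F(2) one not_unit1 not_unit2 dvd_trans by blast+
  \<comment> \<open>Since \<open>\<delta> k\<close> generates the \<open>k\<close>-th determinantal
    ideal, the rank modulo a factor is the largest \<open>k\<close> for which the factor does not
    divide \<open>\<delta> k\<close>.\<close>
  define r s where "r = Max {k. k \<le> l \<and> \<not> g1 dvd \<delta> k}" and "s = Max {k. k \<le> l \<and> \<not> g2 dvd \<delta> k}"
  have "r \<in> {k. k \<le> l \<and> \<not> g1 dvd \<delta> k}" unfolding r_def by (rule Max_in[OF fin]) (use mem in blast)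
  then have r: "r \<le> l" "\<not> g1 dvd \<delta> r" by simp_all
  have "s \<in> {k. k \<le> l \<and> \<not> g2 dvd \<delta> k}" unfolding s_def by (rule Max_in[OF fin]) (use mem in blast)
  then have s: "s \<le> l" "\<not> g2 dvd \<delta> s" by simp_all
  have r1: "1 \<le> r" unfolding r_def by (rule Max_ge[OF fin mem(1)])
  have maxr: "g1 dvd \<delta> (Suc r)" if "Suc r \<le> l"
    using Max_ge[OF fin, of "Suc r" g1] that unfolding r_def[symmetric] by (metis (mono_tags) Suc_n_not_le_n mem_Collect_eq)
  have maxs: "g2 dvd \<delta> (Suc s)" if "Suc s \<le> l"
    using Max_ge[OF fin, of "Suc s" g2] that unfolding s_def[symmetric] by (metis (mono_tags) Suc_n_not_le_n mem_Collect_eq)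
  have minors: "g dvd minor (Suc j) f f' F" if "Suc j \<le> l \<Longrightarrow> g dvd \<delta> (Suc j)" for g j f f'
  proof (cases "Suc j \<le> l")
    case True
    then have "\<delta> (Suc j) dvd minor (Suc j) f f' F" using gen unfolding gen_minors_def by blast
    then show ?thesis using that[OF True] dvd_trans by blast
  next
    case False
    then show ?thesis using minor_big[OF F(1)] by simp
  qed
  \<comment> \<open>The order of the ranks matters here: \<open>g2\<close> does not divide
    \<open>\<delta> s\<close>, so it does not divide its divisor \<open>\<delta> r\<close>
    either.\<close>
  have "\<delta> r dvd \<delta> s" using le s(1) by (intro gen_minors_mono[OF gen]) (simp_all add: r_def s_def)
  then have r2: "\<not> g2 dvd \<delta> r" using s(2) dvd_trans by blast
  obtain N where "\<delta> r dvd (g1 * g2) ^ N" using gen r(1) unfolding gen_minors_def by blast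
  then have "\<delta> r dvd g1 ^ N * (g2 ^ N * 1)" by (simp add: power_mult_distrib)
  then have "\<delta> r dvd g2 ^ N * 1" by (rule dvd_cancel_prime_power[OF g_nz(1) prime1 r(2)])
  then have "\<delta> r dvd 1" by (rule dvd_cancel_prime_power[OF g_nz(2) prime2 r2])
  then show ?thesis by (rule unimodular_row_aux[OF F(1) gen r1 r(1) _ minors s minors]) (fact maxr, fact maxs)
qed

lemma unimodular_row:
  assumes F: "carr l m F" "1 \<le> l" and gen: "gen_minors l F \<delta>" and one: "\<delta> 1 dvd 1"
  shows "\<exists>u v. carr 1 l u \<and> carr m 1 v \<and> u * F * v = I 1"
proof (cases "Max {k. k \<le> l \<and> \<not> g1 dvd \<delta> k} \<le> Max {k. k \<le> l \<and> \<not> g2 dvd \<delta> k}")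
  case True
  then show ?thesis by (rule unimodular_row_le[OF assms])
next
  case False
  interpret swapped: two_retractions \<rho>2 \<rho>1 g2 g1 by (rule swap)
  have "swapped.gen_minors l F \<delta>"
    using gen unfolding gen_minors_def swapped.gen_minors_def by (simp only: mult.commute[of g2 g1])
  then show ?thesis using False one by (intro swapped.unimodular_row_le[OF F]) auto
qed

theorem diagonalizable:
  assumes "carr l m F" "l \<le> m" "gen_minors l F \<delta>"
  shows "\<exists>U U' V V' \<phi>. carr l l U \<and> carr l l U' \<and> carr m m V \<and> carr m m V' \<and>
    U * U' = I l \<and> U' * U = I l \<and> V * V' = I m \<and> V' * V = I m \<and>
    U * F * V = fm l m (\<lambda>i j. if i = j then \<phi> i else 0) \<and>
    (\<forall>k\<le>l. (\<Prod>i<k. \<phi> i) dvd \<delta> k \<and> \<delta> k dvd (\<Prod>i<k. \<phi> i))"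
  using assms
proof (induction l arbitrary: m F \<delta>)
  case 0
  then have "F = 0" by (intro fmat_eqI) (auto simp: carr_def)
  moreover have "\<delta> 0 dvd 1" using 0 unfolding gen_minors_def by (metis le_refl minor_0)
  moreover have "fm 0 m h = (0 :: 'a fmat)" for h by (rule fmat_eqI) simp
  ultimately show ?case
    by (intro exI[of _ "0 :: 'a fmat"] exI[of _ "I m :: 'a fmat"] exI[of _ "\<lambda>_. 0"] conjI) (simp_all)
next
  case (Suc l)
  define d where "d = \<delta> 1"
  have "\<exists>N. d dvd (g1 * g2) ^ N" using Suc.prems(3) unfolding gen_minors_def d_def by simp
  then have d0: "d \<noteq> 0" using g_nz by (metis dvd_0_left_iff mult_eq_0_iff power_not_zero)
  have "d dvd ent F i j" for i j
  proof -
    have "d dvd minor 1 (\<lambda>_. i) (\<lambda>_. j) F" using Suc.prems(3) unfolding gen_minors_def d_def by simp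
    then show ?thesis by (simp add: minor_1)
  qed
  then obtain F0 where F0: "carr (Suc l) m F0" "F = sm d F0" using fmat_divisible[OF Suc.prems(1)] by metis
  \<comment> \<open>Dividing the matrix by \<open>d\<close> divides the generator of order
    \<open>k\<close> by \<open>d ^ k\<close>.\<close>
  have "\<exists>x. x \<in> minor_ideal k F0 \<and> \<delta> k = d ^ k * x" if "k \<le> Suc l" for k
  proof -
    have "\<delta> k \<in> minor_ideal k (sm d F0)" using Suc.prems(3) that F0(2) unfolding gen_minors_def by blast
    then show ?thesis using minor_ideal_sm by metis
  qed
  then obtain \<epsilon> where \<epsilon>: "\<And>k. k \<le> Suc l \<Longrightarrow> \<epsilon> k \<in> minor_ideal k F0" "\<And>k. k \<le> Suc l \<Longrightarrow> \<delta> k = d ^ k * \<epsilon> k" by metis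
  have gen0: "gen_minors (Suc l) F0 \<epsilon>"
    unfolding gen_minors_def
  proof (intro allI impI conjI)
    fix k assume k: "k \<le> Suc l"
    show "\<epsilon> k \<in> minor_ideal k F0" by (rule \<epsilon>(1)[OF k])
    have "d ^ k * \<epsilon> k dvd d ^ k * minor k f g F0" for f g
      using Suc.prems(3) k unfolding gen_minors_def F0(2) minor_sm \<epsilon>(2)[OF k, symmetric] by blast
    then show "\<epsilon> k dvd minor k f g F0" for f g using d0 by (simp only: dvd_mult_cancel_left) simp
    show "\<exists>N. \<epsilon> k dvd (g1 * g2) ^ N"
      using Suc.prems(3) k \<epsilon>(2)[OF k] unfolding gen_minors_def by (metis dvd_mult_right)
  qed
  have \<epsilon>1: "\<epsilon> 1 dvd 1"
  proof -
    have "d * 1 = d * \<epsilon> 1" using \<epsilon>(2)[of 1] by (simp add: d_def[symmetric])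
    then have "1 = \<epsilon> 1" using d0 by (simp only: mult_cancel_left) simp
    then show ?thesis by simp
  qed
  obtain u v where uv: "carr 1 (Suc l) u" "carr m 1 v" "u * F0 * v = I 1"
    using unimodular_row[OF F0(1) _ gen0 \<epsilon>1] by auto
  obtain m' where m': "m = Suc m'" using Suc.prems(2) by (cases m) auto
  define z y where "z = F0 * v" and "y = u * F0"
  have zy: "carr (Suc l) 1 z" "carr 1 m y" "u * z = I 1" "y * v = I 1"
    using uv carr_times[OF F0(1) uv(2)] carr_times[OF uv(1) F0(1)] by (simp_all add: z_def y_def mult.assoc)
  obtain X1 Y1 where 1: "carr (Suc l) l X1" "carr l (Suc l) Y1" "X1 * Y1 = I (Suc l) - z * u" "Y1 * X1 = I l"
    using hermite_complement[OF hermite zy(1) uv(1) zy(3)] by auto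
  obtain X2 Y2 where 2: "carr m m' X2" "carr m' m Y2" "X2 * Y2 = I m - v * y" "Y2 * X2 = I m'"
    using hermite_complement[OF hermite uv(2) zy(2) zy(4)] m' by auto
  have ortho: "x * X = 0 \<and> Y * w = 0"
    if "carr 1 n x" "carr n 1 w" "x * w = I 1" "carr n k X" "carr k n Y" "X * Y = I n - w * x" "Y * X = I k"
    for x w X Y :: "'a fmat" and n k
  proof -
    have "x * X = x * X * (Y * X)" by (simp add: that(7) mult.assoc times_I[OF that(4)])
    also have "\<dots> = x * (X * Y) * X" by (simp only: mult.assoc)
    also have "\<dots> = 0"
      by (simp add: that(6) algebra_simps I_times[OF that(4)] that(3)[THEN mulR] I_times[OF carr_times[OF that(1,4)]])
    finally have xX: "x * X = 0" .
    have "Y * w = (Y * X) * (Y * w)" by (simp only: that(7) I_times[OF carr_times[OF that(5,2)]])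
    also have "\<dots> = Y * ((X * Y) * w)" by (simp only: mult.assoc)
    also have "\<dots> = 0"
      by (simp add: that(6) algebra_simps I_times[OF that(2)] that(3) times_I[OF that(2)])
    finally show ?thesis using xX by simp
  qed
  have o1: "u * X1 = 0" "Y1 * z = 0" using ortho[OF uv(1) zy(1) zy(3) 1] by simp_all
  have o2: "y * X2 = 0" "Y2 * v = 0" using ortho[OF zy(2) uv(2) zy(4) 2] by simp_all
  define F' where "F' = Y1 * F0 * X2"
  have cF': "carr l m' F'" unfolding F'_def by (rule carr_times[OF carr_times[OF 1(2) F0(1)] 2(1)])
  let ?i = "\<lambda>n. ins 1 n :: 'a fmat" and ?p = "\<lambda>n. prj 1 n :: 'a fmat"
  have ip: "?p n * ?i n = I n" "I 1 * ?i n = 0" "?p n * I 1 = 0" "?i n * ?p n = I (Suc n) - I 1" for n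
    by (simp_all add: prj_ins ins_prj I_ins prj_I plus_1_eq_Suc)
  have pI: "?p n * A = 0" if "carr 1 c A" for n c and A :: "'a fmat"
  proof -
    have "?p n * A = ?p n * I 1 * A" by (simp only: mult.assoc I_times[OF that])
    then show ?thesis by (simp add: ip)
  qed
  have Ii: "A * ?i n = 0" if "carr c 1 A" for n c and A :: "'a fmat"
  proof -
    have "A * ?i n = A * (I 1 * ?i n)" by (simp only: mult.assoc[symmetric] times_I[OF that])
    then show ?thesis by (simp add: ip)
  qed
  \<comment> \<open>\<open>U1\<close> is \<open>u\<close> stacked over \<open>Y1\<close>, and its
    inverse is \<open>z\<close> followed by \<open>X1\<close>; similarly for \<open>V1\<close>. As
    \<open>X1\<close> and \<open>Y1\<close> belong to the complement of \<open>z\<close>, the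
    product \<open>U1 * F0 * V1\<close> has the block form diag(1, F').\<close>
  define U1 U1' V1 V1' where "U1 = u + ?i l * Y1" and "U1' = z + X1 * ?p l"
    and "V1 = v + X2 * ?p m'" and "V1' = y + ?i m' * Y2"
  have cU1: "carr (Suc l) (Suc l) U1" "carr (Suc l) (Suc l) U1'"
    unfolding U1_def U1'_def using uv(1) zy(1) 1
    by (auto intro!: carr_add intro: carr_mono carr_times carr_ins_1 carr_prj_1)
  have cV1: "carr m m V1" "carr m m V1'"
    unfolding V1_def V1'_def using uv(2) zy(2) 2 m'
    by (auto intro!: carr_add intro: carr_mono carr_times carr_ins_1 carr_prj_1)
  have U1: "U1 * U1' = I (Suc l)"
    by (simp add: U1_def U1'_def algebra_simps zy o1 o1[THEN mulR] 1(4)[THEN mulR] ip I_times[OF carr_prj])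
  have U1': "U1' * U1 = I (Suc l)"
    by (simp add: U1_def U1'_def algebra_simps pI[OF uv(1)] Ii[OF zy(1), THEN mulR] ip[THEN mulR] I_times[OF 1(2)] 1(3))
  have V1: "V1 * V1' = I m"
    by (simp add: V1_def V1'_def algebra_simps pI[OF zy(2)] Ii[OF uv(2), THEN mulR] ip[THEN mulR] I_times[OF 2(2)] 2(3))
  have V1': "V1' * V1 = I m"
    by (simp add: V1_def V1'_def algebra_simps zy o2 o2[THEN mulR] 2(4)[THEN mulR] ip I_times[OF carr_prj] m')
  have F0_eq: "U1 * F0 * V1 = I 1 + ?i l * F' * ?p m'"
  proof -
    have "U1 * F0 * V1 = u * F0 * v + y * X2 * ?p m' + ?i l * (Y1 * z) + ?i l * (Y1 * F0 * X2) * ?p m'"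
      by (simp add: U1_def V1_def y_def z_def algebra_simps)
    then show ?thesis by (simp add: uv(3)[unfolded mult.assoc] o1 o2 F'_def mult.assoc)
  qed
  have ideals: "minor_ideal (Suc k) F0 = minor_ideal k F'" for k
    using minor_ideal_equiv[OF U1' V1 F0(1), of "Suc k"] minor_ideal_border[OF cF', of k] by (simp only: F0_eq)
  \<comment> \<open>The border raises the order of minors by one, hence the shifted index.\<close>
  have gen': "gen_minors l F' (\<lambda>k. \<epsilon> (Suc k))"
    unfolding gen_minors_def
  proof (intro allI impI conjI)
    fix k assume k: "k \<le> l"
    show "\<epsilon> (Suc k) \<in> minor_ideal k F'" using \<epsilon>(1)[of "Suc k"] k by (simp add: ideals)
    show "\<epsilon> (Suc k) dvd minor k f g F'" for f g
      using gen_minors_ideal[OF gen0, of "Suc k"] k minor_in_minor_ideal[of k f g F'] by (simp add: ideals)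
    show "\<exists>N. \<epsilon> (Suc k) dvd (g1 * g2) ^ N" using gen0 k unfolding gen_minors_def by simp
  qed
  obtain U2 U2' V2 V2' \<phi> where IH: "carr l l U2" "carr l l U2'" "carr m' m' V2" "carr m' m' V2'"
    "U2 * U2' = I l" "U2' * U2 = I l" "V2 * V2' = I m'" "V2' * V2 = I m'"
    "U2 * F' * V2 = fm l m' (\<lambda>i j. if i = j then \<phi> i else 0)"
    "\<And>k. k \<le> l \<Longrightarrow> (\<Prod>i<k. \<phi> i) dvd \<epsilon> (Suc k) \<and> \<epsilon> (Suc k) dvd (\<Prod>i<k. \<phi> i)"
    using Suc.IH[OF cF' _ gen'] Suc.prems(2) m' by auto
  \<comment> \<open>\<open>E n M\<close> is diag(1, M), which extends the transformations of
    \<open>F'\<close> to the bordered matrix.\<close>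
  define E where "E n M = I 1 + ?i n * M * ?p n" for n M
  have cE: "carr (Suc n) (Suc n) (E n M)" if "carr n n M" for n M
    unfolding E_def by (intro carr_add carr_mono[OF carr_I] carr_times[OF carr_times[OF carr_ins_1 that] carr_prj_1]) auto
  have EE: "E n M * E n M' = E n (M * M')" if "carr n n M" "carr n n M'" for n M M'
    by (simp add: E_def algebra_simps ip[THEN mulR] ip I_times[OF that(2), THEN mulR])
  have EI: "E n (I n) = I (Suc n)" for n
    by (simp add: E_def mult.assoc I_times[OF carr_prj] ip)
  have E_mid: "E l U2 * (I 1 + ?i l * F' * ?p m') * E m' V2 = I 1 + ?i l * (U2 * F' * V2) * ?p m'"
    by (simp add: E_def algebra_simps ip[THEN mulR] ip I_times[OF cF', THEN mulR] I_times[OF IH(3), THEN mulR])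
  define \<psi> where "\<psi> i = (case i of 0 \<Rightarrow> d | Suc j \<Rightarrow> d * \<phi> j)" for i
  show ?case
  proof (intro exI conjI)
    show "carr (Suc l) (Suc l) (E l U2 * U1)" "carr (Suc l) (Suc l) (U1' * E l U2')"
      by (intro carr_times[OF cE cU1(1)] carr_times[OF cU1(2) cE] IH)+
    show "carr m m (V1 * E m' V2)" "carr m m (E m' V2' * V1')"
      using carr_times[OF cV1(1) cE[OF IH(3)]] carr_times[OF cE[OF IH(4)] cV1(2)] by (simp_all add: m')
    have "E l U2 * U1 * (U1' * E l U2') = E l U2 * (U1 * U1') * E l U2'" by (simp only: mult.assoc)
    also have "\<dots> = I (Suc l)" by (simp add: U1 times_I[OF cE[OF IH(1)]] EE IH EI)
    finally show "E l U2 * U1 * (U1' * E l U2') = I (Suc l)" .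
    have "U1' * E l U2' * (E l U2 * U1) = U1' * (E l U2' * E l U2) * U1" by (simp only: mult.assoc)
    also have "\<dots> = I (Suc l)" by (simp add: EE IH EI times_I[OF cU1(2)] U1')
    finally show "U1' * E l U2' * (E l U2 * U1) = I (Suc l)" .
    have "V1 * E m' V2 * (E m' V2' * V1') = V1 * (E m' V2 * E m' V2') * V1'" by (simp only: mult.assoc)
    also have "\<dots> = I m" by (simp add: EE IH EI m'[symmetric] times_I[OF cV1(1)] V1)
    finally show "V1 * E m' V2 * (E m' V2' * V1') = I m" .
    have "E m' V2' * V1' * (V1 * E m' V2) = E m' V2' * (V1' * V1) * E m' V2" by (simp only: mult.assoc)
    also have "\<dots> = I m" unfolding V1' by (simp add: m' times_I[OF cE[OF IH(4)]] EE IH EI)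
    finally show "E m' V2' * V1' * (V1 * E m' V2) = I m" .
    have "E l U2 * U1 * F * (V1 * E m' V2) = sm d (E l U2 * (U1 * F0 * V1) * E m' V2)"
      by (simp add: F0(2) sm_times times_sm mult.assoc)
    also have "\<dots> = sm d (I 1 + ?i l * (U2 * F' * V2) * ?p m')" by (simp only: F0_eq E_mid)
    also have "\<dots> = fm (Suc l) m (\<lambda>i j. if i = j then \<psi> i else 0)"
    proof (rule fmat_eqI)
      fix i j
      have "carr l m' (U2 * F' * V2)" by (rule carr_times[OF carr_times[OF IH(1) cF'] IH(3)])
      from ent_border[OF this, of i j]
      show "ent (sm d (I 1 + ?i l * (U2 * F' * V2) * ?p m')) i j = ent (fm (Suc l) m (\<lambda>i j. if i = j then \<psi> i else 0)) i j"
        unfolding IH(9) by (cases i; cases j) (simp_all del: ent_add add: \<psi>_def m')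
    qed
    finally show "E l U2 * U1 * F * (V1 * E m' V2) = fm (Suc l) m (\<lambda>i j. if i = j then \<psi> i else 0)" .
    show "\<forall>k\<le>Suc l. (\<Prod>i<k. \<psi> i) dvd \<delta> k \<and> \<delta> k dvd (\<Prod>i<k. \<psi> i)"
    proof (intro allI impI)
      fix k assume k: "k \<le> Suc l"
      show "(\<Prod>i<k. \<psi> i) dvd \<delta> k \<and> \<delta> k dvd (\<Prod>i<k. \<psi> i)"
      proof (cases k)
        case 0
        then show ?thesis using Suc.prems(3) unfolding gen_minors_def by (metis lessThan_0 minor_0 one_dvd prod.empty zero_le)
      next
        case (Suc j)
        have "(\<Prod>i<k. \<psi> i) = \<psi> 0 * (\<Prod>i<j. \<psi> (Suc i))" unfolding Suc by (rule prod.lessThan_Suc_shift)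
        also have "\<dots> = d ^ k * (\<Prod>i<j. \<phi> i)" by (simp add: \<psi>_def prod.distrib Suc)
        finally have prod: "(\<Prod>i<k. \<psi> i) = d ^ k * (\<Prod>i<j. \<phi> i)" .
        show ?thesis unfolding prod \<epsilon>(2)[OF k] using IH(10)[of j] k Suc by (auto intro: mult_dvd_mono)
      qed
    qed
  qed
qed

end

subsection \<open>The Smith normal form\<close>

definition of_mat :: "'a::zero mat \<Rightarrow> 'a fmat"
  where "of_mat F = fm (dim_row F) (dim_col F) (\<lambda>i j. F $$ (i, j))"

definition to_mat :: "nat \<Rightarrow> nat \<Rightarrow> 'a::zero fmat \<Rightarrow> 'a mat"
  where "to_mat n m M = mat n m (\<lambda>(i, j). ent M i j)"

lemma carr_of_mat: "F \<in> carrier_mat n m \<Longrightarrow> carr n m (of_mat F)"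
  by (auto simp: of_mat_def)

lemma to_mat_carrier [simp]: "to_mat n m M \<in> carrier_mat n m" by (simp add: to_mat_def)

lemma to_of_mat: "F \<in> carrier_mat n m \<Longrightarrow> to_mat n m (of_mat F) = F"
  by (rule eq_matI) (auto simp: to_mat_def of_mat_def)

lemma of_to_mat: "carr n m M \<Longrightarrow> of_mat (to_mat n m M) = M"
  by (rule fmat_eqI) (auto simp: to_mat_def of_mat_def carr_def not_less)

lemma to_mat_times:
  assumes "carr n k M"
  shows "to_mat n m (M * N) = to_mat n k M * to_mat k m N"
  by (rule eq_matI) (auto simp: to_mat_def ent_times_carr[OF assms] scalar_prod_def atLeast0LessThan)

lemma of_mat_times:
  assumes "A \<in> carrier_mat n k" "B \<in> carrier_mat k m"
  shows "of_mat (A * B) = of_mat A * of_mat B"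
proof -
  have "to_mat n m (of_mat A * of_mat B) = A * B"
    using assms by (simp add: to_mat_times[OF carr_of_mat[OF assms(1)]] to_of_mat)
  then show ?thesis
    using of_to_mat[OF carr_times[OF carr_of_mat[OF assms(1)] carr_of_mat[OF assms(2)]]] by simp
qed

lemma to_mat_I: "to_mat n n (I n) = (1\<^sub>m n :: 'a::comm_ring_1 mat)"
  by (rule eq_matI) (auto simp: to_mat_def)

lemma unimodular_to_mat:
  fixes U :: "'a::idom fmat"
  assumes "carr n n U" "U * U' = I n"
  shows "unimodular (to_mat n n U)"
proof -
  have "to_mat n n U * to_mat n n U' = 1\<^sub>m n"
    by (simp add: to_mat_times[OF assms(1), symmetric] assms(2) to_mat_I)
  then have "det (to_mat n n U) * det (to_mat n n U') = 1"
    using det_mult[of "to_mat n n U" n "to_mat n n U'"] by simp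
  then have "det (to_mat n n U) dvd 1" by (metis dvd_triv_left)
  then show ?thesis by (simp add: unimodular_def to_mat_def)
qed

text \<open>Submatrices list their index sets in increasing order, whereas \<open>minor\<close> uses
  functions. An injective function is the increasing enumeration of its range up to a permutation,
  so the two notions of minor differ by a sign.\<close>

lemma inj_on_eq_pick_permutes:
  assumes "inj_on f {0..<k}"
  obtains p where "p permutes {0..<k}" "\<And>i. i < k \<Longrightarrow> f i = pick (f ` {0..<k}) (p i)"
proof -
  let ?I = "f ` {0..<k}"
  have card: "card ?I = k" using card_image[OF assms] by simp
  have bij: "bij_betw (pick ?I) {0..<k} ?I"
  proof -
    have "inj_on (pick ?I) {0..<k}"
    proof (rule inj_onI)
      fix i j assume ij: "i \<in> {0..<k}" "j \<in> {0..<k}" "pick ?I i = pick ?I j"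
      show "i = j"
      proof (rule ccontr)
        assume "i \<noteq> j"
        then consider "i < j" | "j < i" by linarith
        then show False
        proof cases
          case 1 then show False using pick_mono_le[of j ?I i] ij card by simp
        next
          case 2 then show False using pick_mono_le[of i ?I j] ij card by simp
        qed
      qed
    qed
    moreover have sub: "pick ?I ` {0..<k} \<subseteq> ?I" using pick_in_set_le[of _ ?I] card by auto
    ultimately show ?thesis unfolding bij_betw_def using card card_image card_subset_eq[of ?I "pick ?I ` {0..<k}"]
      by (metis card_atLeastLessThan diff_zero finite_atLeastLessThan finite_imageI)
  qed
  define p where "p i = (if i < k then inv_into {0..<k} (pick ?I) (f i) else i)" for i
  have pi: "p i \<in> {0..<k} \<and> pick ?I (p i) = f i" if "i < k" for i
  proof -
    have "f i \<in> pick ?I ` {0..<k}" using bij that by (auto simp: bij_betw_def)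
    then show ?thesis using inv_into_into f_inv_into_f that unfolding p_def by (metis (full_types))
  qed
  have "inj_on p {0..<k}"
    using pi assms unfolding inj_on_def by (metis atLeastLessThan_iff)
  moreover have "p ` {0..<k} \<subseteq> {0..<k}" using pi by auto
  ultimately have "bij_betw p {0..<k} {0..<k}" by (simp add: bij_betw_def endo_inj_surj)
  then have "p permutes {0..<k}" by (rule bij_imp_permutes) (simp add: p_def)
  then show ?thesis using that pi by metis
qed

lemma minor_out_of_range:
  assumes "carr n m M" "i < k" "n \<le> f i"
  shows "minor k f g M = 0"
  using assms by (intro minor_zero_row[of i]) (auto simp: carr_def)

lemma det_submatrix:
  assumes "A \<subseteq> {..<dim_row F}" "B \<subseteq> {..<dim_col F}" "card A = k" "card B = k"
  shows "det (submatrix F A B) = minor k (pick A) (pick B) (of_mat F)"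
proof -
  have "{i. i < dim_row F \<and> i \<in> A} = A" "{j. j < dim_col F \<and> j \<in> B} = B" using assms by auto
  moreover have "pick A i < dim_row F" if "i < k" for i using pick_in_set_le[of i A] assms that by auto
  moreover have "pick B i < dim_col F" if "i < k" for i using pick_in_set_le[of i B] assms that by auto
  ultimately show ?thesis
    unfolding submatrix_def minor_def using assms by (intro arg_cong[where f = det] eq_matI) (auto simp: of_mat_def)
qed

lemma minors_subset: "x \<in> minors k F \<Longrightarrow> \<exists>f g. x = minor k f g (of_mat F)"
  unfolding minors_def using det_submatrix by blast

lemma minor_of_mat:
  fixes F :: "'a::idom mat"
  shows "minor k f g (of_mat F) = 0 \<or> (\<exists>s. \<exists>x\<in>minors k F. minor k f g (of_mat F) = s * x)"
proof (cases "inj_on f {0..<k} \<and> inj_on g {0..<k} \<and> (\<forall>i<k. f i < dim_row F \<and> g i < dim_col F)")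
  case True
  obtain p where p: "p permutes {0..<k}" "\<And>i. i < k \<Longrightarrow> f i = pick (f ` {0..<k}) (p i)"
    using inj_on_eq_pick_permutes True by blast
  obtain q where q: "q permutes {0..<k}" "\<And>i. i < k \<Longrightarrow> g i = pick (g ` {0..<k}) (q i)"
    using inj_on_eq_pick_permutes True by blast
  let ?A = "f ` {0..<k}" and ?B = "g ` {0..<k}"
  have "minor k f g (of_mat F) = minor k (\<lambda>i. pick ?A (p i)) (\<lambda>i. pick ?B (q i)) (of_mat F)"
    by (rule minor_cong) (fact p(2), fact q(2))
  also have "\<dots> = signof p * (signof q * minor k (pick ?A) (pick ?B) (of_mat F))"
    unfolding minor_permute_rows[OF p(1)] minor_tr[symmetric, of k "pick ?A"] minor_permute_rows[OF q(1)] ..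
  also have "minor k (pick ?A) (pick ?B) (of_mat F) = det (submatrix F ?A ?B)"
    by (rule det_submatrix[of ?A F ?B k, symmetric]) (use True in \<open>auto simp: card_image\<close>)
  finally have "minor k f g (of_mat F) = (signof p * signof q) * det (submatrix F ?A ?B)" by (simp only: mult.assoc)
  moreover have "det (submatrix F ?A ?B) \<in> minors k F"
    unfolding minors_def by (intro CollectI exI[of _ ?A] exI[of _ ?B]) (use True in \<open>auto simp: card_image\<close>)
  ultimately show ?thesis by blast
next
  case False
  have c: "carr (dim_row F) (dim_col F) (of_mat F)" by (simp add: of_mat_def)
  consider "\<not> inj_on f {0..<k}" | "\<not> inj_on g {0..<k}" | i where "i < k" "dim_row F \<le> f i" | i where "i < k" "dim_col F \<le> g i"
    using False not_less by blast
  then have "minor k f g (of_mat F) = 0"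
  proof cases
    case 1
    then obtain i j where "i < k" "j < k" "i \<noteq> j" "f i = f j" by (auto simp: inj_on_def)
    then show ?thesis by (rule minor_noninj)
  next
    case 2
    then obtain i j where "i < k" "j < k" "i \<noteq> j" "g i = g j" by (auto simp: inj_on_def)
    then have "minor k g f (tr (of_mat F)) = 0" by (rule minor_noninj)
    then show ?thesis by (simp add: minor_tr)
  next
    case 3
    then show ?thesis by (rule minor_out_of_range[OF c])
  next
    case 4
    then have "minor k g f (tr (of_mat F)) = 0" by (rule minor_out_of_range[OF carr_tr[OF c]])
    then show ?thesis by (simp add: minor_tr)
  qed
  then show ?thesis by blast
qed

lemma minor_ideal_of_mat: "minor_ideal k (of_mat F) = ideal_generated (minors k F)"
proof
  show "ideal_generated (minors k F) \<subseteq> minor_ideal k (of_mat F)"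
    using minors_subset minor_in_minor_ideal by (intro ideal_generated_least is_ideal_minor_ideal) blast
  show "minor_ideal k (of_mat F) \<subseteq> ideal_generated (minors k F)"
  proof (rule minor_ideal_least[OF is_ideal_generated])
    fix f g
    show "minor k f g (of_mat F) \<in> ideal_generated (minors k F)"
      using minor_of_mat[of k f g F] ideal_zeroD[OF is_ideal_generated] ideal_multD[OF is_ideal_generated ideal_generated_base]
      by metis
  qed
qed

lemma dvd_minors_iff: "(\<forall>x\<in>minors k F. c dvd x) \<longleftrightarrow> (\<forall>f g. c dvd minor k f g (of_mat F))"
proof
  show "\<forall>f g. c dvd minor k f g (of_mat F) \<Longrightarrow> \<forall>x\<in>minors k F. c dvd x" using minors_subset by metis
  show "\<forall>x\<in>minors k F. c dvd x \<Longrightarrow> \<forall>f g. c dvd minor k f g (of_mat F)"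
    using minor_of_mat[of k _ _ F] by (metis dvd_0_right dvd_mult)
qed

lemma dvd_minors_mono:
  assumes "k \<le> j" "\<forall>x\<in>minors k F. c dvd x"
  shows "\<forall>x\<in>minors j F. c dvd x"
proof -
  have "minor_ideal k (of_mat F) \<subseteq> {x. c dvd x}"
    using assms(2) unfolding dvd_minors_iff by (intro minor_ideal_least is_ideal_dvd) blast
  moreover have "minor_ideal j (of_mat F) \<subseteq> minor_ideal k (of_mat F)"
    by (rule minor_ideal_antimono[OF assms(1)])
  ultimately show ?thesis unfolding dvd_minors_iff using minor_in_minor_ideal by blast
qed

lemma exact_quot: "b \<noteq> 0 \<Longrightarrow> b dvd a \<Longrightarrow> b * exact_quot a b = (a :: 'a::idom)"
proof -
  assume b: "b \<noteq> 0" "b dvd a"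
  then obtain c where "a = b * c" unfolding dvd_def by blast
  then have "a = b * (THE c. a = b * c)" by (rule theI) (use \<open>a = b * c\<close> b in simp)
  then show ?thesis unfolding exact_quot_def by simp
qed

text \<open>Multiplication by \<open>minor_gcd k F\<close> maps the reduced ideal bijectively onto
  the ideal of the minors and sends 1 to \<open>minor_gcd k F\<close>.\<close>

lemma reduced_ideal_UNIV_iff:
  fixes F :: "'a::idom mat"
  assumes d: "minor_gcd k F \<noteq> 0" "\<forall>x\<in>minors k F. minor_gcd k F dvd x"
  shows "reduced_ideal k F = UNIV \<longleftrightarrow> minor_gcd k F \<in> minor_ideal k (of_mat F)"
proof
  let ?d = "minor_gcd k F"
  have J: "is_ideal (reduced_ideal k F)" unfolding reduced_ideal_def by (rule is_ideal_generated)
  have M: "is_ideal (minor_ideal k (of_mat F))" by (rule is_ideal_minor_ideal)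
  {
    assume "reduced_ideal k F = UNIV"
    have "is_ideal {x. ?d * x \<in> minor_ideal k (of_mat F)}"
    proof -
      have "?d * (r * x) \<in> minor_ideal k (of_mat F)" if "?d * x \<in> minor_ideal k (of_mat F)" for r x
        using ideal_multD[OF M that, of r] by (simp only: mult.left_commute[of r])
      then show ?thesis
        using ideal_zeroD[OF M] ideal_addD[OF M] by (simp add: is_ideal_def distrib_left)
    qed
    moreover have "reduced_minors k F \<subseteq> {x. ?d * x \<in> minor_ideal k (of_mat F)}"
      using d exact_quot[OF d(1)] ideal_generated_base by (auto simp: reduced_minors_def minor_ideal_of_mat)
    ultimately have "reduced_ideal k F \<subseteq> {x. ?d * x \<in> minor_ideal k (of_mat F)}"
      unfolding reduced_ideal_def by (rule ideal_generated_least)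
    then have "1 \<in> {x. ?d * x \<in> minor_ideal k (of_mat F)}" using \<open>reduced_ideal k F = UNIV\<close> by blast
    then show "?d \<in> minor_ideal k (of_mat F)" by simp
  }
  assume "?d \<in> minor_ideal k (of_mat F)"
  let ?A = "{x. \<exists>y\<in>reduced_ideal k F. x = ?d * y}"
  have "is_ideal ?A"
    unfolding is_ideal_def
  proof (intro conjI ballI allI)
    show "0 \<in> ?A" using ideal_zeroD[OF J] by (intro CollectI bexI[of _ 0]) simp_all
    fix x assume "x \<in> ?A"
    then obtain y where y: "y \<in> reduced_ideal k F" "x = ?d * y" by blast
    show "r * x \<in> ?A" for r
      using ideal_multD[OF J y(1), of r] y(2) by (intro CollectI bexI[of _ "r * y"]) (simp_all add: mult.left_commute)
    fix x' assume "x' \<in> ?A"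
    then obtain y' where y': "y' \<in> reduced_ideal k F" "x' = ?d * y'" by blast
    show "x + x' \<in> ?A"
      using ideal_addD[OF J y(1) y'(1)] y(2) y'(2) by (intro CollectI bexI[of _ "y + y'"]) (simp_all add: distrib_left)
  qed
  moreover have "minors k F \<subseteq> ?A"
  proof
    fix x assume x: "x \<in> minors k F"
    then have "exact_quot x ?d \<in> reduced_ideal k F"
      unfolding reduced_ideal_def reduced_minors_def by (intro ideal_generated_base imageI)
    moreover have "x = ?d * exact_quot x ?d" using exact_quot[OF d(1)] d(2) x by simp
    ultimately show "x \<in> ?A" by blast
  qed
  ultimately have "minor_ideal k (of_mat F) \<subseteq> ?A" unfolding minor_ideal_of_mat by (rule ideal_generated_least)
  then obtain y where "y \<in> reduced_ideal k F" "?d = ?d * y" using \<open>?d \<in> minor_ideal k (of_mat F)\<close> by blast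
  then have "1 \<in> reduced_ideal k F" using d(1) by simp
  then show "reduced_ideal k F = UNIV" using ideal_multD'[OF J, of 1] by auto
qed

lemma minor_diag:
  assumes "k \<le> l" "k \<le> m"
  shows "minor k id id (fm l m (\<lambda>i j. if i = j then \<phi> i else 0)) = (\<Prod>i<k. \<phi> i :: 'a::comm_ring_1)"
proof -
  let ?M = "mat k k (\<lambda>(i, j). ent (fm l m (\<lambda>i j. if i = j then \<phi> i else 0)) (id i) (id j))"
  have "minor k id id (fm l m (\<lambda>i j. if i = j then \<phi> i else 0)) = prod_list (diag_mat ?M)"
    unfolding minor_def by (rule det_upper_triangular[of _ k]) (auto simp: upper_triangular_def)
  also have "\<dots> = (\<Prod>i = 0..<k. ?M $$ (i, i))" by (simp add: prod_list_diag_prod)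
  also have "\<dots> = (\<Prod>i<k. \<phi> i)" using assms by (intro prod.cong) auto
  finally show ?thesis .
qed

section \<open>Common divisors of the minors and comparison with the Smith form\<close>

context two_retractions
begin

lemma prime_power_dvd_cancel: "g1 ^ a dvd g2 ^ b * y \<Longrightarrow> g1 ^ a dvd y"
proof (rule dvd_cancel_prime_power[OF g_nz(2) prime2])
  show "\<not> g2 dvd g1 ^ a" using g_nz by (simp add: ker2[symmetric] h2.hom_power fix21)
qed

text \<open>Unique factorisation below a product of two prime powers, by splitting off one prime at
  a time.\<close>

lemma dvd_prime_powers:
  assumes "c dvd g1 ^ p * g2 ^ q"
  obtains a b where "a \<le> p" "b \<le> q" "c dvd g1 ^ a * g2 ^ b" "g1 ^ a * g2 ^ b dvd c"
proof -
  have 2: "\<exists>b\<le>q. c dvd g2 ^ b \<and> g2 ^ b dvd c" if "c dvd g2 ^ q" for c q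
    using that
  proof (induction q arbitrary: c)
    case (Suc q)
    show ?case
    proof (cases "g2 dvd c")
      case True
      then obtain c' where c: "c = g2 * c'" unfolding dvd_def by blast
      have "c' dvd g2 ^ q" using Suc.prems g_nz unfolding c power_Suc by (simp only: dvd_mult_cancel_left) simp
      then obtain b where "b \<le> q" "c' dvd g2 ^ b" "g2 ^ b dvd c'" using Suc.IH by blast
      then show ?thesis by (intro exI[of _ "Suc b"]) (auto simp: c intro: mult_dvd_mono)
    next
      case False
      have "c dvd g2 ^ Suc q * 1" using Suc.prems by simp
      then have "c dvd 1" by (rule dvd_cancel_prime_power[OF g_nz(2) prime2 False])
      then show ?thesis by (intro exI[of _ 0]) simp
    qed
  qed (auto intro: exI[of _ 0])
  have "\<exists>a\<le>p. \<exists>b\<le>q. c dvd g1 ^ a * g2 ^ b \<and> g1 ^ a * g2 ^ b dvd c" if "c dvd g1 ^ p * g2 ^ q" for c p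
    using that
  proof (induction p arbitrary: c)
    case 0
    then show ?case using 2[of c q] by auto
  next
    case (Suc p)
    show ?case
    proof (cases "g1 dvd c")
      case True
      then obtain c' where c: "c = g1 * c'" unfolding dvd_def by blast
      have "g1 * c' dvd g1 * (g1 ^ p * g2 ^ q)" using Suc.prems by (simp only: c power_Suc mult.assoc)
      then have "c' dvd g1 ^ p * g2 ^ q" using g_nz by (simp only: dvd_mult_cancel_left) simp
      then obtain a b where ab: "a \<le> p" "b \<le> q" "c' dvd g1 ^ a * g2 ^ b" "g1 ^ a * g2 ^ b dvd c'" using Suc.IH by blast
      have "g1 * c' dvd g1 * (g1 ^ a * g2 ^ b)" "g1 * (g1 ^ a * g2 ^ b) dvd g1 * c'" using ab by (auto intro: mult_dvd_mono)
      then show ?thesis using ab by (intro exI[of _ "Suc a"] conjI exI[of _ b]) (simp_all only: c power_Suc mult.assoc Suc_le_mono)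
    next
      case False
      have "c dvd g2 ^ q" by (rule dvd_cancel_prime_power[OF g_nz(1) prime1 False Suc.prems])
      then show ?thesis using 2[of c q] by (metis le0 mult_1 power_0)
    qed
  qed
  then show ?thesis using assms that by blast
qed

text \<open>All common divisors are divisors of \<open>g1\<^sup>p g2\<^sup>q\<close>, so the greatest one is found by
  maximising the two exponents separately.\<close>

lemma gcd_exists:
  assumes "\<And>c. \<forall>x\<in>A. c dvd x \<Longrightarrow> c dvd g1 ^ p * g2 ^ q"
  shows "\<exists>d. is_gcd_of A d"
proof -
  define a where "a = Max {a. a \<le> p \<and> (\<forall>x\<in>A. g1 ^ a dvd x)}"
  define b where "b = Max {b. b \<le> q \<and> (\<forall>x\<in>A. g2 ^ b dvd x)}"
  have fin: "finite {a. a \<le> p \<and> P a}" for P and p :: nat by simp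
  have "a \<in> {a. a \<le> p \<and> (\<forall>x\<in>A. g1 ^ a dvd x)}" unfolding a_def by (rule Max_in[OF fin]) (auto intro!: exI[of _ 0])
  moreover have "b \<in> {b. b \<le> q \<and> (\<forall>x\<in>A. g2 ^ b dvd x)}" unfolding b_def by (rule Max_in[OF fin]) (auto intro!: exI[of _ 0])
  ultimately have ab: "g1 ^ a dvd x" "g2 ^ b dvd x" if "x \<in> A" for x using that by simp_all
  show ?thesis
    unfolding is_gcd_of_def
  proof (intro exI[of _ "g1 ^ a * g2 ^ b"] conjI ballI allI impI)
    fix x assume x: "x \<in> A"
    obtain y where y: "x = g2 ^ b * y" using ab(2)[OF x] unfolding dvd_def by blast
    then have "g1 ^ a dvd y" using ab(1)[OF x] prime_power_dvd_cancel by blast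
    then show "g1 ^ a * g2 ^ b dvd x" unfolding y by (subst mult.commute) (rule mult_dvd_mono[OF dvd_refl])
  next
    fix c assume c: "\<forall>x\<in>A. c dvd x"
    obtain a' b' where ab': "a' \<le> p" "b' \<le> q" "c dvd g1 ^ a' * g2 ^ b'" "g1 ^ a' * g2 ^ b' dvd c"
      using dvd_prime_powers[OF assms[OF c]] .
    have "g1 ^ a' dvd x" "g2 ^ b' dvd x" if "x \<in> A" for x
      using c ab'(4) that by (meson dvd_mult_left dvd_mult_right dvd_trans)+
    then have "a' \<le> a" "b' \<le> b"
      unfolding a_def b_def by (auto intro!: Max_ge simp: ab')
    then have "g1 ^ a' * g2 ^ b' dvd g1 ^ a * g2 ^ b" by (intro mult_dvd_mono le_imp_power_dvd)
    then show "c dvd g1 ^ a * g2 ^ b" using ab'(3) dvd_trans by blast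
  qed
qed

theorem smith_form_iff:
  assumes F: "F \<in> carrier_mat l m" "l \<le> m" "normal_rank F = l"
    and gcd: "is_gcd_of (minors l F) (g1 ^ p * g2 ^ q)"
  shows "equivalent_mat F (smith_form F) \<longleftrightarrow> (\<forall>k\<in>{1..l}. reduced_ideal k F = UNIV)"
proof -
  let ?M = "of_mat F"
  define \<delta> where "\<delta> k = minor_gcd k F" for k
  have cM: "carr l m ?M" by (rule carr_of_mat[OF F(1)])
  have common: "c dvd g1 ^ p * g2 ^ q" if "k \<le> l" "\<forall>x\<in>minors k F. c dvd x" for c k
    using dvd_minors_mono[OF that] gcd unfolding is_gcd_of_def by blast
  have \<delta>0: "\<delta> 0 = 1" by (simp add: \<delta>_def minor_gcd_def)
  \<comment> \<open>\<open>minor_gcd\<close> is a choice, which is meaningful once a greatest common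
    divisor exists. By \<open>common\<close>, all common divisors in question divide
    \<open>g1 ^ p * g2 ^ q\<close>, as \<open>gcd_exists\<close> requires.\<close>
  have is_gcd: "is_gcd_of (minors k F) (\<delta> k)" if "k \<le> l" "0 < k" for k
    using someI_ex[OF gcd_exists[OF common[OF that(1)]]] that(2) by (simp add: \<delta>_def minor_gcd_def)
  have dvd: "\<forall>x\<in>minors k F. \<delta> k dvd x" if "k \<le> l" for k
    using is_gcd[OF that] \<delta>0 unfolding is_gcd_of_def by (cases "k = 0") auto
  have D0: "g1 ^ p * g2 ^ q \<noteq> 0" using g_nz by simp
  have \<delta>_nz: "\<delta> k \<noteq> 0" if "k \<le> l" for k
    using common[OF that dvd[OF that]] D0 by auto
  have \<delta>_Suc: "\<delta> k dvd \<delta> (Suc k)" if "Suc k \<le> l" for k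
    using is_gcd[OF that] dvd_minors_mono[of k "Suc k" F "\<delta> k"] dvd[of k] that unfolding is_gcd_of_def by simp
  define \<Phi> where "\<Phi> i = invariant_factor (i + 1) F" for i
  have \<Phi>: "\<delta> (Suc i) = \<delta> i * \<Phi> i" if "i < l" for i
    using exact_quot[OF \<delta>_nz[of i] \<delta>_Suc[of i]] that
    by (simp add: \<Phi>_def invariant_factor_def F(3) \<delta>_def Suc_eq_plus1[symmetric] plus_1_eq_Suc)
  have prod_\<Phi>: "(\<Prod>i<k. \<Phi> i) = \<delta> k" if "k \<le> l" for k
    using that by (induction k) (simp_all add: \<delta>0 \<Phi>)
  have dims: "dim_row F = l" "dim_col F = m" using F(1) by auto
  have S: "of_mat (smith_form F) = fm l m (\<lambda>i j. if i = j then \<Phi> i else 0)"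
    by (rule fmat_eqI) (auto simp: of_mat_def smith_form_def dims \<Phi>_def)
  have cS: "smith_form F \<in> carrier_mat l m" by (simp add: smith_form_def dims)
  have "(\<forall>k\<in>{1..l}. reduced_ideal k F = UNIV) \<longleftrightarrow> (\<forall>k\<in>{1..l}. \<delta> k \<in> minor_ideal k ?M)"
    using reduced_ideal_UNIV_iff[of _ F] \<delta>_nz dvd unfolding \<delta>_def by (intro ball_cong) auto
  also have "\<dots> \<longleftrightarrow> equivalent_mat F (smith_form F)"
  proof
    assume "equivalent_mat F (smith_form F)"
    then obtain P N where PN: "P \<in> carrier_mat l l" "N \<in> carrier_mat m m" "smith_form F = P * F * N"
      unfolding equivalent_mat_def dims by blast
    show "\<forall>k\<in>{1..l}. \<delta> k \<in> minor_ideal k ?M"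
    proof
      fix k assume "k \<in> {1..l}"
      then have k: "k \<le> l" by simp
      have PF: "P * F \<in> carrier_mat l m" using PN F by simp
      \<comment> \<open>The leading principal minor of the Smith form is the product of the first
        \<open>k\<close> invariant factors, which telescopes to \<open>\<delta> k\<close>.\<close>
      have "\<delta> k = minor k id id (of_mat (smith_form F))"
        unfolding S using k F(2) by (subst minor_diag) (simp_all add: prod_\<Phi>)
      also have "of_mat (smith_form F) = of_mat P * ?M * of_mat N"
        unfolding PN(3) of_mat_times[OF PF PN(2)] of_mat_times[OF PN(1) F(1)] ..
      also have "minor k id id \<dots> \<in> minor_ideal k ?M"
        using minor_in_minor_ideal minor_ideal_times_left minor_ideal_times_right by blast
      finally show "\<delta> k \<in> minor_ideal k ?M" .
    qed
  next
    assume all: "\<forall>k\<in>{1..l}. \<delta> k \<in> minor_ideal k ?M"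
    have "gen_minors l ?M \<delta>"
      unfolding gen_minors_def
    proof (intro allI impI conjI)
      fix k assume k: "k \<le> l"
      show "\<delta> k \<in> minor_ideal k ?M"
      proof (cases "k = 0")
        case True
        then show ?thesis using minor_in_minor_ideal[of 0 id id ?M] \<delta>0 by simp
      qed (use all k in auto)
      show "\<delta> k dvd minor k f g ?M" for f g using dvd[OF k] unfolding dvd_minors_iff by blast
      have "g1 ^ p * g2 ^ q dvd (g1 * g2) ^ (p + q)"
        unfolding power_mult_distrib by (intro mult_dvd_mono le_imp_power_dvd) auto
      then show "\<exists>N. \<delta> k dvd (g1 * g2) ^ N" using common[OF k dvd[OF k]] dvd_trans by blast
    qed
    from diagonalizable[OF cM F(2) this] obtain U U' V V' \<phi> where U: "carr l l U" "carr l l U'" "U * U' = I l" "U' * U = I l"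
      and V: "carr m m V" "V * V' = I m"
      and diag: "U * ?M * V = fm l m (\<lambda>i j. if i = j then \<phi> i else 0)"
      and assoc: "\<And>k. k \<le> l \<Longrightarrow> (\<Prod>i<k. \<phi> i) dvd \<delta> k" "\<And>k. k \<le> l \<Longrightarrow> \<delta> k dvd (\<Prod>i<k. \<phi> i)"
      by blast
    \<comment> \<open>The diagonal entries are known only through their partial products, up to
      units. Comparing consecutive products gives units for the entries themselves, which the
      diagonal matrix \<open>E\<close> absorbs.\<close>
    have "\<exists>\<omega> \<omega>'. \<Phi> i = \<omega> * \<phi> i \<and> \<omega> * \<omega>' = 1" if i: "i < l" for i
    proof -
      let ?P = "\<lambda>k. \<Prod>i<k. \<phi> i"
      have unit: "\<exists>e e'. \<delta> k = ?P k * e \<and> e * e' = 1" if k: "k \<le> l" for k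
      proof -
        obtain e e' where e: "\<delta> k = ?P k * e" "?P k = \<delta> k * e'" using assoc(1)[OF k] assoc(2)[OF k] unfolding dvd_def by blast
        have "\<delta> k * 1 = \<delta> k * (e * e')" using e by (metis mult.assoc mult.commute mult_1_right)
        then have "e * e' = 1" using \<delta>_nz[OF k] by (simp only: mult_cancel_left) simp
        then show ?thesis using e(1) by blast
      qed
      obtain e e' where e: "\<delta> i = ?P i * e" "e * e' = 1" using unit[of i] i by auto
      obtain w w' where w: "\<delta> (Suc i) = ?P (Suc i) * w" "w * w' = 1" using unit[of "Suc i"] i by auto
      have P0: "?P i \<noteq> 0" using e(1) \<delta>_nz[of i] i by auto
      have "?P i * (e * \<Phi> i) = \<delta> (Suc i)" by (simp only: \<Phi>[OF i] e(1) mult.assoc)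
      also have "\<dots> = ?P i * (\<phi> i * w)" unfolding w(1) prod.lessThan_Suc mult.assoc ..
      finally have "?P i * (e * \<Phi> i) = ?P i * (\<phi> i * w)" .
      then have eq: "e * \<Phi> i = \<phi> i * w" using P0 by (simp only: mult_cancel_left) simp
      have "\<Phi> i = (e * e') * \<Phi> i" by (simp add: e(2))
      also have "\<dots> = e' * (e * \<Phi> i)" by (simp only: mult_ac)
      also have "\<dots> = (e' * w) * \<phi> i" by (simp only: eq mult_ac)
      finally have "\<Phi> i = (e' * w) * \<phi> i" .
      moreover have "(e' * w) * (e * w') = 1"
      proof -
        have "(e' * w) * (e * w') = (e * e') * (w * w')" by (simp only: mult_ac)
        then show ?thesis by (simp add: e w)
      qed
      ultimately show ?thesis by blast
    qed
    then obtain \<omega> \<omega>' where \<omega>: "\<And>i. i < l \<Longrightarrow> \<Phi> i = \<omega> i * \<phi> i" "\<And>i. i < l \<Longrightarrow> \<omega> i * \<omega>' i = 1" by metis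
    have diag_times: "fm l l (\<lambda>i j. if i = j then \<psi> i else 0) * A = fm l c (\<lambda>i j. \<psi> i * ent A i j)"
      if "carr l c A" for \<psi> :: "nat \<Rightarrow> 'a" and A c
    proof (rule fmat_eqI)
      fix i j
      have "ent (fm l l (\<lambda>i j. if i = j then \<psi> i else 0) * A) i j
          = (\<Sum>k<l. if k = i then \<psi> i * ent A i j else 0)"
        by (subst ent_times_carr[OF carr_fm], rule sum.cong) auto
      then show "ent (fm l l (\<lambda>i j. if i = j then \<psi> i else 0) * A) i j = ent (fm l c (\<lambda>i j. \<psi> i * ent A i j)) i j"
        using carrD[OF that] by (auto simp: not_less)
    qed
    define E E' where "E = fm l l (\<lambda>i j. if i = j then \<omega> i else 0)" and "E' = fm l l (\<lambda>i j. if i = j then \<omega>' i else 0)"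
    have cE: "carr l l E" "carr l l E'" by (simp_all add: E_def E'_def)
    have EE': "E * E' = I l"
      unfolding E_def diag_times[OF cE(2)] by (rule fmat_eqI) (auto simp: E'_def \<omega>)
    have "E * (U * ?M * V) = of_mat (smith_form F)"
      unfolding E_def diag by (subst diag_times[of m], simp, rule fmat_eqI) (auto simp: S \<omega>)
    then have SE: "of_mat (smith_form F) = (E * U) * ?M * V" by (simp add: mult.assoc)
    have cEU: "carr l l (E * U)" by (rule carr_times[OF cE(1) U(1)])
    have "E * U * (U' * E') = E * (U * U') * E'" by (simp only: mult.assoc)
    then have inv: "E * U * (U' * E') = I l" by (simp add: U times_I[OF cE(1)] EE')
    have "smith_form F = to_mat l m ((E * U) * ?M * V)" using to_of_mat[OF cS] by (simp only: SE)
    also have "\<dots> = to_mat l l (E * U) * F * to_mat m m V"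
      by (simp add: to_mat_times[OF carr_times[OF cEU cM]] to_mat_times[OF cEU] to_of_mat[OF F(1)])
    finally show "equivalent_mat F (smith_form F)"
      unfolding equivalent_mat_def dims using unimodular_to_mat[OF cEU inv] unimodular_to_mat[OF V] to_mat_carrier by blast
  qed
  finally show ?thesis ..
qed

end

subsection \<open>Retractions modulo the two linear factors\<close>

definition sb :: "('n::finite \<Rightarrow> ('n, 'k::comm_ring_1) mpoly) \<Rightarrow> ('n, 'k) mpoly \<Rightarrow> ('n, 'k) mpoly"
  where "sb = mev kc"

lemma hom_sb: "comm_ring_hom (sb v)"
  unfolding sb_def by (rule comm_ring_hom.comm_ring_hom_mev[OF comm_ring_hom_kc])

lemma sb_simps [simp]: "sb v (kc c) = kc c" "sb v (xv i) = v i"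
  by (simp_all add: sb_def kc_simps)

lemma sb_sb: "sb v (sb w f) = sb (\<lambda>i. sb v (w i)) f"
  by (rule mpoly_hom_ext[OF comm_ring_hom_comp[OF hom_sb hom_sb] hom_sb]) simp_all

lemma sb_xv: "sb xv f = f"
  by (rule mpoly_hom_ext[OF hom_sb]) (unfold_locales, simp_all)

lemma sb_cong:
  assumes "ret V f = f" "\<And>i. i \<in> V \<Longrightarrow> v i = w i"
  shows "sb v f = sb w f"
proof -
  have 0: "sb u 0 = (0 :: ('a, 'b) mpoly)" for u by (simp add: sb_def mev_def)
  have "sb v (ret V f) = sb w (ret V f)"
    by (rule mpoly_hom_ext[OF comm_ring_hom_comp[OF hom_sb hom_ret] comm_ring_hom_comp[OF hom_sb hom_ret]])
       (simp_all add: assms(2) 0)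
  then show ?thesis by (simp only: assms(1))
qed

lemma sb_fixed: "ret V f = f \<Longrightarrow> (\<And>i. i \<in> V \<Longrightarrow> v i = xv i) \<Longrightarrow> sb v f = f"
  using sb_cong[of V f v xv] by (simp add: sb_xv)

lemma dvd_diff_mult:
  fixes d :: "'a::comm_ring_1"
  assumes "d dvd x - y" "d dvd x' - y'"
  shows "d dvd x * x' - y * y'"
proof -
  have "x * x' - y * y' = (x - y) * x' + y * (x' - y')" by (simp add: algebra_simps)
  then show ?thesis using assms by simp
qed

lemma dvd_diff_power: "d dvd x - y \<Longrightarrow> d dvd x ^ k - (y :: 'a::comm_ring_1) ^ k"
  by (induction k) (simp_all add: dvd_diff_mult)

lemma dvd_diff_prod: "(\<And>i. i \<in> A \<Longrightarrow> d dvd x i - y i) \<Longrightarrow> d dvd prod x A - (prod y A :: 'a::comm_ring_1)"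
  by (induction A rule: infinite_finite_induct) (simp_all add: dvd_diff_mult)

lemma dvd_sb_diff:
  assumes "\<And>i. d dvd v i - xv i"
  shows "d dvd sb v f - f"
proof -
  have "d dvd sb v f - sb xv f"
    unfolding sb_def mev_def sum_subtractf[symmetric] mval_def
    by (intro dvd_sum dvd_diff_mult dvd_diff_prod dvd_diff_power assms) simp
  then show ?thesis by (simp only: sb_xv)
qed

lemma xv_nz: "xv i \<noteq> (0 :: ('n, 'k::comm_ring_1) mpoly)"
proof
  assume "xv i = (0 :: ('n, 'k) mpoly)"
  then have "Poly_Mapping.lookup (xv i :: ('n, 'k) mpoly) (Poly_Mapping.single i 1) = 0" by simp
  then show False by (simp add: xv_def)
qed

lemma xv_minus_nz:
  fixes f :: "('n::finite, 'k::comm_ring_1) mpoly"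
  assumes "ret V f = f" "i \<notin> V"
  shows "xv i - f \<noteq> 0"
proof
  assume "xv i - f = 0"
  then have "f = xv i" by simp
  then have "xv i = (0 :: ('n, 'k) mpoly)" using assms by simp
  then show False by (simp add: xv_nz)
qed

text \<open>With \<open>g1\<close> and \<open>g2\<close> as coordinates in place of the variables
  \<open>a\<close> and \<open>b\<close>, the retractions set one of these coordinates to 0. The
  second one has to fix \<open>g1\<close>, so it must send \<open>xv a = g1 + f1\<close> to
  \<open>g1\<close> plus the result of substituting \<open>f2\<close> for the variable
  \<open>b\<close> in \<open>f1\<close>.\<close>

lemma two_retractions_mpoly:
  fixes f1 f2 :: "('n::{finite, linorder}, 'k::field) mpoly" and a b :: 'n
  assumes f: "ret V f1 = f1" "ret W f2 = f2" and V: "a \<notin> V" "b \<notin> W" "W \<subseteq> V" "a \<noteq> b"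
  defines "g1 \<equiv> xv a - f1" and "g2 \<equiv> xv b - f2"
  shows "two_retractions (sb (xv(a := f1))) (sb (xv(a := g1 + sb (xv(b := f2)) f1, b := f2))) g1 g2"
proof -
  define \<phi> where "\<phi> = sb (xv(b := f2))"
  define \<rho>1 where "\<rho>1 = sb (xv(a := f1))"
  define \<rho>2 where "\<rho>2 = sb (xv(a := g1 + \<phi> f1, b := f2))"
  have aW: "a \<notin> W" using V by blast
  note h1 = hom_sb[of "xv(a := f1)", folded \<rho>1_def] and h2 = hom_sb[of "xv(a := g1 + \<phi> f1, b := f2)", folded \<rho>2_def]
  interpret r1: comm_ring_hom \<rho>1 by (rule h1)
  interpret r2: comm_ring_hom \<rho>2 by (rule h2)
  have x1: "\<rho>1 (xv i) = (if i = a then f1 else xv i)" for i by (simp add: \<rho>1_def)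
  have x2: "\<rho>2 (xv i) = (if i = b then f2 else if i = a then g1 + \<phi> f1 else xv i)" for i by (simp add: \<rho>2_def)
  have c: "\<rho>1 (kc x) = kc x" "\<rho>2 (kc x) = kc x" for x by (simp_all add: \<rho>1_def \<rho>2_def)
  have \<rho>1f: "\<rho>1 f1 = f1" "\<rho>1 f2 = f2"
    unfolding \<rho>1_def using V aW by (auto intro!: sb_fixed[OF f(1)] sb_fixed[OF f(2)])
  have \<rho>2f: "\<rho>2 f1 = \<phi> f1" "\<rho>2 f2 = f2"
    unfolding \<rho>2_def \<phi>_def using V aW by (auto intro!: sb_cong[OF f(1)] sb_fixed[OF f(2)])
  have \<phi>f: "\<rho>1 (\<phi> f1) = \<phi> f1" "\<rho>2 (\<phi> f1) = \<phi> f1"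
  proof -
    have "sb (\<lambda>i. \<rho>1 ((xv(b := f2)) i)) f1 = \<phi> f1" "sb (\<lambda>i. \<rho>2 ((xv(b := f2)) i)) f1 = \<phi> f1"
      unfolding \<phi>_def using V by (auto intro!: sb_cong[OF f(1)] simp: x1 x2 \<rho>1f \<rho>2f)
    then show "\<rho>1 (\<phi> f1) = \<phi> f1" "\<rho>2 (\<phi> f1) = \<phi> f1"
      unfolding \<phi>_def by (simp_all add: \<rho>1_def \<rho>2_def sb_sb)
  qed
  have \<rho>g: "\<rho>1 g1 = 0" "\<rho>1 g2 = g2" "\<rho>2 g1 = g1" "\<rho>2 g2 = 0"
    using V by (simp_all add: g1_def g2_def r1.hom_minus r2.hom_minus x1 x2 \<rho>1f \<rho>2f)
  have d1: "g1 dvd \<rho>1 x - x" for x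
  proof -
    have "g1 dvd - g1" by simp
    then show ?thesis unfolding \<rho>1_def by (intro dvd_sb_diff) (auto simp: g1_def)
  qed
  have d2: "g2 dvd \<rho>2 x - x" for x
  proof -
    have 0: "g2 dvd f2 - xv b" using dvd_minus_iff[of g2 g2] by (simp add: g2_def)
    then have "g2 dvd \<phi> f1 - f1" unfolding \<phi>_def by (intro dvd_sb_diff) auto
    then show ?thesis unfolding \<rho>2_def using 0 by (intro dvd_sb_diff) (auto simp: g1_def)
  qed
  have "two_retractions \<rho>1 \<rho>2 g1 g2"
  proof (rule two_retractions.intro)
    show "comm_ring_hom \<rho>1" "comm_ring_hom \<rho>2" by (fact h1, fact h2)
    show "\<rho>1 x = 0 \<longleftrightarrow> g1 dvd x" for x
    proof
      show "\<rho>1 x = 0 \<Longrightarrow> g1 dvd x" using d1[of x] by simp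
      show "g1 dvd x \<Longrightarrow> \<rho>1 x = 0" unfolding dvd_def by (auto simp: r1.hom_mult \<rho>g)
    qed
    show "\<rho>2 x = 0 \<longleftrightarrow> g2 dvd x" for x
    proof
      show "\<rho>2 x = 0 \<Longrightarrow> g2 dvd x" using d2[of x] by simp
      show "g2 dvd x \<Longrightarrow> \<rho>2 x = 0" unfolding dvd_def by (auto simp: r2.hom_mult \<rho>g)
    qed
    show "\<rho>1 (\<rho>1 x) = \<rho>1 x" for x
      by (rule mpoly_hom_ext[OF comm_ring_hom_comp[OF h1 h1] h1]) (simp_all add: c x1 \<rho>1f)
    show "\<rho>2 (\<rho>2 x) = \<rho>2 x" for x
      by (rule mpoly_hom_ext[OF comm_ring_hom_comp[OF h2 h2] h2]) (simp_all add: c x2 \<rho>2f r2.hom_add \<rho>g \<phi>f)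
    show "\<rho>1 (\<rho>2 x) = \<rho>2 (\<rho>1 x)" for x
      by (rule mpoly_hom_ext[OF comm_ring_hom_comp[OF h1 h2] comm_ring_hom_comp[OF h2 h1]])
         (use V in \<open>simp_all add: c x1 x2 \<rho>1f \<rho>2f r1.hom_add \<rho>g \<phi>f\<close>)
    show "\<rho>1 g2 = g2" "\<rho>2 g1 = g1" by (fact \<rho>g)+
    show "g1 \<noteq> 0" "g2 \<noteq> 0" unfolding g1_def g2_def by (rule xv_minus_nz[OF f(1) V(1)], rule xv_minus_nz[OF f(2) V(2)])
    show "hermite TYPE(('n, 'k) mpoly)" by (rule hermite_mpoly)
    show "free e" if "carr n n e" "e * e = e" for n and e :: "('n, 'k) mpoly fmat"
      by (rule qs_idempotents[OF finite_class.finite_UNIV that]) (simp add: fmat_eq_iff ent_fmap)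
  qed
  then show ?thesis unfolding \<rho>1_def \<rho>2_def \<phi>_def .
qed

lemma ret_polys_from: "f \<in> polys_from k \<Longrightarrow> ret (var_index ` {k..CARD('n)}) f = (f :: ('n::{finite, linorder}, 'k::field) mpoly)"
  by (rule poly_mapping_eqI) (auto simp: lookup_ret polys_from_def in_keys_iff)

lemma var_index_eq_iff:
  assumes "i \<in> {1..CARD('n)}" "j \<in> {1..CARD('n)}"
  shows "var_index i = (var_index j :: 'n::{finite, linorder}) \<longleftrightarrow> i = j"
  unfolding var_index_def using assms by (subst nth_eq_iff_index_eq) auto

theorem theorem4p4:
  fixes F :: "('n :: {finite, linorder}, 'k :: field) mpoly mat"
    and f\<^sub>1 f\<^sub>2 g\<^sub>1 g\<^sub>2 :: "('n, 'k) mpoly"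
    and l m p q :: nat
  assumes "CARD('n) \<ge> 2"
    and "F \<in> carrier_mat l m" and "l \<le> m"
    and "normal_rank F = l"
    and "f\<^sub>1 \<in> polys_from 2" and "g\<^sub>1 = x_var 1 - f\<^sub>1"
    and "f\<^sub>2 \<in> polys_from 3" and "g\<^sub>2 = x_var 2 - f\<^sub>2"
    and "p > 0" and "q > 0"
    and "is_gcd_of (minors l F) (g\<^sub>1 ^ p * g\<^sub>2 ^ q)"
  shows "equivalent_mat F (smith_form F) \<longleftrightarrow> (\<forall>k \<in> {1..l}. reduced_ideal k F = UNIV)"
proof -
  let ?X = "\<lambda>k. var_index ` {k..CARD('n)} :: 'n set"
  have x: "x_var k = (xv (var_index k) :: ('n, 'k) mpoly)" for k by (simp add: x_var_def xv_def)
  have out: "var_index i \<notin> ?X k" if "1 \<le> i" "i \<le> 2" "i < k" for i k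
  proof
    assume "var_index i \<in> ?X k"
    then obtain j where "j \<in> {k..CARD('n)}" "var_index i = (var_index j :: 'n)" by blast
    then show False using that assms(1) var_index_eq_iff[where ?'n = 'n, of i j] by simp
  qed
  have "var_index 1 \<noteq> (var_index 2 :: 'n)" using assms(1) by (subst var_index_eq_iff) auto
  then have "two_retractions (sb (xv(var_index 1 := f\<^sub>1)))
      (sb (xv(var_index 1 := g\<^sub>1 + sb (xv(var_index 2 := f\<^sub>2)) f\<^sub>1, var_index 2 := f\<^sub>2))) g\<^sub>1 g\<^sub>2"
    unfolding assms x
    by (intro two_retractions_mpoly[OF ret_polys_from[OF assms(5)] ret_polys_from[OF assms(7)]] out) auto
  then show ?thesis using assms by (intro two_retractions.smith_form_iff)
qed

end
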